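(* Let $p\ge1$, let $\rho$ be a nondegenerate (positive) $p\times p$ matrix measure on the unit circle with Lebesgue decomposition $d\rho(\theta)=\rho'(\theta)\,\frac{d\theta}{2\pi}+d\rho_s(\theta)$, where $\rho_s$ is the singular part, and let $\varphi_n$ ($n=0,1,2,\dots$) be the left orthonormal matrix polynomials with respect to $\rho$. Then $$\det\rho'(\theta)>0\quad\text{for almost every }\theta\in[0,2\pi)$$ if and only if $$\lim_{n\to\infty}\ \sup_{\ell\ge1}\ \frac1{2\pi}\int_0^{2\pi}\left\|\varphi_n(z)\,\varphi_{n+\ell}(z)^{-1}\,[\varphi_{n+\ell}(z)^*]^{-1}\,\varphi_n(z)^*-I\right\|_2\,d\theta=0,\qquad z=e^{i\theta}.$$
   Context: A (positive) $p\times p$ matrix measure $\rho$ on the unit circle $\mathbb{T}=\{z\in\mathbb{C}:|z|=1\}$ (identified with $[0,2\pi)$ via $z=e^{i\theta}$) is a finite countably additive Borel measure whose values are Hermitian positive semidefinite $p\times p$ complex matrices. Its absolutely continuous density with respect to $d\theta/2\pi$ is denoted $\rho'$, and its part singular with respect to Lebesgue measure is denoted $\rho_s$. It is nondegenerate if $\int_0^{2\pi} v(z)\,d\rho(\theta)\,v(z)^*>0$ for every nonzero row-vector polynomial $v$. $A^*$ denotes the Hermitian transpose of a matrix $A$, and $\|\cdot\|_2$ is the spectral norm (largest singular value). A matrix polynomial is a polynomial in $z$ with $p\times p$ complex matrix coefficients. The left orthonormal matrix polynomials $\varphi_n$ are matrix polynomials of degree $n$ with nonsingular leading coefficient such that $$\int_0^{2\pi}\varphi_n(z)\,d\rho(\theta)\,[\varphi_m(z)]^*=\delta_{m,n}I,\qquad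 z=e^{i\theta}.$$ They are unique up to left multiplication by a constant unitary matrix (the statement does not depend on this choice), and $\varphi_n(z)$ is invertible for every $z\in\mathbb{T}$. *)

theory Defs
  imports "HOL-Analysis.Analysis" "HOL-Computational_Algebra.Polynomial"
begin

text \<open>
  Complex numbers carry the order of \<^theory>\<open>HOL-Library.Complex_Order\<close>: for a complex number \<open>c\<close>,
  \<open>0 < c\<close> means that \<open>c\<close> is real and positive, and likewise for \<open>0 \<le> c\<close>.
\<close>

section \<open>Complex matrices\<close>

definition htranspose :: "complex^'n^'m \<Rightarrow> complex^'m^'n" where
  "htranspose A = map_matrix cnj (transpose A)"

text \<open>\<open>u A w\<^sup>*\<close> for row vectors \<open>u\<close> and \<open>w\<close>\<close>

definition row_form :: "complex^'p^'p \<Rightarrow> complex^'p \<Rightarrow> complex^'p \<Rightarrow> complex" where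
  "row_form A u w = (\<Sum>k\<in>UNIV. \<Sum>l\<in>UNIV. u $ k * A $ k $ l * cnj (w $ l))"

definition hermitian_psd :: "complex^'p^'p \<Rightarrow> bool" where
  "hermitian_psd A \<longleftrightarrow> htranspose A = A \<and> (\<forall>u. 0 \<le> row_form A u u)"

definition singular_values :: "complex^'p^'p \<Rightarrow> real set" where
  "singular_values A =
     {s. 0 \<le> s \<and> (\<exists>v. v \<noteq> 0 \<and> (htranspose A ** A) *v v = complex_of_real (s\<^sup>2) *s v)}"

text \<open>\<open>singular_values A\<close> is finite and nonempty, see \<open>spectral_norm_eq_onorm\<close> below.\<close>

definition spectral_norm :: "complex^'p^'p \<Rightarrow> real" where
  "spectral_norm A = Max (singular_values A)"


section \<open>Matrix measures on the unit circle\<close>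

text \<open>
  The unit circle is identified with \<open>[0, 2\<pi>)\<close> through \<open>z = cis \<theta>\<close>. A matrix measure is
  a function on sets of which only the values on Borel subsets of \<open>[0, 2\<pi>)\<close> matter.
\<close>

definition circle_borel :: "real measure" where
  "circle_borel = restrict_space borel {0..<2*pi}"

definition matrix_measure :: "(real set \<Rightarrow> complex^'p^'p) \<Rightarrow> bool" where
  "matrix_measure \<rho> \<longleftrightarrow>
     (\<forall>E\<in>sets circle_borel. hermitian_psd (\<rho> E)) \<and>
     (\<forall>A :: nat \<Rightarrow> real set. range A \<subseteq> sets circle_borel \<longrightarrow> disjoint_family A \<longrightarrow>
        (\<lambda>n. \<rho> (A n)) sums \<rho> (\<Union>n. A n))"

text \<open>The finite positive measure \<open>u \<rho> u\<^sup>*\<close>\<close>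

definition scalar_measure :: "(real set \<Rightarrow> complex^'p^'p) \<Rightarrow> complex^'p \<Rightarrow> real measure" where
  "scalar_measure \<rho> u = measure_of (space circle_borel) (sets circle_borel)
     (\<lambda>E. ennreal (Re (row_form (\<rho> E) u u)))"

text \<open>
  Integral with respect to the complex measure \<open>\<rho>\<^sub>k\<^sub>l\<close>. By polarization
  \<open>\<rho>\<^sub>k\<^sub>l = (1/4) (\<Sum>m<4. i\<^sup>m u\<^sub>m \<rho> u\<^sub>m\<^sup>*)\<close> with \<open>u\<^sub>m = e\<^sub>k + i\<^sup>m e\<^sub>l\<close>, which writes \<open>\<rho>\<^sub>k\<^sub>l\<close> as a
  linear combination of finite positive measures; compare \<open>entry_integral_indicator\<close> below.
\<close>

definition entry_integral ::
    "(real set \<Rightarrow> complex^'p^'p) \<Rightarrow> 'p \<Rightarrow> 'p \<Rightarrow> (real \<Rightarrow> complex) \<Rightarrow> complex" where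
  "entry_integral \<rho> k l f =
     (1/4) * (\<Sum>m<4. \<i> ^ m *
        (\<integral>\<theta>. f \<theta> \<partial>scalar_measure \<rho> (axis k 1 + \<i> ^ m *s axis l 1)))"

text \<open>\<open>\<integral> v(\<theta>) d\<rho>(\<theta>) w(\<theta>)\<^sup>*\<close> for row vectors \<open>v(\<theta>)\<close>, \<open>w(\<theta>)\<close>\<close>

definition row_integral ::
    "(real set \<Rightarrow> complex^'p^'p) \<Rightarrow> (real \<Rightarrow> complex^'p) \<Rightarrow> (real \<Rightarrow> complex^'p) \<Rightarrow> complex" where
  "row_integral \<rho> v w =
     (\<Sum>k\<in>UNIV. \<Sum>l\<in>UNIV. entry_integral \<rho> k l (\<lambda>\<theta>. v \<theta> $ k * cnj (w \<theta> $ l)))"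

text \<open>\<open>\<integral> F(\<theta>) d\<rho>(\<theta>) G(\<theta>)\<^sup>*\<close>, using that \<open>F(\<theta>) $ i\<close> is the \<open>i\<close>-th row of \<open>F(\<theta>)\<close>\<close>

definition matrix_integral ::
    "(real set \<Rightarrow> complex^'p^'p) \<Rightarrow> (real \<Rightarrow> complex^'p^'p) \<Rightarrow> (real \<Rightarrow> complex^'p^'p)
      \<Rightarrow> complex^'p^'p" where
  "matrix_integral \<rho> F G = (\<chi> i j. row_integral \<rho> (\<lambda>\<theta>. F \<theta> $ i) (\<lambda>\<theta>. G \<theta> $ j))"

definition singular_matrix_measure :: "(real set \<Rightarrow> complex^'p^'p) \<Rightarrow> bool" where
  "singular_matrix_measure \<rho> \<longleftrightarrow> matrix_measure \<rho> \<and>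
     (\<exists>N. N \<in> sets circle_borel \<and> N \<in> null_sets lborel \<and>
        (\<forall>E\<in>sets circle_borel. \<rho> (E - N) = 0))"

text \<open>\<open>d\<rho> = W d\<theta>/2\<pi> + d\<rho>\<^sub>s\<close> with \<open>\<rho>\<^sub>s\<close> singular; this determines \<open>W\<close> up to a Lebesgue-null set.\<close>

definition lebesgue_decomposition ::
    "(real set \<Rightarrow> complex^'p^'p) \<Rightarrow> (real \<Rightarrow> complex^'p^'p) \<Rightarrow> (real set \<Rightarrow> complex^'p^'p) \<Rightarrow> bool" where
  "lebesgue_decomposition \<rho> W \<rho>\<^sub>s \<longleftrightarrow>
     singular_matrix_measure \<rho>\<^sub>s \<and>
     set_integrable lborel {0..<2*pi} W \<and>
     (\<forall>E\<in>sets circle_borel. \<rho> E = (1 / (2*pi)) *\<^sub>R (LINT \<theta>:E|lborel. W \<theta>) + \<rho>\<^sub>s E)"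


section \<open>Vector and matrix polynomials\<close>

text \<open>
  The library function \<open>poly\<close> is not applicable: the product on \<^typ>\<open>complex^'p^'p\<close> coming from the
  type class is the entrywise one. Coefficients and degrees are those of the library.
\<close>

definition vec_poly_eval :: "(complex^'p) poly \<Rightarrow> complex \<Rightarrow> complex^'p" where
  "vec_poly_eval v z = (\<Sum>i\<le>degree v. z ^ i *s coeff v i)"

definition mat_poly_eval :: "(complex^'p^'p) poly \<Rightarrow> complex \<Rightarrow> complex^'p^'p" where
  "mat_poly_eval P z = (\<Sum>i\<le>degree P. mat (z ^ i) ** coeff P i)"

definition nondegenerate :: "(real set \<Rightarrow> complex^'p^'p) \<Rightarrow> bool" where
  "nondegenerate \<rho> \<longleftrightarrow> (\<forall>v :: (complex^'p) poly. v \<noteq> 0 \<longrightarrow>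
     0 < row_integral \<rho> (\<lambda>\<theta>. vec_poly_eval v (cis \<theta>)) (\<lambda>\<theta>. vec_poly_eval v (cis \<theta>)))"

definition left_orthonormal ::
    "(real set \<Rightarrow> complex^'p^'p) \<Rightarrow> (nat \<Rightarrow> (complex^'p^'p) poly) \<Rightarrow> bool" where
  "left_orthonormal \<rho> \<phi> \<longleftrightarrow>
     (\<forall>n. degree (\<phi> n) = n \<and> invertible (lead_coeff (\<phi> n))) \<and>
     (\<forall>n m. matrix_integral \<rho> (\<lambda>\<theta>. mat_poly_eval (\<phi> n) (cis \<theta>)) (\<lambda>\<theta>. mat_poly_eval (\<phi> m) (cis \<theta>))
        = (if m = n then mat 1 else 0))"


section \<open>Consistency of the definitions\<close>

lemma row_form_axis:
  "row_form A (axis k 1 + c *s axis l 1) (axis k 1 + c *s axis l 1) =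
     A $ k $ k + c * A $ l $ k + cnj c * A $ k $ l + c * cnj c * A $ l $ l"
proof -
  have e: "(axis k 1 + c *s axis l 1) $ j = (if j = k then 1 else 0) + (if j = l then c else 0)" for j
    by (simp add: axis_def)
  have *: "(\<Sum>j\<in>UNIV. (axis k 1 + c *s axis l 1) $ j * f j) = f k + c * f l" for f :: "'a \<Rightarrow> complex"
    unfolding e by (simp add: distrib_right sum.distrib if_distribR if_distrib[of "\<lambda>x. x * _"] cong: if_cong)
  have **: "(\<Sum>j\<in>UNIV. f j * cnj ((axis k 1 + c *s axis l 1) $ j)) = f k + cnj c * f l"
    for f :: "'a \<Rightarrow> complex"
    unfolding e by (simp add: distrib_left sum.distrib if_distrib[of cnj] if_distrib[of "\<lambda>x. _ * x"] cong: if_cong)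
  have "row_form A (axis k 1 + c *s axis l 1) (axis k 1 + c *s axis l 1) =
     (\<Sum>i\<in>UNIV. (axis k 1 + c *s axis l 1) $ i *
       (\<Sum>j\<in>UNIV. A $ i $ j * cnj ((axis k 1 + c *s axis l 1) $ j)))"
    by (simp only: row_form_def sum_distrib_left mult.assoc)
  also have "\<dots> = (A $ k $ k + cnj c * A $ k $ l) + c * (A $ l $ k + cnj c * A $ l $ l)"
    by (simp only: * **)
  finally show ?thesis by (simp add: algebra_simps)
qed

lemma row_form_linear: "bounded_linear (\<lambda>A. row_form A u u)"
  unfolding row_form_def
  by (intro bounded_linear_sum bounded_linear_mult_left[THEN bounded_linear_compose]
      bounded_linear_mult_right[THEN bounded_linear_compose]
      bounded_linear_vec_nth[THEN bounded_linear_compose] bounded_linear_vec_nth) 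

lemma emeasure_scalar_measure:
  assumes "matrix_measure \<rho>" "E \<in> sets circle_borel"
  shows "emeasure (scalar_measure \<rho> u) E = ennreal (Re (row_form (\<rho> E) u u))"
proof -
  have nn: "0 \<le> Re (row_form (\<rho> E) u u)" if "E \<in> sets circle_borel" for E
    using assms that by (auto simp: matrix_measure_def hermitian_psd_def less_eq_complex_def)
  have sums: "(\<lambda>n. Re (row_form (\<rho> (A n)) u u)) sums Re (row_form (\<rho> (\<Union>n. A n)) u u)"
    if "range A \<subseteq> sets circle_borel" "disjoint_family A" for A :: "nat \<Rightarrow> real set"
  proof -
    have "(\<lambda>n. \<rho> (A n)) sums \<rho> (\<Union>n. A n)"
      using assms that by (auto simp: matrix_measure_def)
    from bounded_linear.sums[OF bounded_linear_compose[OF bounded_linear_Re row_form_linear] this]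
    show ?thesis .
  qed
  have "(\<lambda>n. \<rho> {}) sums \<rho> {}"
    using assms(1) unfolding matrix_measure_def
    by (auto dest!: conjunct2 spec[of _ "\<lambda>_::nat. {}"] simp: disjoint_family_on_def)
  then have "(\<lambda>n::nat. \<rho> {}) \<longlonglongrightarrow> 0"
    by (rule sums_summable[THEN summable_LIMSEQ_zero])
  then have "\<rho> {} = 0" by (simp add: tendsto_const_iff)
  show ?thesis
  proof (rule emeasure_measure_of)
    show "scalar_measure \<rho> u = measure_of (space circle_borel) (sets circle_borel)
      (\<lambda>E. ennreal (Re (row_form (\<rho> E) u u)))"
      by (simp add: scalar_measure_def)
    show "sets circle_borel \<subseteq> Pow (space circle_borel)" by (rule sets.space_closed)
    show "E \<in> sets (scalar_measure \<rho> u)"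
      using assms(2) by (simp add: scalar_measure_def sets.space_closed sets.sigma_sets_eq)
    show "positive (sets (scalar_measure \<rho> u)) (\<lambda>E. ennreal (Re (row_form (\<rho> E) u u)))"
      using \<open>\<rho> {} = 0\<close> by (simp add: positive_def row_form_def)
    show "countably_additive (sets (scalar_measure \<rho> u)) (\<lambda>E. ennreal (Re (row_form (\<rho> E) u u)))"
    proof (rule countably_additiveI)
      fix A :: "nat \<Rightarrow> real set"
      assume "range A \<subseteq> sets (scalar_measure \<rho> u)" and d: "disjoint_family A"
      then have r: "range A \<subseteq> sets circle_borel"
        by (simp add: scalar_measure_def sets.space_closed sets.sigma_sets_eq)
      show "(\<Sum>i. ennreal (Re (row_form (\<rho> (A i)) u u)))
          = ennreal (Re (row_form (\<rho> (\<Union>i. A i)) u u))"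
        using sums[OF r d] nn r by (intro suminf_ennreal_eq) auto
    qed
  qed
qed

lemma entry_integral_indicator:
  assumes "matrix_measure \<rho>" "E \<in> sets circle_borel"
  shows "entry_integral \<rho> k l (indicator E) = \<rho> E $ k $ l"
proof -
  have psd: "hermitian_psd (\<rho> E)" using assms by (auto simp: matrix_measure_def)
  have *: "(\<integral>\<theta>. indicator E \<theta> \<partial>scalar_measure \<rho> u) = row_form (\<rho> E) u u" for u
  proof -
    have fin: "emeasure (scalar_measure \<rho> u) E < \<infinity>"
      using emeasure_scalar_measure[OF assms, of u] by simp
    have E: "E \<in> sets (scalar_measure \<rho> u)"
      using assms(2) by (simp add: scalar_measure_def sets.space_closed sets.sigma_sets_eq)
    have "(\<integral>\<theta>. indicator E \<theta> \<partial>scalar_measure \<rho> u)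
        = (\<integral>\<theta>. complex_of_real (indicator E \<theta>) \<partial>scalar_measure \<rho> u)"
      by (intro Bochner_Integration.integral_cong) (auto simp: indicator_def)
    also have "\<dots> = complex_of_real (\<integral>\<theta>. indicator E \<theta> \<partial>scalar_measure \<rho> u)"
      by (rule integral_complex_of_real)
    also have "\<dots> = complex_of_real (measure (scalar_measure \<rho> u) E)"
      using E sets.sets_into_space[OF E] by (simp add: Int_absorb2)
    also have "\<dots> = row_form (\<rho> E) u u"
      using psd emeasure_scalar_measure[OF assms, of u]
      by (auto simp: hermitian_psd_def less_eq_complex_def measure_def complex_eq_iff)
    finally show ?thesis .
  qed
  show ?thesis
    by (simp add: entry_integral_def * row_form_axis lessThan_nat_numeral lessThan_Suc
        eval_nat_numeral algebra_simps)
qed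

lemma inner_cnj: "inner x y = Re (x * cnj y)"
  by (simp add: inner_complex_def)

lemma inner_htranspose:
  fixes A :: "complex^'p^'p"
  shows "inner (A *v x) y = inner x (htranspose A *v y)"
proof -
  have "inner (A *v x) y = (\<Sum>i\<in>UNIV. \<Sum>j\<in>UNIV. Re (A $ i $ j * x $ j * cnj (y $ i)))"
    unfolding inner_vec_def inner_cnj
    by (simp only: matrix_vector_mult_def vec_lambda_beta sum_distrib_right Re_sum)
  also have "\<dots> = (\<Sum>j\<in>UNIV. \<Sum>i\<in>UNIV. Re (A $ i $ j * x $ j * cnj (y $ i)))"
    by (rule sum.swap)
  also have "\<dots> = inner x (htranspose A *v y)"
    unfolding inner_vec_def inner_cnj
    by (simp only: matrix_vector_mult_def sum_distrib_left htranspose_def transpose_def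
        nth_map_matrix vec_lambda_beta cnj_sum complex_cnj_mult complex_cnj_cnj Re_sum mult_ac)
  finally show ?thesis .
qed

lemma htranspose_htranspose [simp]: "htranspose (htranspose A) = A"
  by (simp add: htranspose_def transpose_def vec_eq_iff)

lemma of_real_vector_scale: "complex_of_real c *s v = c *\<^sub>R (v :: complex^'p)"
  by (simp add: vec_eq_iff) (simp add: scaleR_conv_of_real)

lemma spectral_norm_eq_onorm:
  fixes A :: "complex^'p^'p"
  shows "finite (singular_values A)" "singular_values A \<noteq> {}" "spectral_norm A = onorm ((*v) A)"
proof -
  define M where "M = htranspose A ** A"
  define \<sigma> where "\<sigma> = onorm ((*v) A)"
  have bl: "bounded_linear ((*v) B)" for B :: "complex^'p^'p"
  proof (intro linear_conv_bounded_linear[THEN iffD1] linearI)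
    show "B *v (r *\<^sub>R x) = r *\<^sub>R (B *v x)" for r x
      by (simp add: vec_eq_iff matrix_vector_mult_def scaleR_right.sum)
  qed (simp add: matrix_vector_right_distrib)
  have M: "M *v x = htranspose A *v (A *v x)" for x
    by (simp add: M_def matrix_vector_mul_assoc)
  have inner_M: "inner (M *v x) y = inner (A *v x) (A *v y)" for x y
    unfolding M by (simp add: inner_htranspose)
  have sv: "singular_values A = {s. 0 \<le> s \<and> (\<exists>v. v \<noteq> 0 \<and> M *v v = s\<^sup>2 *\<^sub>R v)}"
    by (simp only: singular_values_def M_def of_real_vector_scale)
  have \<sigma>0: "0 \<le> \<sigma>" unfolding \<sigma>_def by (rule onorm_pos_le[OF bl])
  have \<sigma>: "norm (A *v x) \<le> \<sigma> * norm x" for x unfolding \<sigma>_def by (rule onorm[OF bl])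

  show fin: "finite (singular_values A)"
  proof -
    obtain v where v: "\<And>s. s \<in> singular_values A \<Longrightarrow> v s \<noteq> 0 \<and> M *v v s = s\<^sup>2 *\<^sub>R v s"
    proof -
      have "\<forall>s\<in>singular_values A. \<exists>v. v \<noteq> 0 \<and> M *v v = s\<^sup>2 *\<^sub>R v" by (simp add: sv)
      from bchoice[OF this] that show thesis by blast
    qed
    have orth: "inner (v s) (v t) = 0"
      if "s \<in> singular_values A" "t \<in> singular_values A" "s \<noteq> t" for s t
    proof -
      have "s\<^sup>2 * inner (v s) (v t) = inner (M *v v s) (v t)" using v[OF that(1)] by simp
      also have "\<dots> = inner (M *v v t) (v s)" by (simp only: inner_M inner_commute[of "A *v v s"])
      also have "\<dots> = t\<^sup>2 * inner (v s) (v t)" using v[OF that(2)] by (simp add: inner_commute)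
      finally have "(s\<^sup>2 - t\<^sup>2) * inner (v s) (v t) = 0" by (simp add: algebra_simps)
      moreover have "s\<^sup>2 \<noteq> t\<^sup>2" using that by (auto simp: sv)
      ultimately show ?thesis by simp
    qed
    have inj: "inj_on v (singular_values A)"
    proof (rule inj_onI, rule ccontr)
      fix s t assume "s \<in> singular_values A" "t \<in> singular_values A" "v s = v t" "s \<noteq> t"
      with orth[of s t] v[of t] show False by simp
    qed
    have "independent (v ` singular_values A)"
    proof (rule pairwise_orthogonal_independent)
      show "pairwise orthogonal (v ` singular_values A)"
        using orth by (force simp: pairwise_def orthogonal_def)
      show "0 \<notin> v ` singular_values A" using v by force
    qed
    then have "finite (v ` singular_values A)" by (simp add: independent_bound)
    then show ?thesis using inj by (simp add: finite_image_iff)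
  qed

  have upper: "s \<le> \<sigma>" if s: "s \<in> singular_values A" for s
  proof -
    obtain v where v: "v \<noteq> 0" "M *v v = s\<^sup>2 *\<^sub>R v" and "0 \<le> s" using s by (auto simp: sv)
    have "(norm (A *v v))\<^sup>2 = inner (M *v v) v" by (simp add: inner_M power2_norm_eq_inner)
    also have "\<dots> = (s * norm v)\<^sup>2" by (simp add: v power_mult_distrib power2_norm_eq_inner)
    finally have "norm (A *v v) = s * norm v" using \<open>0 \<le> s\<close> by (simp add: power2_eq_iff_nonneg)
    with \<sigma>[of v] v show ?thesis by simp
  qed

  have mem: "\<sigma> \<in> singular_values A"
  proof -
    have "compact (sphere 0 1 :: (complex^'p) set)" by simp
    moreover have "sphere 0 1 \<noteq> ({} :: (complex^'p) set)" by simp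
    moreover have "continuous_on (sphere 0 1) (\<lambda>x. norm (A *v x))"
      by (intro continuous_on_norm linear_continuous_on bl)
    ultimately obtain v where v: "norm v = 1"
      and max: "\<And>x. norm x = 1 \<Longrightarrow> norm (A *v x) \<le> norm (A *v v)"
      using continuous_attains_sup[of "sphere 0 1" "\<lambda>x. norm (A *v x)"] by auto
    have "\<sigma> \<le> norm (A *v v)" unfolding \<sigma>_def
    proof (rule onorm_bound)
      show "norm (A *v x) \<le> norm (A *v v) * norm x" for x
      proof (cases "x = 0")
        case False
        have "norm (A *v ((1 / norm x) *\<^sub>R x)) \<le> norm (A *v v)" using False by (intro max) simp
        moreover have "A *v ((1 / norm x) *\<^sub>R x) = (1 / norm x) *\<^sub>R (A *v x)"
          using bl by (rule linear_simps(5))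
        ultimately show ?thesis using False by (simp add: field_simps)
      qed simp
    qed simp
    with \<sigma>[of v] v have eq: "norm (A *v v) = \<sigma>" by simp
    have le: "norm (M *v v) \<le> \<sigma>\<^sup>2"
    proof (cases "M *v v = 0")
      case False
      have "(norm (M *v v))\<^sup>2 = inner (A *v v) (A *v (M *v v))"
        by (simp add: power2_norm_eq_inner inner_M)
      also have "\<dots> \<le> norm (A *v v) * norm (A *v (M *v v))" by (rule norm_cauchy_schwarz)
      also have "\<dots> \<le> \<sigma> * (\<sigma> * norm (M *v v))"
        unfolding eq by (intro mult_left_mono \<sigma> \<sigma>0)
      finally show ?thesis using False by (simp add: power2_eq_square)
    qed simp
    have in1: "inner (M *v v) v = \<sigma>\<^sup>2" by (simp add: inner_M eq flip: power2_norm_eq_inner)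
    have "(norm (M *v v - \<sigma>\<^sup>2 *\<^sub>R v))\<^sup>2
        = (norm (M *v v))\<^sup>2 - 2 * \<sigma>\<^sup>2 * inner (M *v v) v + (\<sigma>\<^sup>2)\<^sup>2 * (norm v)\<^sup>2"
      unfolding power2_norm_eq_inner
      by (simp add: inner_diff_left inner_diff_right inner_commute power2_eq_square algebra_simps)
    also have "\<dots> = (norm (M *v v))\<^sup>2 - (\<sigma>\<^sup>2)\<^sup>2"
      unfolding in1 v by (simp add: power2_eq_square algebra_simps)
    also have "\<dots> \<le> 0" using power_mono[OF le, of 2] by simp
    finally have "M *v v = \<sigma>\<^sup>2 *\<^sub>R v" by simp
    moreover have "v \<noteq> 0" using v by auto
    ultimately show ?thesis using \<sigma>0 by (auto simp: sv)
  qed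
  then show "singular_values A \<noteq> {}" by auto
  show "spectral_norm A = onorm ((*v) A)"
    unfolding spectral_norm_def \<sigma>_def[symmetric] using fin upper mem by (intro Max_eqI)
qed

end

theory Submission
  imports Defs
begin

text \<open>
  Write \<open>dm = d\<theta>/2\<pi>\<close>, \<open>W = \<rho>'\<close>, \<open>F\<^sub>m = (\<phi>\<^sub>m\<^sup>* \<phi>\<^sub>m)\<^sup>-\<^sup>1\<close>, \<open>A\<^sub>n = \<phi>\<^sub>n W \<phi>\<^sub>n\<^sup>*\<close> and
  \<open>G\<^sub>n\<^sub>m = \<phi>\<^sub>n F\<^sub>m \<phi>\<^sub>n\<^sup>*\<close>. The measures \<open>\<rho>\<close> and \<open>F\<^sub>m dm\<close> have the same moments of order at most \<open>m\<close>:
  compression of the multiplication by \<open>z\<close> to the row polynomials of degree less than \<open>m\<close> is an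
  operator \<open>T\<close> that depends on \<open>\<phi>\<^sub>m\<close> only, it satisfies \<open>\<langle>q, r\<rangle> = \<langle>T q, T r\<rangle> + const\<close> for both inner
  products with the same constant, and \<open>T\<^sup>k q\<close> tends to \<open>0\<close>.

  Suppose that \<open>W\<close> is positive definite almost everywhere. Choose a matrix trigonometric polynomial \<open>H\<close>
  close to \<open>W\<^sup>-\<^sup>1\<close>. For large \<open>n\<close> the integral of \<open>tr A\<^sub>n + tr (H F\<^sub>n)\<close> is at most about \<open>2p\<close>, while
  pointwise this is about \<open>tr (A\<^sub>n + A\<^sub>n\<^sup>-\<^sup>1)\<close>, which exceeds \<open>2p\<close> unless \<open>A\<^sub>n\<close> is the identity. So \<open>A\<^sub>n\<close>
  tends to the identity in measure. Where \<open>A\<^sub>n\<close> and \<open>A\<^sub>m\<close> are close to the identity, so is \<open>G\<^sub>n\<^sub>m\<close>; as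
  \<open>G\<^sub>n\<^sub>m\<close> is positive with integral \<open>I\<close>, it converges in \<open>L\<^sup>1\<close> by the argument of Scheffe's lemma.

  Conversely, letting \<open>m\<close> tend to infinity shows that the entries of \<open>A\<^sub>n - I\<close> have small integrals over
  all sets which do not meet the support of the singular part. On the set where \<open>W\<close> is singular these
  entries cannot all be small, so this set is null.
\<close>

section \<open>Positive semidefinite complex matrices\<close>

text \<open>For each \<open>m\<close> only the moments up to order \<open>m\<close> carry over from
  \<open>\<rho>\<close> to \<open>F m\<close>, so an indicator can be integrated only through a
  trigonometric polynomial; and \<open>\<rho>\<close> may charge a null set \<open>N\<close>. Both
  difficulties are met by approximating the indicator of a set \<open>E\<close> disjoint from
  \<open>N\<close> at once in the Lebesgue measure and in all measures \<open>u \<rho> u*\<close> of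
  the polarization: the polynomial is then small on the singular part too. The mass lost to the
  singular part is why the integral of \<open>A n\<close> is only bounded above by the identity,
  which is the direction that the trace argument uses. The inverse of \<open>W\<close> need not be
  integrable, so \<open>H\<close> is not an approximation of it in norm. Up to a set of small
  measure the circle is cut into finitely many sets \<open>E j\<close> on which \<open>W\<close> is
  within a relative error \<open>e\<close> of a constant matrix \<open>V j\<close>, and
  \<open>H\<close> is the sum of the \<open>g j * V j^-1\<close>, where \<open>g j\<close> is a
  polynomial close to the indicator of \<open>E j\<close>. In the converse the supremum over
  \<open>l\<close> makes it possible to fix \<open>n\<close> first and to choose \<open>m\<close>
  afterwards, as large as the degree of the approximating polynomial requires.\<close>

lemma row_form_add_left: "row_form A (u + v) w = row_form A u w + row_form A v w"
  by (simp add: row_form_def algebra_simps sum.distrib)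

lemma row_form_add_right: "row_form A u (v + w) = row_form A u v + row_form A u w"
  by (simp add: row_form_def algebra_simps sum.distrib)

lemma row_form_scale_left: "row_form A (c *s u) w = c * row_form A u w"
  by (simp add: row_form_def algebra_simps sum_distrib_left)

lemma row_form_scale_right: "row_form A u (c *s w) = cnj c * row_form A u w"
  by (simp add: row_form_def algebra_simps sum_distrib_left)

lemma row_form_zero_left [simp]: "row_form A 0 w = 0"
  and row_form_zero_right [simp]: "row_form A w 0 = 0"
  and row_form_zero_matrix [simp]: "row_form 0 u w = 0"
  by (simp_all add: row_form_def)

lemma row_form_sum_left: "row_form A (\<Sum>i\<in>I. f i) w = (\<Sum>i\<in>I. row_form A (f i) w)"
  by (induction I rule: infinite_finite_induct) (simp_all add: row_form_add_left)

lemma row_form_sum_right: "row_form A w (\<Sum>i\<in>I. f i) = (\<Sum>i\<in>I. row_form A w (f i))"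
  by (induction I rule: infinite_finite_induct) (simp_all add: row_form_add_right)

lemma row_form_add_matrix: "row_form (A + B) u w = row_form A u w + row_form B u w"
  by (simp add: row_form_def algebra_simps sum.distrib)

lemma row_form_diff_matrix: "row_form (A - B) u w = row_form A u w - row_form B u w"
  by (simp add: row_form_def algebra_simps sum_subtractf)

lemma row_form_scaleR_matrix: "row_form (c *\<^sub>R A) u w = c * row_form A u w"
  by (simp add: row_form_def scaleR_conv_of_real[where 'a=complex] sum_distrib_left mult_ac)

lemma row_form_axis_axis: "row_form A (axis k 1) (axis l 1) = A $ k $ l"
proof -
  have "row_form A (axis k 1) (axis l 1)
      = (\<Sum>i\<in>UNIV. if i = k then \<Sum>j\<in>UNIV. if j = l then A $ i $ j else 0 else 0)"
    unfolding row_form_def by (intro sum.cong) (auto simp: axis_def if_distrib cong: if_cong)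
  then show ?thesis by simp
qed

lemma row_form_eq_vector_matrix: "row_form A u w = (\<Sum>l\<in>UNIV. (u v* A) $ l * cnj (w $ l))"
  unfolding row_form_def
  by (subst sum.swap) (simp add: vector_matrix_mult_def sum_distrib_right)

lemma row_form_mult: "row_form (A ** B) u w = row_form B (u v* A) w"
  by (simp add: row_form_eq_vector_matrix vector_matrix_mul_assoc)

lemma row_form_htranspose: "row_form (htranspose A) u w = cnj (row_form A w u)"
  unfolding row_form_def htranspose_def
  by (subst sum.swap) (simp add: transpose_def mult_ac)

lemma htranspose_mult: "htranspose (A ** B) = htranspose B ** htranspose A"
  by (simp add: htranspose_def transpose_def matrix_matrix_mult_def vec_eq_iff mult_ac)

lemma htranspose_mat1 [simp]: "htranspose (mat 1) = mat 1"
  by (simp add: htranspose_def transpose_def mat_def vec_eq_iff)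

lemma row_form_mult_htranspose: "row_form (A ** htranspose B) u w = row_form A u (w v* B)"
proof -
  have "row_form (A ** htranspose B) u w = cnj (row_form (B ** htranspose A) w u)"
    by (simp add: htranspose_mult flip: row_form_htranspose)
  also have "\<dots> = cnj (row_form (htranspose A) (w v* B) u)" by (simp add: row_form_mult)
  finally show ?thesis by (simp add: row_form_htranspose)
qed

text \<open>A congruence of matrices is a substitution in the form. Estimates for \<open>A\<close>,
  \<open>G\<close> and \<open>F\<close> are later transported through this identity.\<close>

lemma row_form_congruence:
  fixes P Q A :: "complex^'p^'p"
  shows "row_form (P ** A ** htranspose Q) u w = row_form A (u v* P) (w v* Q)"
  by (subst row_form_mult_htranspose) (rule row_form_mult)

lemma row_form_mat1: "row_form (mat 1) u u = complex_of_real ((norm u)\<^sup>2)"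
proof -
  have "row_form (mat 1) u u = (\<Sum>k\<in>UNIV. \<Sum>l\<in>UNIV. if l = k then u $ k * cnj (u $ l) else 0)"
    unfolding row_form_def mat_def by (intro sum.cong) auto
  then show ?thesis
    by (simp add: norm_vec_def L2_set_def sum_nonneg flip: complex_norm_square)
qed

lemma hermitian_row_form_commute:
  assumes "htranspose A = A"
  shows "row_form A u w = cnj (row_form A w u)"
  using row_form_htranspose[of A u w] assms by simp

lemma hermitian_row_form_real:
  assumes "htranspose A = A"
  shows "row_form A u u = complex_of_real (Re (row_form A u u))"
  using hermitian_row_form_commute[OF assms, of u u] by (simp add: complex_eq_iff)

lemma hermitian_psdI:
  assumes "htranspose A = A" "\<And>u. 0 \<le> Re (row_form A u u)"
  shows "hermitian_psd A"
  using assms hermitian_row_form_real[OF assms(1)]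
  by (auto simp: hermitian_psd_def less_eq_complex_def complex_eq_iff)

lemma hermitian_psd_nonneg:
  assumes "hermitian_psd A"
  shows "0 \<le> Re (row_form A u u)"
  using assms by (auto simp: hermitian_psd_def less_eq_complex_def)

text \<open>The form may be degenerate, so \<open>w\<close> cannot be normalized; nonnegativity of
  the form along the line through \<open>u\<close> in a complex multiple of the direction
  \<open>w\<close> is used instead.\<close>

lemma hermitian_psd_Cauchy_Schwarz:
  assumes "hermitian_psd A"
  shows "(cmod (row_form A u w))\<^sup>2 \<le> Re (row_form A u u) * Re (row_form A w w)"
proof -
  define a b c where "a = Re (row_form A u u)" and "b = row_form A u w" and "c = Re (row_form A w w)"
  have h: "htranspose A = A" using assms by (simp add: hermitian_psd_def)
  have *: "0 \<le> a + 2 * s * (cmod b)\<^sup>2 + s\<^sup>2 * (cmod b)\<^sup>2 * c" for s :: real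
  proof -
    \<comment> \<open>A real multiple of \<open>b\<close> has the right phase: both cross terms
      become the real number \<open>s * (cmod b)^2\<close>.\<close>
    define t where "t = complex_of_real s * b"
    have "0 \<le> Re (row_form A (u + t *s w) (u + t *s w))"
      by (rule hermitian_psd_nonneg[OF assms])
    also have "row_form A (u + t *s w) (u + t *s w)
        = row_form A u u + cnj t * b + t * cnj b + t * cnj t * row_form A w w"
      using hermitian_row_form_commute[OF h, of w u]
      by (simp add: row_form_add_left row_form_add_right row_form_scale_left row_form_scale_right b_def algebra_simps)
    also have "Re \<dots> = a + 2 * s * (cmod b)\<^sup>2 + s\<^sup>2 * (cmod b)\<^sup>2 * c"
    proof -
      have "t * cnj b = of_real (s * (cmod b)\<^sup>2)" "cnj t * b = of_real (s * (cmod b)\<^sup>2)"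
        "t * cnj t = of_real (s\<^sup>2 * (cmod b)\<^sup>2)"
        using complex_norm_square[of b]
        by (simp_all add: t_def mult_ac power2_eq_square)
      then show ?thesis by (simp only: plus_complex.sel Re_complex_of_real a_def c_def times_complex.sel Im_complex_of_real)
    qed
    finally show ?thesis .
  qed
  show ?thesis
  proof (cases "b = 0")
    case True
    then show ?thesis
      using hermitian_psd_nonneg[OF assms] by (simp add: b_def)
  next
    case False
    then have pos: "(cmod b)\<^sup>2 > 0" by simp
    have "c \<ge> 0" using hermitian_psd_nonneg[OF assms] by (simp add: c_def)
    show ?thesis
    proof (cases "c = 0")
      case True
      \<comment> \<open>For \<open>c = 0\<close> the expression is affine in \<open>s\<close>; this
        \<open>s\<close> gives it the value \<open>-1\<close>.\<close>
      with *[of "- (a + 1) / (2 * (cmod b)\<^sup>2)"] pos show ?thesis by (simp add: field_simps)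
    next
      case False
      with \<open>c \<ge> 0\<close> have "c > 0" by simp
      \<comment> \<open>The quadratic in \<open>s\<close> attains its minimum at
        \<open>- 1 / c\<close>.\<close>
      have "0 \<le> a - (cmod b)\<^sup>2 / c"
        using *[of "- 1 / c"] \<open>c > 0\<close> by (simp add: power2_eq_square field_simps)
      then have "(cmod b)\<^sup>2 \<le> a * c" using \<open>c > 0\<close> by (simp add: field_simps)
      then show ?thesis by (simp add: a_def b_def c_def)
    qed
  qed
qed

lemma Re_trace: "Re (trace A) = (\<Sum>i\<in>UNIV. Re (row_form A (axis i 1) (axis i 1)))"
  by (simp add: trace_def row_form_axis_axis)

lemma hermitian_psd_trace_nonneg: "hermitian_psd A \<Longrightarrow> 0 \<le> Re (trace A)"
  unfolding Re_trace by (intro sum_nonneg hermitian_psd_nonneg)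

text \<open>The trace bounds the largest eigenvalue, here without diagonalization: with
  \<open>d\<close> the roots of the diagonal, entries are dominated by \<open>d k * d l\<close>, so
  the form is dominated by a rank-one form, and the squares of \<open>d\<close> sum to the
  trace.\<close>

lemma row_form_le_trace:
  assumes "hermitian_psd A"
  shows "Re (row_form A x x) \<le> Re (trace A) * (norm x)\<^sup>2"
proof -
  define d where "d = (\<lambda>k. sqrt (Re (A $ k $ k)))"
  have d0: "0 \<le> Re (A $ k $ k)" for k
    using hermitian_psd_nonneg[OF assms, of "axis k 1"] by (simp add: row_form_axis_axis)
  have A: "cmod (A $ k $ l) \<le> d k * d l" for k l
  proof -
    have "(cmod (A $ k $ l))\<^sup>2 \<le> (d k * d l)\<^sup>2"
      using hermitian_psd_Cauchy_Schwarz[OF assms, of "axis k 1" "axis l 1"] d0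
      by (simp add: row_form_axis_axis d_def power_mult_distrib)
    then show ?thesis by (rule power2_le_imp_le) (simp add: d_def d0)
  qed
  have "Re (row_form A x x) \<le> cmod (row_form A x x)" by (rule complex_Re_le_cmod)
  also have "\<dots> \<le> (\<Sum>k\<in>UNIV. \<Sum>l\<in>UNIV. cmod (x $ k) * (d k * d l) * cmod (x $ l))"
    unfolding row_form_def
    by (intro sum_norm_le) (auto simp: norm_mult intro!: sum_norm_le mult_right_mono mult_left_mono A)
  also have "\<dots> = (\<Sum>k\<in>UNIV. cmod (x $ k) * d k) * (\<Sum>l\<in>UNIV. cmod (x $ l) * d l)"
    unfolding sum_product by (simp add: mult_ac)
  also have "\<dots> = (\<Sum>k\<in>UNIV. cmod (x $ k) * d k)\<^sup>2" by (simp add: power2_eq_square)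
  also have "\<dots> \<le> (\<Sum>k\<in>UNIV. (cmod (x $ k))\<^sup>2) * (\<Sum>k\<in>UNIV. (d k)\<^sup>2)"
    by (rule Cauchy_Schwarz_ineq_sum)
  also have "(\<Sum>k\<in>UNIV. (d k)\<^sup>2) = Re (trace A)"
    by (simp add: d_def d0 trace_def)
  also have "(\<Sum>k\<in>UNIV. (cmod (x $ k))\<^sup>2) = (norm x)\<^sup>2"
    by (simp add: norm_vec_def L2_set_def sum_nonneg)
  finally show ?thesis by (simp add: mult_ac)
qed

section \<open>Spectral norm of positive semidefinite matrices\<close>

lemma bounded_linear_matrix_vector: "bounded_linear ((*v) (A :: complex^'n^'m))"
proof (intro linear_conv_bounded_linear[THEN iffD1] linearI)
  show "A *v (r *\<^sub>R x) = r *\<^sub>R (A *v x)" for r x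
    by (simp add: vec_eq_iff matrix_vector_mult_def scaleR_right.sum)
qed (simp add: matrix_vector_right_distrib)

text \<open>\<open>row_form\<close> is conjugate linear in its right argument while
  \<open>A *v x\<close> is linear in \<open>x\<close>. Conjugating the vector translates between
  them, so that estimates for rows reach the column-based \<open>spectral_norm\<close>.\<close>

definition conj_vec :: "complex^'n \<Rightarrow> complex^'n" where
  "conj_vec x = (\<chi> i. cnj (x $ i))"

lemma norm_conj_vec [simp]: "norm (conj_vec x) = norm x"
  by (simp add: conj_vec_def norm_vec_def)

lemma row_form_conj_vec:
  "row_form A u (conj_vec x) = (\<Sum>k\<in>UNIV. u $ k * (A *v x) $ k)"
  by (simp add: row_form_def conj_vec_def matrix_vector_mult_def sum_distrib_left mult_ac)

lemma row_form_conj_vec_self: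
  "row_form A (conj_vec (A *v x)) (conj_vec x) = complex_of_real ((norm (A *v x))\<^sup>2)"
  unfolding row_form_conj_vec
  by (simp add: conj_vec_def norm_vec_def L2_set_def sum_nonneg flip: complex_norm_square) (simp add: mult.commute flip: complex_norm_square)

text \<open>Cauchy-Schwarz for the form at \<open>conj_vec (A *v x)\<close> and
  \<open>conj_vec x\<close> has the fourth power of the norm of \<open>A *v x\<close> on the left.
  \<open>row_form_le_trace\<close> bounds both factors on the right, and two powers cancel.\<close>

lemma spectral_norm_psd_le_trace:
  assumes "hermitian_psd A"
  shows "spectral_norm A \<le> Re (trace A)"
proof -
  let ?t = "Re (trace A)"
  have t: "0 \<le> ?t" by (rule hermitian_psd_trace_nonneg[OF assms])
  show ?thesis unfolding spectral_norm_eq_onorm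
  proof (rule onorm_bound[OF t])
    fix x
    let ?y = "norm (A *v x)"
    have "(?y\<^sup>2)\<^sup>2 \<le> (?t * ?y\<^sup>2) * (?t * (norm x)\<^sup>2)"
      using hermitian_psd_Cauchy_Schwarz[OF assms, of "conj_vec (A *v x)" "conj_vec x"]
        mult_mono[OF row_form_le_trace[OF assms, of "conj_vec (A *v x)"]
          row_form_le_trace[OF assms, of "conj_vec x"]] t hermitian_psd_nonneg[OF assms]
      by (simp add: row_form_conj_vec_self norm_power)
    then have "?y\<^sup>2 * ?y\<^sup>2 \<le> ?y\<^sup>2 * (?t * norm x)\<^sup>2"
      by (simp add: power2_eq_square mult_ac)
    then have "?y = 0 \<or> ?y\<^sup>2 \<le> (?t * norm x)\<^sup>2"
      by (metis mult_le_cancel_left_pos zero_eq_power2 zero_le_power2 order_le_less)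
    then show "?y \<le> ?t * norm x"
      using t by (auto intro: power2_le_imp_le)
  qed
qed

lemma spectral_norm_add_le: "spectral_norm (A + B) \<le> spectral_norm A + spectral_norm B"
  using onorm_triangle[OF bounded_linear_matrix_vector bounded_linear_matrix_vector, of A B]
  by (simp add: spectral_norm_eq_onorm matrix_vector_mult_add_rdistrib[abs_def])

lemma spectral_norm_scaleR_mat1: "spectral_norm (c *\<^sub>R (mat 1 :: complex^'p^'p)) \<le> \<bar>c\<bar>"
  unfolding spectral_norm_eq_onorm
proof (rule onorm_bound)
  fix x :: "complex^'p"
  have "(c *\<^sub>R mat 1) *v x = c *\<^sub>R x"
    by (simp add: vec_eq_iff matrix_vector_mult_def mat_def if_distrib if_distribR cong: if_cong)
  then show "norm ((c *\<^sub>R mat 1) *v x) \<le> \<bar>c\<bar> * norm x" by simp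
qed simp

lemma norm_entry_le_spectral_norm:
  fixes A :: "complex^'n^'n"
  shows "cmod (A $ i $ j) \<le> spectral_norm A"
proof -
  have "cmod (A $ i $ j) = cmod ((A *v axis j 1) $ i)"
    by (simp add: matrix_vector_mult_def axis_def if_distrib cong: if_cong)
  also have "\<dots> \<le> norm (A *v axis j 1)" by (rule Finite_Cartesian_Product.norm_nth_le)
  also have "\<dots> \<le> onorm ((*v) A) * norm (axis j (1::complex))"
    by (rule onorm[OF bounded_linear_matrix_vector])
  finally show ?thesis by (simp add: spectral_norm_eq_onorm)
qed

lemma spectral_norm_nonneg: "0 \<le> spectral_norm A"
  using norm_entry_le_spectral_norm[of A] norm_ge_zero order_trans by blast

section \<open>Positive definite matrices, inverses and congruences\<close>

definition posdef :: "complex^'p^'p \<Rightarrow> bool" where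
  "posdef A \<longleftrightarrow> htranspose A = A \<and> (\<forall>x. x \<noteq> 0 \<longrightarrow> 0 < Re (row_form A x x))"

lemma posdef_imp_psd: "posdef A \<Longrightarrow> hermitian_psd A"
  unfolding posdef_def by (intro hermitian_psdI) (auto, metis less_eq_real_def row_form_zero_left zero_complex.sel(1))

lemma matrix_inv:
  fixes A :: "complex^'n^'n"
  assumes "invertible A"
  shows "A ** matrix_inv A = mat 1" "matrix_inv A ** A = mat 1"
  using someI_ex[OF assms[unfolded invertible_def]] by (simp_all add: matrix_inv_def)

lemma matrix_inv_unique:
  fixes A :: "complex^'n^'n"
  assumes "A ** B = mat 1"
  shows "matrix_inv A = B" "invertible A"
proof -
  show i: "invertible A" using assms invertible_right_inverse by blast
  have "matrix_inv A = matrix_inv A ** (A ** B)" by (simp add: assms)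
  also have "\<dots> = B" by (simp only: matrix_mul_assoc matrix_inv[OF i] matrix_mul_lid)
  finally show "matrix_inv A = B" .
qed

lemma matrix_inv_htranspose:
  fixes A :: "complex^'n^'n"
  assumes "invertible A"
  shows "matrix_inv (htranspose A) = htranspose (matrix_inv A)" "invertible (htranspose A)"
proof -
  have "htranspose A ** htranspose (matrix_inv A) = mat 1"
    by (simp add: matrix_inv[OF assms] flip: htranspose_mult)
  then show "matrix_inv (htranspose A) = htranspose (matrix_inv A)" "invertible (htranspose A)"
    using matrix_inv_unique by blast+
qed

lemma posdef_invertible:
  assumes "posdef A"
  shows "invertible A"
  unfolding invertible_left_inverse matrix_left_invertible_injective
proof (rule injI)
  fix x y assume eq: "A *v x = A *v y"
  have "A *v (x - y) = 0" using eq by (simp add: matrix_vector_mult_diff_distrib)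
  then have "row_form A (conj_vec (x - y)) (conj_vec (x - y)) = 0"
    by (simp add: row_form_conj_vec)
  then have "conj_vec (x - y) = 0" using assms by (force simp: posdef_def)
  then have "norm (x - y) = 0" by (metis norm_conj_vec norm_zero)
  then show "x = y" by simp
qed

lemma hermitian_inverse:
  fixes A :: "complex^'n^'n"
  assumes "htranspose A = A" "invertible A"
  shows "htranspose (matrix_inv A) = matrix_inv A"
  using matrix_inv_htranspose(1)[OF assms(2)] assms(1) by simp

lemma row_form_matrix_inv:
  assumes "htranspose A = A" "invertible A"
  shows "row_form A (y v* matrix_inv A) (y v* matrix_inv A) = row_form (matrix_inv A) y y"
proof -
  have "row_form A (y v* matrix_inv A) (y v* matrix_inv A)
      = row_form (matrix_inv A ** A ** htranspose (matrix_inv A)) y y"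
    by (simp add: row_form_congruence)
  then show ?thesis by (simp add: matrix_inv assms hermitian_inverse)
qed

lemma posdef_matrix_inv:
  assumes "posdef A"
  shows "posdef (matrix_inv A)"
proof -
  have h: "htranspose A = A" and i: "invertible A"
    using assms posdef_invertible by (auto simp: posdef_def)
  have "0 < Re (row_form (matrix_inv A) y y)" if "y \<noteq> 0" for y
  proof -
    have "y v* matrix_inv A \<noteq> 0"
    proof
      assume "y v* matrix_inv A = 0"
      then have "y v* (matrix_inv A ** A) = 0" by (simp flip: vector_matrix_mul_assoc)
      with that show False by (simp add: matrix_inv i)
    qed
    with assms have "0 < Re (row_form A (y v* matrix_inv A) (y v* matrix_inv A))"
      by (simp add: posdef_def)
    then show ?thesis by (simp add: row_form_matrix_inv h i)
  qed
  then show ?thesis by (simp add: posdef_def hermitian_inverse h i)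
qed

lemma posdef_congruence:
  fixes A P :: "complex^'n^'n"
  assumes "posdef A" "invertible P"
  shows "posdef (P ** A ** htranspose P)"
proof -
  have "x v* P \<noteq> 0" if "x \<noteq> 0" for x
  proof
    assume "x v* P = 0"
    then have "x v* (P ** matrix_inv P) = 0" by (simp flip: vector_matrix_mul_assoc)
    with that assms show False by (simp add: matrix_inv)
  qed
  with assms show ?thesis
    by (auto simp: posdef_def row_form_congruence htranspose_mult matrix_mul_assoc)
qed

lemma hermitian_psd_congruence:
  fixes A P :: "complex^'n^'n"
  assumes "hermitian_psd A"
  shows "hermitian_psd (P ** A ** htranspose P)"
  using assms by (auto simp: hermitian_psd_def row_form_congruence htranspose_mult matrix_mul_assoc)

lemma posdef_mat1: "posdef (mat 1)"
  by (simp add: posdef_def row_form_mat1)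

text \<open>Cauchy-Schwarz for \<open>B\<close> at \<open>y v* matrix_inv B\<close> and
  \<open>y\<close>: the mixed value is the squared norm of \<open>y\<close>, and the form of
  \<open>B\<close> at the first vector is that of the inverse at \<open>y\<close>.\<close>

lemma posdef_inverse_pairing:
  assumes "posdef B"
  shows "((norm y)\<^sup>2)\<^sup>2 \<le> Re (row_form B y y) * Re (row_form (matrix_inv B) y y)"
proof -
  have h: "htranspose B = B" and i: "invertible B"
    using assms posdef_invertible by (auto simp: posdef_def)
  have "row_form B (y v* matrix_inv B) y = row_form (mat 1) y y"
    using row_form_mult[of "matrix_inv B" B y y] by (simp add: matrix_inv i)
  then have "row_form B (y v* matrix_inv B) y = complex_of_real ((norm y)\<^sup>2)"
    by (simp add: row_form_mat1)
  with hermitian_psd_Cauchy_Schwarz[OF posdef_imp_psd[OF assms], of "y v* matrix_inv B" y]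
  show ?thesis by (simp add: row_form_matrix_inv h i mult.commute norm_power)
qed

text \<open>\<open>B + B\<^sup>-\<^sup>1 - 2\<close> is positive semidefinite, so its trace bounds it on every unit vector.\<close>

lemma posdef_trace_inverse:
  fixes B :: "complex^'p^'p"
  assumes B: "posdef B" and "norm x = 1"
  shows "Re (row_form B x x) + 1 / Re (row_form B x x) - 2
      \<le> Re (trace B) + Re (trace (matrix_inv B)) - 2 * CARD('p)"
proof -
  let ?M = "B + matrix_inv B - 2 *\<^sub>R mat 1"
  have h: "htranspose B = B" and i: "invertible B"
    using assms posdef_invertible by (auto simp: posdef_def)
  have lin: "htranspose (C + D) = htranspose C + htranspose D" "htranspose (C - D) = htranspose C - htranspose D"
    "htranspose (r *\<^sub>R C) = r *\<^sub>R htranspose C" for C D :: "complex^'p^'p" and r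
    by (simp_all add: htranspose_def transpose_def vec_eq_iff)
  have M: "Re (row_form ?M y y) = Re (row_form B y y) + Re (row_form (matrix_inv B) y y) - 2 * (norm y)\<^sup>2" for y
    by (simp add: row_form_diff_matrix row_form_add_matrix row_form_scaleR_matrix row_form_mat1)
  have "0 \<le> Re (row_form ?M y y)" for y
  proof -
    define a b where "a = Re (row_form B y y)" and "b = Re (row_form (matrix_inv B) y y)"
    have ab: "0 \<le> a" "0 \<le> b"
      using hermitian_psd_nonneg posdef_imp_psd B posdef_matrix_inv by (auto simp: a_def b_def)
    have "((norm y)\<^sup>2)\<^sup>2 \<le> a * b" using posdef_inverse_pairing[OF B] by (simp add: a_def b_def)
    also have "\<dots> \<le> ((a + b) / 2)\<^sup>2"
      using zero_le_power2[of "a - b"] by (simp add: power2_eq_square field_simps)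
    finally have "(norm y)\<^sup>2 \<le> (a + b) / 2" by (rule power2_le_imp_le) (use ab in simp)
    then show ?thesis unfolding M by (simp add: a_def b_def)
  qed
  then have "hermitian_psd ?M"
    by (intro hermitian_psdI) (simp_all add: lin h i hermitian_inverse)
  from row_form_le_trace[OF this, of x] have "Re (row_form ?M x x) \<le> Re (trace ?M)"
    by (simp add: assms)
  also have "Re (trace ?M) = Re (trace B) + Re (trace (matrix_inv B)) - 2 * CARD('p)"
    by (simp add: trace_def mat_def sum.distrib sum_subtractf)
  finally have le: "Re (row_form B x x) + Re (row_form (matrix_inv B) x x) - 2
      \<le> Re (trace B) + Re (trace (matrix_inv B)) - 2 * CARD('p)"
    unfolding M by (simp add: assms)
  have "x \<noteq> 0" using assms by auto
  then have pos: "0 < Re (row_form B x x)" using B by (simp add: posdef_def)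
  have "1 / Re (row_form B x x) \<le> Re (row_form (matrix_inv B) x x)"
    using posdef_inverse_pairing[OF B, of x] pos by (simp add: assms field_simps)
  with le show ?thesis by simp
qed

section \<open>Determinants and positive definiteness\<close>

lemma det_htranspose: "det (htranspose A) = cnj (det A)"
proof -
  have "det (map_matrix cnj B) = cnj (det B)" for B :: "complex^'a^'a"
    by (simp add: det_def)
  then show ?thesis by (simp add: htranspose_def)
qed

lemma continuous_on_det:
  fixes f :: "'a::topological_space \<Rightarrow> complex^'n^'n"
  assumes "\<And>i j. continuous_on S (\<lambda>x. f x $ i $ j)"
  shows "continuous_on S (\<lambda>x. det (f x))"
  unfolding det_def by (intro continuous_intros assms)

text \<open>On the segment from the identity to \<open>A\<close> all matrices are positive definite,
  so the determinant is real and never 0 there. It starts at 1 and cannot change sign.\<close>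

lemma posdef_det_pos:
  fixes A :: "complex^'p^'p"
  assumes "posdef A"
  shows "0 < det A"
proof -
  define M where "M = (\<lambda>t::real. (1 - t) *\<^sub>R (mat 1 :: complex^'p^'p) + t *\<^sub>R A)"
  have pd: "posdef (M t)" if "0 \<le> t" "t \<le> 1" for t
  proof -
    have "0 < (1 - t) * (norm x)\<^sup>2 + t * Re (row_form A x x)" if "x \<noteq> 0" for x
    proof (cases "t = 1")
      case False
      have "0 \<le> t * Re (row_form A x x)"
        using \<open>0 \<le> t\<close> hermitian_psd_nonneg posdef_imp_psd assms by (intro mult_nonneg_nonneg) auto
      moreover have "0 < (1 - t) * (norm x)\<^sup>2" using False \<open>t \<le> 1\<close> that by simp
      ultimately show ?thesis by simp
    qed (use assms that in \<open>simp add: posdef_def\<close>)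
    moreover have "htranspose (M t) = M t"
      using assms htranspose_mat1[where 'a='p]
      unfolding posdef_def M_def by (simp add: htranspose_def transpose_def vec_eq_iff mat_def)
    ultimately show ?thesis
      by (simp add: posdef_def M_def row_form_add_matrix row_form_scaleR_matrix row_form_mat1)
  qed
  have real: "Im (det (M t)) = 0" and nz: "det (M t) \<noteq> 0" if "0 \<le> t" "t \<le> 1" for t
  proof -
    have "htranspose (M t) = M t" using pd[OF that] by (simp add: posdef_def)
    with det_htranspose[of "M t"] have "cnj (det (M t)) = det (M t)" by simp
    then show "Im (det (M t)) = 0" by (simp add: complex_eq_iff)
    show "det (M t) \<noteq> 0" using posdef_invertible[OF pd[OF that]] invertible_det_nz by blast
  qed
  have "continuous_on {0..1} (\<lambda>t. Re (det (M t)))"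
    unfolding M_def by (intro continuous_intros continuous_on_det)
  have "0 < Re (det A)"
  proof (rule ccontr)
    assume "\<not> 0 < Re (det A)"
    then have "Re (det (M 1)) \<le> 0" by (simp add: M_def)
    moreover have "0 \<le> Re (det (M 0))" by (simp add: M_def)
    ultimately obtain t where "0 \<le> t" "t \<le> 1" "Re (det (M t)) = 0"
      using IVT2'[of "\<lambda>t. Re (det (M t))" 1 0 0] \<open>continuous_on {0..1} (\<lambda>t. Re (det (M t)))\<close> by auto
    with real[of t] nz[of t] show False by (simp add: complex_eq_iff)
  qed
  moreover have "Im (det A) = 0" using real[of 1] by (simp add: M_def)
  ultimately show ?thesis by (simp add: less_complex_def)
qed

lemma psd_kernel:
  assumes "hermitian_psd A" "Re (row_form A x x) = 0"
  shows "row_form A x y = 0"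
  using hermitian_psd_Cauchy_Schwarz[OF assms(1), of x y] assms(2) by simp

text \<open>This turns the condition on \<open>det\<close> in the theorem into one on quadratic
  forms. By \<open>psd_kernel\<close> a vector on which the form vanishes is annihilated by
  \<open>A\<close>, which invertibility excludes.\<close>

lemma psd_det_pos_iff:
  assumes "hermitian_psd A"
  shows "0 < det A \<longleftrightarrow> posdef A"
proof
  assume "0 < det A"
  then have i: "invertible A" by (auto simp: invertible_det_nz)
  have "Re (row_form A x x) \<noteq> 0" if "x \<noteq> 0" for x
  proof
    assume *: "Re (row_form A x x) = 0"
    have "(x v* A) $ l = 0" for l
    proof -
      have "row_form (mat 1) (x v* A) (axis l 1) = 0"
        using psd_kernel[OF assms *, of "axis l 1"] row_form_mult[of A "mat 1"] by simp
      moreover have "row_form (mat 1) (x v* A) (axis l 1)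
          = (\<Sum>i\<in>UNIV. \<Sum>j\<in>UNIV. if i = j then if j = l then (x v* A) $ i else 0 else 0)"
        unfolding row_form_def mat_def axis_def by (intro sum.cong) auto
      ultimately show ?thesis by simp
    qed
    then have "x v* A = 0" by (simp add: vec_eq_iff)
    then have "x v* (A ** matrix_inv A) = 0" by (simp flip: vector_matrix_mul_assoc)
    with i that show False by (simp add: matrix_inv)
  qed
  moreover have "0 \<le> Re (row_form A x x)" for x by (rule hermitian_psd_nonneg[OF assms])
  ultimately show "posdef A"
    using assms unfolding posdef_def hermitian_psd_def by (metis order_le_less)
qed (rule posdef_det_pos)

text \<open>Multiplying the last hypothesis by \<open>b\<close> gives
  \<open>(b - 1)^2 \<le> b * \<eta>^2 / 4\<close>. With \<open>\<eta> \<le> 1\<close> this yields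
  the crude bound \<open>b \<le> 4\<close>, which is then inserted into the same inequality.\<close>

lemma abs_diff_one_le:
  fixes b \<eta> :: real
  assumes "0 < b" "0 < \<eta>" "\<eta> \<le> 1" "b + 1 / b - 2 \<le> \<eta>\<^sup>2 / 4"
  shows "\<bar>b - 1\<bar> \<le> \<eta>"
proof -
  have "b * (b + 1 / b - 2) \<le> b * (\<eta>\<^sup>2 / 4)" using assms by (intro mult_left_mono) auto
  then have *: "(b - 1)\<^sup>2 \<le> b * \<eta>\<^sup>2 / 4" using assms by (simp add: power2_eq_square algebra_simps)
  have "\<eta>\<^sup>2 \<le> 1" using assms by (simp add: power_le_one)
  then have "b * \<eta>\<^sup>2 \<le> b * 1" using assms by (intro mult_left_mono) auto
  with * have "(b - 1)\<^sup>2 \<le> b / 4" by simp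
  then have "b \<le> 4"
  proof (rule contrapos_pp)
    assume "\<not> b \<le> 4"
    then have "3 * (b - 1) < (b - 1) * (b - 1)" by (intro mult_strict_right_mono) auto
    with \<open>\<not> b \<le> 4\<close> show "\<not> (b - 1)\<^sup>2 \<le> b / 4" by (simp add: power2_eq_square)
  qed
  then have "b * \<eta>\<^sup>2 \<le> 4 * \<eta>\<^sup>2" by (intro mult_right_mono) auto
  with * have "(b - 1)\<^sup>2 \<le> \<eta>\<^sup>2" by simp
  then have "\<bar>b - 1\<bar> \<le> \<bar>\<eta>\<bar>" using abs_le_square_iff by blast
  then show ?thesis using assms by simp
qed

section \<open>Trigonometric polynomials\<close>

text \<open>The degree bound is carried along because Bernstein-Szego integrals agree only up to a
  given order. Adding one monomial at a time makes a linear identity an induction with one monomial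
  per step.\<close>

inductive trig :: "nat \<Rightarrow> (real \<Rightarrow> complex) \<Rightarrow> bool" for n where
  trig_zero: "trig n (\<lambda>_. 0)"
| trig_step: "\<bar>k\<bar> \<le> int n \<Longrightarrow> trig n f \<Longrightarrow> trig n (\<lambda>\<theta>. c * cis (of_int k * \<theta>) + f \<theta>)"

lemma trig_add: "trig n f \<Longrightarrow> trig n g \<Longrightarrow> trig n (\<lambda>\<theta>. f \<theta> + g \<theta>)"
  by (induction rule: trig.induct) (simp_all add: add.assoc trig_step)

lemma trig_monomial: "\<bar>k\<bar> \<le> int n \<Longrightarrow> trig n (\<lambda>\<theta>. c * cis (of_int k * \<theta>))"
  using trig_step[OF _ trig_zero] by simp

lemma trig_const: "trig n (\<lambda>_. c)"
  using trig_monomial[of 0 n c] by simp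

lemma trig_mono: "trig n f \<Longrightarrow> n \<le> m \<Longrightarrow> trig m f"
  by (induction rule: trig.induct) (auto intro: trig_zero trig_step)

lemma trig_sum: "(\<And>i. i \<in> I \<Longrightarrow> trig n (f i)) \<Longrightarrow> trig n (\<lambda>\<theta>. \<Sum>i\<in>I. f i \<theta>)"
  by (induction I rule: infinite_finite_induct) (auto intro: trig_zero trig_add)

lemma trig_mult:
  assumes "trig n f" "trig m g"
  shows "trig (n + m) (\<lambda>\<theta>. f \<theta> * g \<theta>)"
  using assms(1)
proof (induction rule: trig.induct)
  case (trig_step k f c)
  have "trig (n + m) (\<lambda>\<theta>. c * cis (of_int k * \<theta>) * g \<theta>)"
    using assms(2)
  proof (induction rule: trig.induct)
    case (trig_step l g d)
    have "trig (n + m) (\<lambda>\<theta>. (c * d) * cis (of_int (k + l) * \<theta>))"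
      using trig_step \<open>\<bar>k\<bar> \<le> int n\<close> by (intro trig_monomial) auto
    from trig_add[OF this trig_step.IH] show ?case
      by (simp add: cis_mult[symmetric] algebra_simps)
  qed (simp add: trig_zero)
  from trig_add[OF this trig_step.IH] show ?case by (simp add: distrib_right)
qed (simp add: trig_zero)

lemma trig_cnj: "trig n f \<Longrightarrow> trig n (\<lambda>\<theta>. cnj (f \<theta>))"
proof (induction rule: trig.induct)
  case (trig_step k f c)
  then have "trig n (\<lambda>\<theta>. cnj c * cis (of_int (- k) * \<theta>) + cnj (f \<theta>))"
    by (intro trig.trig_step) auto
  then show ?case by (simp add: cis_cnj)
qed (simp add: trig_zero)

lemma trig_continuous: "trig n f \<Longrightarrow> continuous_on S f"
  by (induction rule: trig.induct) (auto intro!: continuous_intros)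

lemma trig_bounded: "trig n f \<Longrightarrow> \<exists>B. \<forall>\<theta>. cmod (f \<theta>) \<le> B"
proof (induction rule: trig.induct)
  case (trig_step k f c)
  then obtain B where B: "\<And>\<theta>. cmod (f \<theta>) \<le> B" by auto
  have "cmod (c * cis (of_int k * \<theta>) + f \<theta>) \<le> cmod c + B" for \<theta>
    by (rule norm_triangle_le) (simp add: norm_mult B add_mono)
  then show ?case by blast
qed auto

text \<open>A real linear functional restricted to the circle is a combination of
  \<open>cis \<theta>\<close> and \<open>cis (- \<theta>)\<close>. So Stone-Weierstrass on the
  circle delivers trigonometric polynomials.\<close>

lemma trig_real_polynomial:
  assumes "real_polynomial_function q"
  shows "\<exists>n. trig n (\<lambda>\<theta>. complex_of_real (q (cis \<theta>)))"
  using assms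
proof (induction rule: real_polynomial_function.induct)
  case (linear f)
  define a b where "a = complex_of_real (f 1)" and "b = complex_of_real (f \<i>)"
  have "complex_of_real (f (cis \<theta>)) = (a - \<i> * b) / 2 * cis (of_int 1 * \<theta>)
      + ((a + \<i> * b) / 2 * cis (of_int (- 1) * \<theta>) + 0)" for \<theta>
  proof -
    have "cis \<theta> = cos \<theta> *\<^sub>R 1 + sin \<theta> *\<^sub>R \<i>" by (simp add: complex_eq_iff)
    then have "f (cis \<theta>) = cos \<theta> * f 1 + sin \<theta> * f \<i>"
      by (simp add: linear_simps[OF linear])
    then show ?thesis by (simp add: a_def b_def complex_eq_iff field_simps)
  qed
  then have "trig 1 (\<lambda>\<theta>. complex_of_real (f (cis \<theta>)))"
    by (simp only:) (intro trig_step trig_zero; simp)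
  then show ?case by blast
next
  case (add f g)
  then obtain n m where "trig n (\<lambda>\<theta>. complex_of_real (f (cis \<theta>)))" "trig m (\<lambda>\<theta>. complex_of_real (g (cis \<theta>)))"
    by auto
  then have "trig (max n m) (\<lambda>\<theta>. complex_of_real (f (cis \<theta>)) + complex_of_real (g (cis \<theta>)))"
    by (intro trig_add) (auto elim: trig_mono)
  then show ?case by auto
next
  case (mult f g)
  then show ?case using trig_mult by fastforce
qed (blast intro: trig_const)

text \<open>Regularity of \<open>\<tau>\<close> encloses \<open>E\<close> between a compact and an
  open set, Urysohn on the circle interpolates, and Stone-Weierstrass replaces the interpolant by a
  polynomial. As \<open>E\<close> avoids the point 0, where \<open>cis\<close> glues the ends of the
  interval, the sets stay disjoint on the circle.\<close>

lemma trig_approx_indicator: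
  fixes \<tau> :: "real measure"
  assumes sets: "sets \<tau> = sets borel" and "finite_measure \<tau>"
    and conc: "emeasure \<tau> (- {0..<2*pi}) = 0"
    and E: "E \<in> sets borel" "E \<subseteq> {0<..<2*pi}" and "0 < \<delta>"
  obtains n g where "trig n (\<lambda>\<theta>. complex_of_real (g \<theta>))" "\<And>\<theta>. 0 \<le> g \<theta>" "\<And>\<theta>. g \<theta> \<le> 1 + \<delta>"
    "(\<integral>\<theta>. \<bar>g \<theta> - indicator E \<theta>\<bar> \<partial>\<tau>) \<le> \<delta>"
proof -
  interpret finite_measure \<tau> by fact
  have space: "space \<tau> = UNIV" using sets_eq_imp_space_eq[OF sets] by simp
  note [measurable_cong] = sets
  define M where "M = measure \<tau> UNIV"
  have "0 \<le> M" by (simp add: M_def)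
  \<comment> \<open>The uniform error enters as \<open>2 * e\<close>: once for the approximation and
    once for the shift that makes \<open>g\<close> nonnegative. It may cost
    \<open>\<delta> / 2\<close> in the integral and \<open>\<delta>\<close> pointwise.\<close>
  define e where "e = \<delta> / (4 * (M + 1))"
  have "0 < e" using \<open>0 < \<delta>\<close> \<open>0 \<le> M\<close> by (simp add: e_def)
  have eM: "2 * e * M \<le> \<delta> / 2" and e\<delta>: "2 * e \<le> \<delta>"
    using \<open>0 < \<delta>\<close> \<open>0 \<le> M\<close> by (simp_all add: e_def field_simps)
  have fin: "emeasure \<tau> (space \<tau>) \<noteq> \<infinity>" by simp
  obtain K where K: "K \<subseteq> E" "compact K" "measure \<tau> E < measure \<tau> K + \<delta> / 4"
  proof (cases "measure \<tau> E < \<delta> / 4")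
    case True
    with that[of "{}"] show thesis by simp
  next
    case False
    have "ennreal (measure \<tau> E - \<delta> / 4) < ennreal (measure \<tau> E)"
      using False \<open>0 < \<delta>\<close> by (intro ennreal_lessI) auto
    also have "\<dots> = (SUP K \<in> {K. K \<subseteq> E \<and> compact K}. emeasure \<tau> K)"
      using inner_regular[OF sets fin E(1)] by (simp add: emeasure_eq_measure)
    finally obtain K where "K \<subseteq> E" "compact K" "ennreal (measure \<tau> E - \<delta> / 4) < emeasure \<tau> K"
      by (auto simp: less_SUP_iff)
    then show thesis using that[of K] False by (simp add: emeasure_eq_measure ennreal_less_iff)
  qed
  obtain U where U: "E \<subseteq> U" "open U" "measure \<tau> U < measure \<tau> E + \<delta> / 4"
  proof -
    have "(INF U \<in> {U. E \<subseteq> U \<and> open U}. emeasure \<tau> U) = emeasure \<tau> E"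
      by (rule outer_regular[OF sets fin E(1), symmetric])
    also have "\<dots> < ennreal (measure \<tau> E + \<delta> / 4)"
      unfolding emeasure_eq_measure using \<open>0 < \<delta>\<close> by (intro ennreal_lessI) (auto intro: add_nonneg_pos)
    finally have "(INF U \<in> {U. E \<subseteq> U \<and> open U}. emeasure \<tau> U) < ennreal (measure \<tau> E + \<delta> / 4)" .
    then show thesis using that by (auto simp: INF_less_iff emeasure_eq_measure ennreal_less_iff)
  qed
  have [measurable]: "K \<in> sets borel" "U \<in> sets borel"
    using K U by (auto intro: borel_closed compact_imp_closed)
  define V where "V = U \<inter> {0<..<2*pi}"
  have V: "E \<subseteq> V" "open V" "V \<subseteq> U" using U E by (auto simp: V_def)
  have [measurable]: "V \<in> sets borel" using V by simp
  have VK: "measure \<tau> (V - K) \<le> \<delta> / 2"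
  proof -
    note K(3) U(3)
    moreover have "measure \<tau> V \<le> measure \<tau> U" using V by (intro finite_measure_mono) auto
    moreover have "measure \<tau> (V - K) = measure \<tau> V - measure \<tau> K"
      using K V by (intro finite_measure_Diff) auto
    ultimately show ?thesis by simp
  qed
  \<comment> \<open>\<open>x\<close> is interior while \<open>y\<close> may be an end of the
    interval. This separates the image of \<open>K\<close> from the image of everything outside
    \<open>V\<close>, both ends included.\<close>
  have inj: "x = y" if "x \<in> {0<..<2*pi}" "y \<in> {0..2*pi}" "cis x = cis y" for x y
  proof -
    from \<open>cis x = cis y\<close> obtain n where n: "x = y + 2 * pi * of_int n"
      using sin_cos_eq_iff[of x y] by (auto simp: complex_eq_iff mult_ac)
    then have "of_int n * (2 * pi) = x - y" by simp
    then have "of_int n * (2 * pi) < 1 * (2 * pi)" "(- 1) * (2 * pi) < of_int n * (2 * pi)"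
      using that by auto
    then have "real_of_int n < 1" "- 1 < real_of_int n"
      by (meson mult_less_cancel_right_pos pi_gt_zero zero_less_mult_iff zero_less_numeral)+
    then have "n = 0" by linarith
    then show ?thesis using n by simp
  qed
  define S T where "S = cis ` K" and "T = cis ` ({0..2*pi} - V)"
  have "closed S" unfolding S_def
    by (intro compact_imp_closed compact_continuous_image K continuous_intros)
  moreover have "closed T" unfolding T_def
    by (intro compact_imp_closed compact_continuous_image compact_diff V continuous_intros) simp
  moreover have "S \<inter> T = {}"
    using inj K(1) E(2) V(1) unfolding S_def T_def by blast
  ultimately obtain f :: "complex \<Rightarrow> real" where f: "continuous_on UNIV f" "\<And>x. f x \<in> closed_segment 1 0"
    "\<And>x. x \<in> S \<Longrightarrow> f x = 1" "\<And>x. x \<in> T \<Longrightarrow> f x = 0"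
    by (rule Urysohn) blast
  have f01: "0 \<le> f x" "f x \<le> 1" for x
    using f(2)[of x] by (auto simp: closed_segment_eq_real_ivl)
  obtain q where q: "real_polynomial_function q" "\<And>x. x \<in> sphere 0 1 \<Longrightarrow> \<bar>f x - q x\<bar> < e"
    using Stone_Weierstrass_real_polynomial_function[OF _ continuous_on_subset[OF f(1)] \<open>0 < e\<close>, of "sphere 0 1"]
    by auto
  have qe: "\<bar>f (cis \<theta>) - q (cis \<theta>)\<bar> < e" for \<theta> by (rule q) simp
  obtain n where n: "trig n (\<lambda>\<theta>. complex_of_real (q (cis \<theta>)))" using trig_real_polynomial[OF q(1)] by auto
  define g where "g = (\<lambda>\<theta>. q (cis \<theta>) + e)"
  have "trig n (\<lambda>\<theta>. complex_of_real (g \<theta>))"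
    using trig_add[OF n trig_const[of n "of_real e"]] by (simp add: g_def)
  moreover have "0 \<le> g \<theta>" "g \<theta> \<le> 1 + \<delta>" for \<theta>
    using qe[of \<theta>] f01[of "cis \<theta>"] e\<delta> by (auto simp: g_def)
  moreover have "(\<integral>\<theta>. \<bar>g \<theta> - indicator E \<theta>\<bar> \<partial>\<tau>) \<le> \<delta>"
  proof -
    have "continuous_on UNIV (\<lambda>\<theta>. complex_of_real (g \<theta>))"
      by (rule trig_continuous) fact
    from continuous_on_Re[OF this] have "continuous_on UNIV g" by simp
    then have [measurable]: "g \<in> borel_measurable borel" by (rule borel_measurable_continuous_onI)
    have "AE \<theta> in \<tau>. \<theta> \<in> {0..<2*pi}"
      by (rule AE_I[OF _ conc]) (auto simp: sets)
    then have "AE \<theta> in \<tau>. \<bar>g \<theta> - indicator E \<theta>\<bar> \<le> indicator (V - K) \<theta> + 2 * e"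
    proof eventually_elim
      case (elim \<theta>)
      have "\<bar>g \<theta> - f (cis \<theta>)\<bar> \<le> 2 * e" using qe[of \<theta>] by (simp add: g_def)
      moreover have "\<bar>f (cis \<theta>) - indicator E \<theta>\<bar> \<le> indicator (V - K) \<theta>"
      proof (cases "\<theta> \<in> V")
        case True
        then show ?thesis
          using f01[of "cis \<theta>"] f(3)[of "cis \<theta>"] K(1) by (auto simp: S_def indicator_def)
      next
        case False
        then have "f (cis \<theta>) = 0" using elim by (intro f(4)) (auto simp: T_def)
        then show ?thesis using False V(1) by (auto simp: indicator_def)
      qed
      ultimately show ?case by linarith
    qed
    then have "(\<integral>\<theta>. \<bar>g \<theta> - indicator E \<theta>\<bar> \<partial>\<tau>) \<le> (\<integral>\<theta>. indicator (V - K) \<theta> + 2 * e \<partial>\<tau>)"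
      by (intro integral_mono_AE' ) (auto simp: integrable_indicator_iff emeasure_eq_measure)
    also have "\<dots> = measure \<tau> (V - K) + 2 * e * M"
      by (subst Bochner_Integration.integral_add)
        (auto simp: integrable_indicator_iff emeasure_eq_measure M_def space)
    finally show ?thesis using VK eM by simp
  qed
  ultimately show thesis by (rule that)
qed

section \<open>Normalized Lebesgue measure on the circle\<close>

lemma borel_measurable_vec_nth_comp [measurable (raw)]:
  fixes f :: "'a \<Rightarrow> ('b::euclidean_space)^'n"
  assumes "f \<in> borel_measurable M"
  shows "(\<lambda>x. f x $ i) \<in> borel_measurable M"
  by (rule measurable_compose[OF assms])
    (intro borel_measurable_continuous_onI continuous_intros)

lemma borel_measurable_row_form [measurable (raw)]:
  assumes [measurable]: "A \<in> borel_measurable M" "u \<in> borel_measurable M" "w \<in> borel_measurable M"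
  shows "(\<lambda>x. row_form (A x) (u x) (w x)) \<in> borel_measurable M"
proof -
  have [measurable]: "(\<lambda>x. A x $ k $ l) \<in> borel_measurable M" for k l
    by (rule measurable_compose[OF assms(1)])
      (intro borel_measurable_continuous_onI continuous_intros)
  have [measurable]: "cnj \<in> borel_measurable borel"
    by (intro borel_measurable_continuous_onI continuous_intros)
  show ?thesis unfolding row_form_def by measurable
qed

lemma row_form_integral:
  assumes "integrable M A"
  shows "row_form (\<integral>x. A x \<partial>M) u u = (\<integral>x. row_form (A x) u u \<partial>M)"
    and "integrable M (\<lambda>x. row_form (A x) u u)"
  using integral_bounded_linear[OF row_form_linear assms] integrable_bounded_linear[OF row_form_linear assms]
  by simp_all

text \<open>Normalized Lebesgue measure on the circle, placed as a probability measure on the Borel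
  sets of the whole line, so that measurability always refers to \<open>borel\<close>.\<close>

definition circ :: "real measure" where
  "circ = density lborel (\<lambda>\<theta>. ennreal (indicator {0..<2*pi} \<theta> / (2*pi)))"

lemma sets_circ [simp, measurable_cong]: "sets circ = sets borel"
  by (simp add: circ_def)

lemma space_circ [simp]: "space circ = UNIV"
  by (simp add: circ_def)

lemma nn_integral_circ:
  assumes "f \<in> borel_measurable borel"
  shows "(\<integral>\<^sup>+\<theta>. f \<theta> \<partial>circ) = ennreal (1 / (2*pi)) * (\<integral>\<^sup>+\<theta>\<in>{0..<2*pi}. f \<theta> \<partial>lborel)"
proof -
  have "(\<integral>\<^sup>+\<theta>. f \<theta> \<partial>circ) = (\<integral>\<^sup>+\<theta>. ennreal (indicator {0..<2*pi} \<theta> / (2*pi)) * f \<theta> \<partial>lborel)"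
    unfolding circ_def using assms by (intro nn_integral_density) auto
  also have "\<dots> = (\<integral>\<^sup>+\<theta>. ennreal (1 / (2*pi)) * (f \<theta> * indicator {0..<2*pi} \<theta>) \<partial>lborel)"
    by (intro nn_integral_cong) (auto simp: indicator_def)
  also have "\<dots> = ennreal (1 / (2*pi)) * (\<integral>\<^sup>+\<theta>\<in>{0..<2*pi}. f \<theta> \<partial>lborel)"
    using assms by (intro nn_integral_cmult) auto
  finally show ?thesis .
qed

lemma emeasure_circ:
  assumes "E \<in> sets borel"
  shows "emeasure circ E = ennreal (1 / (2*pi)) * emeasure lborel (E \<inter> {0..<2*pi})"
  using nn_integral_circ[of "indicator E"] assms
  by (simp add: indicator_inter_arith[symmetric])

lemma emeasure_circ_UNIV: "emeasure circ UNIV = 1"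
  by (subst emeasure_circ) (simp_all flip: ennreal_mult)

lemma finite_measure_circ: "finite_measure circ"
  by (rule finite_measureI) (simp add: emeasure_circ_UNIV)

interpretation circ: finite_measure circ by (rule finite_measure_circ)

lemma measure_circ_UNIV [simp]: "measure circ UNIV = 1"
  by (simp add: measure_def emeasure_circ_UNIV)

lemma AE_circ: "(AE \<theta> in circ. P \<theta>) \<longleftrightarrow> (AE \<theta> in lborel. \<theta> \<in> {0..<2*pi} \<longrightarrow> P \<theta>)"
proof -
  have "0 < ennreal (indicator {0..<2*pi} \<theta> / (2*pi)) \<longleftrightarrow> \<theta> \<in> {0..<2*pi}" for \<theta> :: real
    by (auto simp: indicator_def)
  moreover have "(\<lambda>\<theta>. ennreal (indicator {0..<2*pi} \<theta> / (2*pi))) \<in> borel_measurable lborel"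
    by measurable
  ultimately show ?thesis unfolding circ_def by (simp only: AE_density)
qed

lemma integral_circ:
  fixes f :: "real \<Rightarrow> 'b::{banach, second_countable_topology}"
  assumes "f \<in> borel_measurable borel"
  shows "(\<integral>\<theta>. f \<theta> \<partial>circ) = (1 / (2*pi)) *\<^sub>R (\<integral>\<theta>. indicator {0..<2*pi} \<theta> *\<^sub>R f \<theta> \<partial>lborel)"
    and "integrable circ f \<longleftrightarrow> integrable lborel (\<lambda>\<theta>. indicator {0..<2*pi} \<theta> *\<^sub>R f \<theta>)"
proof -
  have *: "(indicator {0..<2*pi} \<theta> / (2*pi)) *\<^sub>R f \<theta> = (1 / (2*pi)) *\<^sub>R (indicator {0..<2*pi} \<theta> *\<^sub>R f \<theta>)" for \<theta>
    by simp
  have "(\<integral>\<theta>. f \<theta> \<partial>circ) = (\<integral>\<theta>. (indicator {0..<2*pi} \<theta> / (2*pi)) *\<^sub>R f \<theta> \<partial>lborel)"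
    unfolding circ_def using assms by (intro integral_density) auto
  also have "\<dots> = (1 / (2*pi)) *\<^sub>R (\<integral>\<theta>. indicator {0..<2*pi} \<theta> *\<^sub>R f \<theta> \<partial>lborel)"
    unfolding * by (rule integral_scaleR_right)
  finally show "(\<integral>\<theta>. f \<theta> \<partial>circ) = (1 / (2*pi)) *\<^sub>R (\<integral>\<theta>. indicator {0..<2*pi} \<theta> *\<^sub>R f \<theta> \<partial>lborel)" .
  have "integrable circ f \<longleftrightarrow> integrable lborel (\<lambda>\<theta>. (indicator {0..<2*pi} \<theta> / (2*pi)) *\<^sub>R f \<theta>)"
    unfolding circ_def using assms by (intro integrable_density) auto
  then show "integrable circ f \<longleftrightarrow> integrable lborel (\<lambda>\<theta>. indicator {0..<2*pi} \<theta> *\<^sub>R f \<theta>)"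
  proof (simp only: *, intro iffI)
    assume "integrable lborel (\<lambda>\<theta>. (1 / (2*pi)) *\<^sub>R (indicator {0..<2*pi} \<theta> *\<^sub>R f \<theta>))"
    from integrable_scaleR_right[OF this, of "2 * pi"]
    show "integrable lborel (\<lambda>\<theta>. indicator {0..<2*pi} \<theta> *\<^sub>R f \<theta>)" by simp
  next
    assume "integrable lborel (\<lambda>\<theta>. indicator {0..<2*pi} \<theta> *\<^sub>R f \<theta>)"
    then show "integrable lborel (\<lambda>\<theta>. (1 / (2*pi)) *\<^sub>R (indicator {0..<2*pi} \<theta> *\<^sub>R f \<theta>))"
      by (rule integrable_scaleR_right)
  qed
qed

lemma trig_measurable: "trig n f \<Longrightarrow> f \<in> borel_measurable borel"
  by (intro borel_measurable_continuous_onI trig_continuous)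

lemma AE_nonneg_of_integrals:
  fixes f :: "'a \<Rightarrow> real"
  assumes int: "integrable M f" and S: "S \<in> sets M"
    and pos: "\<And>E. E \<in> sets M \<Longrightarrow> E \<subseteq> S \<Longrightarrow> 0 \<le> (\<integral>x. indicator E x * f x \<partial>M)"
  shows "AE x in M. x \<in> S \<longrightarrow> 0 \<le> f x"
proof -
  note [measurable] = S borel_measurable_integrable[OF int]
  define E where "E = {x\<in>space M. x \<in> S \<and> f x < 0}"
  have E [measurable]: "E \<in> sets M" unfolding E_def by measurable
  have i: "integrable M (\<lambda>x. indicator E x * f x)"
    using integrable_mult_indicator[OF E int] by simp
  have neg: "indicator E x * f x \<le> 0" for x by (auto simp: E_def indicator_def)
  have "(\<integral>x. - (indicator E x * f x) \<partial>M) = 0"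
    using pos[OF E] Bochner_Integration.integral_nonneg[of M "\<lambda>x. - (indicator E x * f x)"] neg
    by (auto simp: E_def)
  then have "AE x in M. - (indicator E x * f x) = 0"
    using i neg by (subst (asm) integral_nonneg_eq_0_iff_AE) auto
  then show ?thesis
    by (rule AE_mp) (auto simp: E_def indicator_def intro!: AE_I2 split: if_splits)
qed

text \<open>The measure \<open>u \<rho> u\<^sup>*\<close>, extended by zero to the real line\<close>

definition ext_measure :: "(real set \<Rightarrow> complex^'p^'p) \<Rightarrow> complex^'p \<Rightarrow> real measure" where
  "ext_measure \<rho> u = distr (scalar_measure \<rho> u) borel (\<lambda>x. x)"

lemma sets_ext_measure [simp, measurable_cong]: "sets (ext_measure \<rho> u) = sets borel"
  by (simp add: ext_measure_def)

lemma space_ext_measure [simp]: "space (ext_measure \<rho> u) = UNIV"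
  by (simp add: ext_measure_def)

lemma sets_scalar_measure: "sets (scalar_measure \<rho> u) = sets circle_borel"
  by (simp add: scalar_measure_def sets.space_closed sets.sigma_sets_eq)

lemma space_scalar_measure: "space (scalar_measure \<rho> u) = {0..<2*pi}"
  by (simp add: scalar_measure_def sets.space_closed space_measure_of_conv circle_borel_def)

lemma id_measurable_scalar_measure: "(\<lambda>x. x) \<in> measurable (scalar_measure \<rho> u) borel"
proof -
  have "(\<lambda>x. x) \<in> measurable circle_borel borel"
    unfolding circle_borel_def by (rule measurable_restrict_space1) simp
  then show ?thesis
    by (subst measurable_cong_sets[OF sets_scalar_measure refl])
qed

lemma sets_circle_borel: "E \<in> sets circle_borel \<longleftrightarrow> E \<in> sets borel \<and> E \<subseteq> {0..<2*pi}"
  unfolding circle_borel_def by (subst sets_restrict_space_iff) auto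

lemma emeasure_ext_measure:
  assumes "matrix_measure \<rho>" "E \<in> sets borel"
  shows "emeasure (ext_measure \<rho> u) E = ennreal (Re (row_form (\<rho> (E \<inter> {0..<2*pi})) u u))"
proof -
  have "E \<inter> {0..<2*pi} \<in> sets circle_borel" using assms by (simp add: sets_circle_borel)
  with assms show ?thesis
    unfolding ext_measure_def
    by (subst emeasure_distr[OF id_measurable_scalar_measure])
      (simp_all add: space_scalar_measure emeasure_scalar_measure)
qed

lemma finite_measure_ext_measure: "matrix_measure \<rho> \<Longrightarrow> finite_measure (ext_measure \<rho> u)"
  by (rule finite_measureI) (simp add: emeasure_ext_measure)

lemma matrix_measure_empty:
  assumes "matrix_measure \<rho>"
  shows "Re (row_form (\<rho> {}) u u) \<le> 0"
  using emeasure_ext_measure[OF assms, of "{}" u] ennreal_eq_0_iff by simp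

lemma ext_measure_outside:
  assumes "matrix_measure \<rho>"
  shows "emeasure (ext_measure \<rho> u) (- {0..<2*pi}) = 0"
proof -
  have "- {0..<2*pi} \<inter> {0..<2*pi} = {}" by auto
  then show ?thesis
    using matrix_measure_empty[OF assms, of u] by (subst emeasure_ext_measure[OF assms]) (simp_all add: ennreal_neg)
qed

lemma integral_ext_measure:
  fixes f :: "real \<Rightarrow> complex"
  assumes "f \<in> borel_measurable borel"
  shows "(\<integral>\<theta>. f \<theta> \<partial>scalar_measure \<rho> u) = (\<integral>\<theta>. f \<theta> \<partial>ext_measure \<rho> u)"
  unfolding ext_measure_def by (rule integral_distr[symmetric, OF id_measurable_scalar_measure assms])

abbreviation polar :: "'p \<Rightarrow> 'p \<Rightarrow> nat \<Rightarrow> complex^'p" where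
  "polar k l m \<equiv> axis k 1 + \<i> ^ m *s axis l 1"

lemma entry_integral_ext:
  assumes "f \<in> borel_measurable borel"
  shows "entry_integral \<rho> k l f = (1/4) * (\<Sum>m<4. \<i> ^ m * (\<integral>\<theta>. f \<theta> \<partial>ext_measure \<rho> (polar k l m)))"
  by (simp add: entry_integral_def integral_ext_measure assms)

lemma polarization: "(1/4) * (\<Sum>m<4. \<i> ^ m * row_form A (polar k l m) (polar k l m)) = A $ k $ l"
  by (simp add: row_form_axis lessThan_nat_numeral lessThan_Suc eval_nat_numeral algebra_simps)

lemma sum_of_measures:
  fixes \<M> :: "real measure set"
  assumes "finite \<M>" "\<And>M. M \<in> \<M> \<Longrightarrow> sets M = sets borel"
  obtains \<tau> where "sets \<tau> = sets borel" "\<And>E. E \<in> sets borel \<Longrightarrow> emeasure \<tau> E = (\<Sum>M\<in>\<M>. emeasure M E)"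
proof -
  define \<tau> where "\<tau> = measure_of UNIV (sets (borel :: real measure)) (\<lambda>E. \<Sum>M\<in>\<M>. emeasure M E)"
  have sets: "sets \<tau> = sets borel"
    unfolding \<tau>_def using sets.sigma_sets_eq[of "borel :: real measure"] by (simp add: sets.space_closed[of borel, simplified])
  have "emeasure \<tau> E = (\<Sum>M\<in>\<M>. emeasure M E)" if "E \<in> sets borel" for E
  proof (rule emeasure_measure_of[OF \<tau>_def])
    show "sets borel \<subseteq> Pow UNIV" by simp
    show "E \<in> sets \<tau>" using that sets by simp
    show "positive (sets \<tau>) (\<lambda>E. \<Sum>M\<in>\<M>. emeasure M E)" by (simp add: positive_def)
    show "countably_additive (sets \<tau>) (\<lambda>E. \<Sum>M\<in>\<M>. emeasure M E)"
    proof (rule countably_additiveI)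
      fix A :: "nat \<Rightarrow> real set"
      assume A: "range A \<subseteq> sets \<tau>" "disjoint_family A"
      have "(\<Sum>i. \<Sum>M\<in>\<M>. emeasure M (A i)) = (\<Sum>M\<in>\<M>. \<Sum>i. emeasure M (A i))"
        by (rule suminf_sum) simp
      also have "\<dots> = (\<Sum>M\<in>\<M>. emeasure M (\<Union>i. A i))"
        using A assms sets by (intro sum.cong suminf_emeasure) auto
      finally show "(\<Sum>i. \<Sum>M\<in>\<M>. emeasure M (A i)) = (\<Sum>M\<in>\<M>. emeasure M (\<Union>i. A i))" .
    qed
  qed
  with sets show thesis by (rule that)
qed

text \<open>One polynomial has to serve several measures. The indicator is approximated in their
  sum, which dominates each of them.\<close>

lemma trig_approx_indicator_family:
  fixes \<M> :: "real measure set"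
  assumes "finite \<M>"
    and \<M>: "\<forall>M\<in>\<M>. sets M = sets borel \<and> finite_measure M \<and> emeasure M (- {0..<2*pi}) = 0"
    and E: "E \<in> sets borel" "E \<subseteq> {0<..<2*pi}" and "0 < \<delta>"
  shows "\<exists>n g. trig n (\<lambda>\<theta>. complex_of_real (g \<theta>)) \<and> (\<forall>\<theta>. 0 \<le> g \<theta>) \<and> (\<forall>\<theta>. g \<theta> \<le> 1 + \<delta>) \<and>
    (\<forall>M\<in>\<M>. (\<integral>\<theta>. \<bar>g \<theta> - indicator E \<theta>\<bar> \<partial>M) \<le> \<delta>)"
proof -
  have sets_\<M>: "sets M = sets borel" if "M \<in> \<M>" for M using \<M> that by blast
  obtain \<tau> where \<tau>: "sets \<tau> = sets borel" "\<And>E. E \<in> sets borel \<Longrightarrow> emeasure \<tau> E = (\<Sum>M\<in>\<M>. emeasure M E)"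
    using sum_of_measures[OF assms(1) sets_\<M>] by blast
  have space: "space \<tau> = UNIV" using sets_eq_imp_space_eq[OF \<tau>(1)] by simp
  have "finite_measure \<tau>"
  proof (rule finite_measureI)
    have "emeasure M UNIV \<noteq> \<infinity>" if "M \<in> \<M>" for M
      using \<M> that finite_measure.emeasure_finite[of M UNIV] by simp
    then show "emeasure \<tau> (space \<tau>) \<noteq> \<infinity>" using assms(1) by (simp add: space \<tau>(2))
  qed
  moreover have "emeasure \<tau> (- {0..<2*pi}) = 0" by (subst \<tau>(2)) (simp_all add: \<M>)
  ultimately obtain n g where g: "trig n (\<lambda>\<theta>. complex_of_real (g \<theta>))" "\<And>\<theta>. 0 \<le> g \<theta>" "\<And>\<theta>. g \<theta> \<le> 1 + \<delta>"
    and int: "(\<integral>\<theta>. \<bar>g \<theta> - indicator E \<theta>\<bar> \<partial>\<tau>) \<le> \<delta>"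
    using trig_approx_indicator[OF \<tau>(1) _ _ E \<open>0 < \<delta>\<close>] by metis
  interpret finite_measure \<tau> by fact
  have "continuous_on UNIV g"
    using continuous_on_Re[OF trig_continuous[OF g(1)], of UNIV] by simp
  then have g_meas [measurable]: "g \<in> borel_measurable borel" by (rule borel_measurable_continuous_onI)
  note [measurable_cong] = \<tau>(1)
  let ?h = "\<lambda>\<theta>. \<bar>g \<theta> - indicator E \<theta>\<bar>"
  have h: "?h \<theta> \<le> 1 + \<delta>" for \<theta> using g(2,3)[of \<theta>] \<open>0 < \<delta>\<close> by (auto simp: indicator_def)
  have [measurable]: "?h \<in> borel_measurable borel" using E by measurable
  have "(\<integral>\<theta>. ?h \<theta> \<partial>M) \<le> \<delta>" if M: "M \<in> \<M>" for M
  proof -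
    interpret M: finite_measure M using \<M> M by blast
    have [measurable_cong]: "sets M = sets borel" by (rule sets_\<M>[OF M])
    have "emeasure M X \<le> emeasure \<tau> X" for X
    proof (cases "X \<in> sets borel")
      case True
      then show ?thesis using assms(1) M by (auto simp: \<tau>(2) intro: member_le_sum[of M \<M> "\<lambda>M. emeasure M X"])
    next
      case False
      then show ?thesis using sets_\<M>[OF M] by (simp add: emeasure_notin_sets)
    qed
    then have "M \<le> \<tau>"
      using sets_eq_imp_space_eq[OF sets_\<M>[OF M]]
      by (simp add: le_measure_iff space sets_\<M>[OF M] \<tau>(1) le_fun_def)
    then have "(\<integral>\<^sup>+\<theta>. ?h \<theta> \<partial>M) \<le> (\<integral>\<^sup>+\<theta>. ?h \<theta> \<partial>\<tau>)"
      using sets_\<M>[OF M] \<tau>(1) by (intro nn_integral_mono_measure) auto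
    moreover have "(\<integral>\<^sup>+\<theta>. ?h \<theta> \<partial>M) = ennreal (\<integral>\<theta>. ?h \<theta> \<partial>M)"
      by (intro nn_integral_eq_integral M.integrable_const_bound[of _ "1 + \<delta>"]) (auto simp: h)
    moreover have "(\<integral>\<^sup>+\<theta>. ?h \<theta> \<partial>\<tau>) = ennreal (\<integral>\<theta>. ?h \<theta> \<partial>\<tau>)"
      by (intro nn_integral_eq_integral integrable_const_bound[of _ "1 + \<delta>"]) (auto simp: h)
    ultimately have "(\<integral>\<theta>. ?h \<theta> \<partial>M) \<le> (\<integral>\<theta>. ?h \<theta> \<partial>\<tau>)" by (simp add: integral_nonneg)
    with int show ?thesis by simp
  qed
  with g show ?thesis by blast
qed

section \<open>Integration against a matrix measure\<close>

lemma row_form_continuous: "continuous_on S (\<lambda>u. row_form A u u)"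
  unfolding row_form_def by (intro continuous_intros)

text \<open>Both conditions are closed in \<open>u\<close>, so they extend from \<open>D\<close> to
  all vectors. Realness of the form at the sums of two axis vectors, the second with factor 1 or
  \<open>\<i>\<close>, gives the symmetry of \<open>A\<close>.\<close>

lemma hermitian_psd_dense:
  fixes A :: "complex^'p^'p"
  assumes D: "\<And>X :: (complex^'p) set. open X \<Longrightarrow> X \<noteq> {} \<Longrightarrow> \<exists>d\<in>D. d \<in> X"
    and pos: "\<And>u. u \<in> D \<Longrightarrow> 0 \<le> Re (row_form A u u)" "\<And>u. u \<in> D \<Longrightarrow> Im (row_form A u u) = 0"
  shows "hermitian_psd A"
proof -
  have "closed {u. 0 \<le> Re (row_form A u u)}"
    by (intro closed_Collect_le continuous_intros row_form_continuous)
  moreover have "closed {u. Im (row_form A u u) = 0}"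
    by (intro closed_Collect_eq continuous_intros row_form_continuous)
  ultimately have "open (- ({u. 0 \<le> Re (row_form A u u)} \<inter> {u. Im (row_form A u u) = 0}))"
    by auto
  with D pos have "- ({u. 0 \<le> Re (row_form A u u)} \<inter> {u. Im (row_form A u u) = 0}) = {}"
    by blast
  then have re: "0 \<le> Re (row_form A u u)" and im: "Im (row_form A u u) = 0" for u by auto
  have "htranspose A = A"
  proof (simp only: vec_eq_iff, intro allI)
    fix k l
    have "Im (A $ k $ k) = 0" "Im (A $ l $ l) = 0"
      using im[of "axis k 1"] im[of "axis l 1"] by (simp_all add: row_form_axis_axis)
    with im[of "axis k 1 + 1 *s axis l 1"] im[of "axis k 1 + \<i> *s axis l 1"]
    have "Im (A $ k $ l) = - Im (A $ l $ k)" "Re (A $ k $ l) = Re (A $ l $ k)"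
      unfolding row_form_axis by simp_all
    then show "htranspose A $ k $ l = A $ k $ l"
      by (simp add: htranspose_def transpose_def complex_eq_iff)
  qed
  with re show ?thesis by (rule hermitian_psdI[rotated])
qed

text \<open>The exceptional null set depends on the vector. Testing only a countable dense set of
  vectors leaves a single null set.\<close>

lemma AE_hermitian_psd:
  fixes W :: "'a \<Rightarrow> complex^'p^'p"
  assumes int: "integrable M W" and S: "S \<in> sets M"
    and pos: "\<And>E. E \<in> sets M \<Longrightarrow> E \<subseteq> S \<Longrightarrow> hermitian_psd (\<integral>x. indicator E x *\<^sub>R W x \<partial>M)"
  shows "AE x in M. x \<in> S \<longrightarrow> hermitian_psd (W x)"
proof -
  obtain D :: "(complex^'p) set" where D: "countable D" "\<And>X. open X \<Longrightarrow> X \<noteq> {} \<Longrightarrow> \<exists>d\<in>D. d \<in> X"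
    using countable_dense_setE by blast
  have row_form_scaleR: "row_form (c *\<^sub>R A) u u = c *\<^sub>R row_form A u u" for c and A :: "complex^'p^'p" and u
    unfolding row_form_scaleR_matrix scaleR_conv_of_real[of c "row_form A u u"] ..
  have eq: "row_form (\<integral>x. indicator E x *\<^sub>R W x \<partial>M) u u = (\<integral>x. indicator E x *\<^sub>R row_form (W x) u u \<partial>M)"
    and i: "integrable M (\<lambda>x. indicator E x *\<^sub>R row_form (W x) u u)" if "E \<in> sets M" for E u
    using row_form_integral[OF integrable_mult_indicator[OF that int], of u]
    by (simp_all only: row_form_scaleR)
  have parts: "0 \<le> (\<integral>x. indicator E x * Re (row_form (W x) u u) \<partial>M)"
    "(\<integral>x. indicator E x * Im (row_form (W x) u u) \<partial>M) = 0" if E: "E \<in> sets M" "E \<subseteq> S" for E u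
  proof -
    have h: "hermitian_psd (\<integral>x. indicator E x *\<^sub>R W x \<partial>M)" by (rule pos[OF E])
    have "(\<integral>x. indicator E x * Re (row_form (W x) u u) \<partial>M) = Re (row_form (\<integral>x. indicator E x *\<^sub>R W x \<partial>M) u u)"
      unfolding eq[OF E(1)] integral_Re[OF i[OF E(1)], symmetric] by simp
    with hermitian_psd_nonneg[OF h] show "0 \<le> (\<integral>x. indicator E x * Re (row_form (W x) u u) \<partial>M)" by simp
    have "(\<integral>x. indicator E x * Im (row_form (W x) u u) \<partial>M) = Im (row_form (\<integral>x. indicator E x *\<^sub>R W x \<partial>M) u u)"
      unfolding eq[OF E(1)] integral_Im[OF i[OF E(1)], symmetric] by simp
    also have "\<dots> = 0"
      using hermitian_row_form_real[of "\<integral>x. indicator E x *\<^sub>R W x \<partial>M" u] h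
      by (simp add: hermitian_psd_def complex_eq_iff)
    finally show "(\<integral>x. indicator E x * Im (row_form (W x) u u) \<partial>M) = 0" .
  qed
  have "AE x in M. x \<in> S \<longrightarrow> 0 \<le> Re (row_form (W x) u u) \<and> Im (row_form (W x) u u) = 0" for u
  proof -
    have int': "integrable M (\<lambda>x. row_form (W x) u u)" by (rule row_form_integral(2)[OF int])
    have 1: "AE x in M. x \<in> S \<longrightarrow> 0 \<le> Re (row_form (W x) u u)"
      by (intro AE_nonneg_of_integrals S parts integrable_Re int')
    have 2: "AE x in M. x \<in> S \<longrightarrow> 0 \<le> Im (row_form (W x) u u)"
      using parts(2) by (intro AE_nonneg_of_integrals S integrable_Im int') auto
    have 3: "AE x in M. x \<in> S \<longrightarrow> 0 \<le> - Im (row_form (W x) u u)"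
      using parts(2) by (intro AE_nonneg_of_integrals S integrable_Im int' integrable_minus) auto
    from 1 2 3 show ?thesis by eventually_elim auto
  qed
  then have "AE x in M. \<forall>u\<in>D. x \<in> S \<longrightarrow> 0 \<le> Re (row_form (W x) u u) \<and> Im (row_form (W x) u u) = 0"
    unfolding AE_ball_countable[OF D(1)] by blast
  then show ?thesis
    by eventually_elim (auto intro: hermitian_psd_dense[OF D(2)])
qed

lemma bounded_bochner_integrable:
  fixes h :: "'a \<Rightarrow> complex" and f :: "'a \<Rightarrow> complex"
  assumes "integrable M f" "h \<in> borel_measurable M" "\<And>x. cmod (h x) \<le> B"
  shows "integrable M (\<lambda>x. h x * f x)"
proof (rule Bochner_Integration.integrable_bound)
  show "integrable M (\<lambda>x. B *\<^sub>R f x)" using assms by simp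
  show "(\<lambda>x. h x * f x) \<in> borel_measurable M"
    using assms(2) borel_measurable_integrable[OF assms(1)] by measurable
  have "0 \<le> B" using assms(3)[of undefined] norm_ge_zero order_trans by blast
  then show "AE x in M. norm (h x * f x) \<le> norm (B *\<^sub>R f x)"
    using assms(3) by (auto simp: norm_mult intro!: mult_right_mono)
qed

text \<open>These functions are integrable against every finite Borel measure and closed under sums,
  products and conjugation, so one predicate settles integrability for all the measures that
  occur.\<close>

definition bounded_borel :: "(real \<Rightarrow> complex) \<Rightarrow> bool" where
  "bounded_borel f \<longleftrightarrow> f \<in> borel_measurable borel \<and> (\<exists>B. \<forall>\<theta>. cmod (f \<theta>) \<le> B)"

lemma bounded_borel_measurable: "bounded_borel f \<Longrightarrow> f \<in> borel_measurable borel"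
  by (simp add: bounded_borel_def)

lemma bounded_borel_trig: "trig n f \<Longrightarrow> bounded_borel f"
  using trig_bounded trig_measurable by (auto simp: bounded_borel_def)

lemma bounded_borel_const: "bounded_borel (\<lambda>_. c)"
  by (auto simp: bounded_borel_def)

lemma bounded_borel_add:
  assumes "bounded_borel f" "bounded_borel g"
  shows "bounded_borel (\<lambda>\<theta>. f \<theta> + g \<theta>)"
proof -
  obtain A B where "\<And>\<theta>. cmod (f \<theta>) \<le> A" "\<And>\<theta>. cmod (g \<theta>) \<le> B"
    using assms by (auto simp: bounded_borel_def)
  then have "cmod (f \<theta> + g \<theta>) \<le> A + B" for \<theta> by (intro norm_triangle_le add_mono)
  then show ?thesis using assms by (auto simp: bounded_borel_def)
qed

lemma bounded_borel_mult:
  assumes "bounded_borel f" "bounded_borel g"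
  shows "bounded_borel (\<lambda>\<theta>. f \<theta> * g \<theta>)"
proof -
  obtain A B where AB: "\<And>\<theta>. cmod (f \<theta>) \<le> A" "\<And>\<theta>. cmod (g \<theta>) \<le> B"
    using assms by (auto simp: bounded_borel_def)
  have "cmod (f \<theta> * g \<theta>) \<le> A * B" for \<theta>
    unfolding norm_mult using AB order_trans[OF norm_ge_zero AB(1)] by (intro mult_mono) auto
  then show ?thesis using assms by (auto simp: bounded_borel_def)
qed

lemma bounded_borel_cnj: "bounded_borel f \<Longrightarrow> bounded_borel (\<lambda>\<theta>. cnj (f \<theta>))"
proof -
  have "cnj \<in> borel_measurable borel"
    by (intro borel_measurable_continuous_onI continuous_intros)
  then show "bounded_borel f \<Longrightarrow> bounded_borel (\<lambda>\<theta>. cnj (f \<theta>))"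
    unfolding bounded_borel_def complex_mod_cnj by (auto intro: measurable_compose)
qed

lemma bounded_borel_sum: "(\<And>i. i \<in> I \<Longrightarrow> bounded_borel (f i)) \<Longrightarrow> bounded_borel (\<lambda>\<theta>. \<Sum>i\<in>I. f i \<theta>)"
  by (induction I rule: infinite_finite_induct) (auto intro: bounded_borel_const bounded_borel_add)

lemma bounded_borel_indicator: "E \<in> sets borel \<Longrightarrow> bounded_borel (indicator E)"
  unfolding bounded_borel_def by (auto simp: indicator_def intro!: exI[of _ 1])

lemma bounded_borel_integrable:
  assumes "bounded_borel f" "finite_measure M" "sets M = sets borel"
  shows "integrable M f"
proof -
  interpret finite_measure M by fact
  from assms(1) obtain B where "\<And>\<theta>. cmod (f \<theta>) \<le> B" by (auto simp: bounded_borel_def)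
  moreover have "f \<in> borel_measurable M"
    using bounded_borel_measurable[OF assms(1)] by (simp add: measurable_cong_sets[OF assms(3) refl])
  ultimately show ?thesis by (intro integrable_const_bound) auto
qed

lemma cmod_diff_indicator: "cmod (complex_of_real x - indicator E \<theta>) = \<bar>x - indicator E \<theta>\<bar>"
proof -
  have "complex_of_real x - indicator E \<theta> = complex_of_real (x - indicator E \<theta>)"
    by (simp add: indicator_def)
  then show ?thesis by (simp only: norm_of_real)
qed

lemma integrable_abs_diff_indicator:
  assumes "trig n (\<lambda>\<theta>. complex_of_real (g \<theta>))" "E \<in> sets borel" "finite_measure M" "sets M = sets borel"
  shows "integrable M (\<lambda>\<theta>. \<bar>g \<theta> - indicator E \<theta>\<bar>)"
proof -
  have "integrable M (\<lambda>\<theta>. cmod (complex_of_real (g \<theta>) - indicator E \<theta>))"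
    using assms by (intro integrable_norm Bochner_Integration.integrable_diff bounded_borel_integrable
        bounded_borel_trig bounded_borel_indicator)
  then show ?thesis by (simp only: cmod_diff_indicator)
qed

lemma entry_integral_add:
  assumes "matrix_measure \<rho>" "bounded_borel f" "bounded_borel g"
  shows "entry_integral \<rho> k l (\<lambda>\<theta>. f \<theta> + g \<theta>) = entry_integral \<rho> k l f + entry_integral \<rho> k l g"
proof -
  have "integrable (ext_measure \<rho> u) f" "integrable (ext_measure \<rho> u) g" for u
    using assms by (auto intro: bounded_borel_integrable finite_measure_ext_measure)
  then show ?thesis
    using bounded_borel_add[OF assms(2,3)] assms(2,3)
    by (simp add: entry_integral_ext bounded_borel_measurable distrib_left sum.distrib)
qed

lemma entry_integral_scale:
  assumes "bounded_borel f"
  shows "entry_integral \<rho> k l (\<lambda>\<theta>. c * f \<theta>) = c * entry_integral \<rho> k l f"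
  using assms bounded_borel_mult[OF bounded_borel_const[of c] assms]
  by (simp add: entry_integral_ext bounded_borel_measurable sum_distrib_left mult_ac)

lemma entry_integral_zero: "entry_integral \<rho> k l (\<lambda>_. 0) = 0"
  by (simp add: entry_integral_def)

lemma entry_integral_sum:
  assumes "matrix_measure \<rho>" "\<And>i. i \<in> I \<Longrightarrow> bounded_borel (f i)"
  shows "entry_integral \<rho> k l (\<lambda>\<theta>. \<Sum>i\<in>I. f i \<theta>) = (\<Sum>i\<in>I. entry_integral \<rho> k l (f i))"
  using assms(2)
proof (induction I rule: infinite_finite_induct)
  case (insert i I)
  then have "bounded_borel (f i)" "bounded_borel (\<lambda>\<theta>. \<Sum>i\<in>I. f i \<theta>)" by (auto intro: bounded_borel_sum)
  then show ?case using insert by (simp add: entry_integral_add[OF assms(1)])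
qed (simp_all add: entry_integral_zero)

text \<open>The polarization averages four integrals with unimodular weights, so a common bound for
  the four passes to the entry without an additional factor.\<close>

lemma entry_integral_bound:
  assumes "bounded_borel f"
    and "\<And>m. m < 4 \<Longrightarrow> (\<integral>\<theta>. cmod (f \<theta>) \<partial>ext_measure \<rho> (polar k l m)) \<le> c"
  shows "cmod (entry_integral \<rho> k l f) \<le> c"
proof -
  have "cmod (\<Sum>m<4. \<i> ^ m * (\<integral>\<theta>. f \<theta> \<partial>ext_measure \<rho> (polar k l m))) \<le> (\<Sum>m<(4::nat). c)"
  proof (rule sum_norm_le)
    fix m :: nat assume "m \<in> {..<4}"
    then have "(\<integral>\<theta>. cmod (f \<theta>) \<partial>ext_measure \<rho> (polar k l m)) \<le> c" by (simp add: assms(2))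
    from order_trans[OF integral_norm_bound this] show "cmod (\<i> ^ m * (\<integral>\<theta>. f \<theta> \<partial>ext_measure \<rho> (polar k l m))) \<le> c"
      by (simp add: norm_mult norm_power)
  qed
  then show ?thesis
    using assms(1) by (simp add: entry_integral_ext bounded_borel_measurable norm_mult)
qed

text \<open>\<open>N\<close> collects what has to be avoided: a carrier of the singular part, the
  points where \<open>W\<close> fails to be positive semidefinite, and the point 0, at which the
  circle is cut. Off \<open>N\<close>, \<open>\<rho>\<close> has the density \<open>W\<close>, and
  \<open>W\<close> is positive semidefinite at every point.\<close>

locale decomposed_measure =
  fixes \<rho> :: "real set \<Rightarrow> complex^'p^'p" and W :: "real \<Rightarrow> complex^'p^'p" and N :: "real set"
  assumes mm: "matrix_measure \<rho>"
    and N_null: "N \<in> null_sets lborel" and zero_N: "0 \<in> N"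
    and W_int: "integrable circ W"
    and density: "\<And>E. E \<in> sets borel \<Longrightarrow> E \<subseteq> {0..<2*pi} - N \<Longrightarrow> \<rho> E = (\<integral>\<theta>. indicator E \<theta> *\<^sub>R W \<theta> \<partial>circ)"
    and W_psd: "\<And>\<theta>. \<theta> \<in> {0..<2*pi} - N \<Longrightarrow> hermitian_psd (W \<theta>)"
begin

abbreviation C where "C \<equiv> {0..<2*pi} - N"

lemma N_borel [measurable]: "N \<in> sets borel"
  using N_null by (auto simp: null_sets_def)

lemma W_measurable [measurable]: "W \<in> borel_measurable borel"
  using borel_measurable_integrable[OF W_int] by simp

lemma W_entry_int: "integrable circ (\<lambda>\<theta>. W \<theta> $ k $ l)"
  by (intro integrable_bounded_linear[OF bounded_linear_vec_nth] W_int)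

lemma AE_C: "AE \<theta> in circ. \<theta> \<in> C"
proof -
  have "AE \<theta> in lborel. \<theta> \<notin> N" using N_null by (rule AE_not_in)
  then show ?thesis unfolding AE_circ by (rule AE_mp) auto
qed

text \<open>Cutting \<open>u \<rho> u*\<close> down to \<open>C\<close> and giving
  \<open>circ\<close> the density \<open>r\<close> produce measures that agree on Borel sets, hence
  have the same integrals. The factor \<open>indicator C\<close> makes \<open>r\<close> nonnegative
  on the whole line.\<close>

lemma integral_ext_measure_C:
  assumes E: "E \<in> sets borel" "E \<subseteq> C" and h: "h \<in> borel_measurable borel"
  shows "(\<integral>\<theta>. indicator E \<theta> * h \<theta> \<partial>ext_measure \<rho> u) = (\<integral>\<theta>. indicator E \<theta> * h \<theta> * row_form (W \<theta>) u u \<partial>circ)"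
proof -
  define r where "r = (\<lambda>\<theta>. indicator C \<theta> * Re (row_form (W \<theta>) u u))"
  have r0: "0 \<le> r \<theta>" for \<theta> using hermitian_psd_nonneg[OF W_psd] by (auto simp: r_def indicator_def)
  have [measurable]: "r \<in> borel_measurable borel" unfolding r_def by measurable
  have eq: "density (ext_measure \<rho> u) (\<lambda>\<theta>. ennreal (indicator C \<theta>)) = density circ (\<lambda>\<theta>. ennreal (r \<theta>))"
  proof (rule measure_eqI)
    fix A assume "A \<in> sets (density (ext_measure \<rho> u) (\<lambda>\<theta>. ennreal (indicator C \<theta>)))"
    then have A [measurable]: "A \<in> sets borel" by simp
    let ?A = "A \<inter> C"
    have A': "?A \<in> sets borel" "?A \<subseteq> C" by auto
    have int: "integrable circ (\<lambda>\<theta>. indicator ?A \<theta> *\<^sub>R W \<theta>)"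
      using A' by (intro integrable_mult_indicator W_int) auto
    have "emeasure (density (ext_measure \<rho> u) (\<lambda>\<theta>. ennreal (indicator C \<theta>))) A = emeasure (ext_measure \<rho> u) ?A"
    proof (subst emeasure_density)
      have "(\<integral>\<^sup>+\<theta>. ennreal (indicator C \<theta>) * indicator A \<theta> \<partial>ext_measure \<rho> u) = (\<integral>\<^sup>+\<theta>. indicator ?A \<theta> \<partial>ext_measure \<rho> u)"
        by (intro nn_integral_cong) (auto simp: indicator_def)
      also have "\<dots> = emeasure (ext_measure \<rho> u) ?A" using A' by (intro nn_integral_indicator) simp
      finally show "(\<integral>\<^sup>+\<theta>. ennreal (indicator C \<theta>) * indicator A \<theta> \<partial>ext_measure \<rho> u) = emeasure (ext_measure \<rho> u) ?A" .
    qed auto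
    also have "\<dots> = ennreal (Re (row_form (\<rho> ?A) u u))"
    proof -
      have "?A \<inter> {0..<2*pi} = ?A" by auto
      then show ?thesis using emeasure_ext_measure[OF mm A'(1), of u] by simp
    qed
    also have "row_form (\<rho> ?A) u u = (\<integral>\<theta>. row_form (indicator ?A \<theta> *\<^sub>R W \<theta>) u u \<partial>circ)"
      unfolding density[OF A'] by (rule row_form_integral(1)[OF int])
    also have "Re \<dots> = (\<integral>\<theta>. Re (row_form (indicator ?A \<theta> *\<^sub>R W \<theta>) u u) \<partial>circ)"
      by (rule integral_Re[OF row_form_integral(2)[OF int], symmetric])
    also have "ennreal \<dots> = (\<integral>\<^sup>+\<theta>. ennreal (Re (row_form (indicator ?A \<theta> *\<^sub>R W \<theta>) u u)) \<partial>circ)"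
      by (intro nn_integral_eq_integral[symmetric] integrable_Re row_form_integral(2) int AE_I2)
        (auto simp: row_form_scaleR_matrix indicator_def hermitian_psd_nonneg[OF W_psd])
    also have "\<dots> = (\<integral>\<^sup>+\<theta>. ennreal (r \<theta>) * indicator A \<theta> \<partial>circ)"
      by (intro nn_integral_cong) (auto simp: r_def row_form_scaleR_matrix indicator_def)
    also have "\<dots> = emeasure (density circ (\<lambda>\<theta>. ennreal (r \<theta>))) A"
      by (subst emeasure_density) auto
    finally show "emeasure (density (ext_measure \<rho> u) (\<lambda>\<theta>. ennreal (indicator C \<theta>))) A
      = emeasure (density circ (\<lambda>\<theta>. ennreal (r \<theta>))) A" .
  qed simp
  have [measurable]: "h \<in> borel_measurable borel" "E \<in> sets borel" by fact+
  let ?f = "\<lambda>\<theta>. indicator E \<theta> * h \<theta>"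
  have "(\<integral>\<theta>. ?f \<theta> \<partial>ext_measure \<rho> u) = (\<integral>\<theta>. indicator C \<theta> *\<^sub>R ?f \<theta> \<partial>ext_measure \<rho> u)"
    using E(2) by (intro Bochner_Integration.integral_cong) (auto simp: indicator_def)
  also have "\<dots> = (\<integral>\<theta>. ?f \<theta> \<partial>density (ext_measure \<rho> u) (\<lambda>\<theta>. ennreal (indicator C \<theta>)))"
    by (rule integral_density[symmetric]) auto
  also have "\<dots> = (\<integral>\<theta>. r \<theta> *\<^sub>R ?f \<theta> \<partial>circ)"
    unfolding eq using r0 by (intro integral_density) auto
  also have "\<dots> = (\<integral>\<theta>. ?f \<theta> * row_form (W \<theta>) u u \<partial>circ)"
  proof (intro Bochner_Integration.integral_cong refl)
    fix \<theta>
    show "r \<theta> *\<^sub>R ?f \<theta> = ?f \<theta> * row_form (W \<theta>) u u"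
    proof (cases "\<theta> \<in> E")
      case True
      then have "hermitian_psd (W \<theta>)" using E by (auto intro: W_psd)
      then have "row_form (W \<theta>) u u = complex_of_real (Re (row_form (W \<theta>) u u))"
        unfolding hermitian_psd_def by (intro hermitian_row_form_real) simp
      moreover have "r \<theta> = Re (row_form (W \<theta>) u u)" using True E by (auto simp: r_def)
      ultimately show ?thesis by (simp add: scaleR_conv_of_real)
    qed simp
  qed
  finally show ?thesis .
qed

text \<open>\<open>entry_integral\<close> polarizes the measures; polarizing the form of
  \<open>W\<close> at each point recovers its entries in the same way.\<close>

lemma entry_integral_C:
  assumes E: "E \<in> sets borel" "E \<subseteq> C" and h: "bounded_borel h"
  shows "entry_integral \<rho> k l (\<lambda>\<theta>. indicator E \<theta> * h \<theta>) = (\<integral>\<theta>. indicator E \<theta> * h \<theta> * W \<theta> $ k $ l \<partial>circ)"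
proof -
  let ?f = "\<lambda>\<theta>. indicator E \<theta> * h \<theta>"
  have f: "bounded_borel ?f" by (intro bounded_borel_mult bounded_borel_indicator E h)
  then obtain B where B: "\<And>\<theta>. cmod (?f \<theta>) \<le> B" unfolding bounded_borel_def by auto
  have int: "integrable circ (\<lambda>\<theta>. ?f \<theta> * row_form (W \<theta>) u u)" for u
    using bounded_borel_measurable[OF f] B
    by (intro bounded_bochner_integrable row_form_integral(2) W_int) auto
  have "entry_integral \<rho> k l ?f = (1/4) * (\<Sum>m<4. \<i> ^ m * (\<integral>\<theta>. ?f \<theta> * row_form (W \<theta>) (polar k l m) (polar k l m) \<partial>circ))"
    unfolding entry_integral_ext[OF bounded_borel_measurable[OF f]]
    by (simp only: integral_ext_measure_C[OF E bounded_borel_measurable[OF h]])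
  also have "\<dots> = (\<integral>\<theta>. (1/4) * (\<Sum>m<4. \<i> ^ m * (?f \<theta> * row_form (W \<theta>) (polar k l m) (polar k l m))) \<partial>circ)"
    using int by (simp add: Bochner_Integration.integral_sum)
  also have "\<dots> = (\<integral>\<theta>. ?f \<theta> * W \<theta> $ k $ l \<partial>circ)"
    by (intro Bochner_Integration.integral_cong refl, subst polarization[symmetric])
      (simp add: sum_distrib_left mult_ac)
  finally show ?thesis .
qed

text \<open>The polynomial is chosen once for all \<open>k\<close>, \<open>l\<close> and
  \<open>h\<close>: it approximates the indicator in every measure of the polarization, and a
  bounded \<open>h\<close> only multiplies the error by its bound.\<close>

lemma trig_approx_C:
  assumes E: "E \<in> sets borel" "E \<subseteq> C" and "0 < \<delta>"
  shows "\<exists>n g. trig n (\<lambda>\<theta>. complex_of_real (g \<theta>)) \<and> (\<forall>\<theta>. 0 \<le> g \<theta>) \<and> (\<forall>\<theta>. g \<theta> \<le> 1 + \<delta>) \<and>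
    (\<integral>\<theta>. \<bar>g \<theta> - indicator E \<theta>\<bar> \<partial>circ) \<le> \<delta> \<and>
    (\<forall>k l h B. h \<in> borel_measurable borel \<longrightarrow> (\<forall>\<theta>. cmod (h \<theta>) \<le> B) \<longrightarrow>
      cmod (entry_integral \<rho> k l (\<lambda>\<theta>. complex_of_real (g \<theta>) * h \<theta>)
        - (\<integral>\<theta>. indicator E \<theta> * h \<theta> * W \<theta> $ k $ l \<partial>circ)) \<le> B * \<delta>)"
proof -
  \<comment> \<open>The measures of the polarization contain the singular part, on which the
    indicator of \<open>E\<close> is 0, so \<open>g\<close> is forced to be small there.\<close>
  define \<M> where "\<M> = insert circ ((\<lambda>(k, l, m). ext_measure \<rho> (polar k l m)) ` (UNIV \<times> UNIV \<times> {..<4}))"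
  have "emeasure circ (- {0..<2*pi}) = 0"
    by (subst emeasure_circ) auto
  then have \<M>: "finite \<M>"
    "\<forall>M\<in>\<M>. sets M = sets borel \<and> finite_measure M \<and> emeasure M (- {0..<2*pi}) = 0"
    unfolding \<M>_def
    by (auto simp: finite_measure_circ finite_measure_ext_measure[OF mm] ext_measure_outside[OF mm])
  have "E \<subseteq> {0<..<2*pi}"
  proof
    fix \<theta> assume "\<theta> \<in> E"
    then have "\<theta> \<in> C" "\<theta> \<noteq> 0" using E(2) zero_N by auto
    then show "\<theta> \<in> {0<..<2*pi}" by auto
  qed
  note fam = trig_approx_indicator_family[OF \<M> E(1) this \<open>0 < \<delta>\<close>]
  then obtain n g where g': "trig n (\<lambda>\<theta>. complex_of_real (g \<theta>))" "\<forall>\<theta>. 0 \<le> g \<theta>" "\<forall>\<theta>. g \<theta> \<le> 1 + \<delta>"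
    and int': "\<forall>M\<in>\<M>. (\<integral>\<theta>. \<bar>g \<theta> - indicator E \<theta>\<bar> \<partial>M) \<le> \<delta>"
    by (elim exE conjE)
  note g = g'(1) g'(2)[rule_format] g'(3)[rule_format] and int = int'[rule_format]
  have "cmod (entry_integral \<rho> k l (\<lambda>\<theta>. complex_of_real (g \<theta>) * h \<theta>)
        - (\<integral>\<theta>. indicator E \<theta> * h \<theta> * W \<theta> $ k $ l \<partial>circ)) \<le> B * \<delta>"
    if h: "h \<in> borel_measurable borel" "\<And>\<theta>. cmod (h \<theta>) \<le> B" for k l h B
  proof -
    have "0 \<le> B" using h(2)[of 0] norm_ge_zero order_trans by blast
    let ?d = "\<lambda>\<theta>. complex_of_real (g \<theta>) * h \<theta> + (- 1) * (indicator E \<theta> * h \<theta>)"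
    have bh: "bounded_borel h" using h by (auto simp: bounded_borel_def)
    have b1: "bounded_borel (\<lambda>\<theta>. complex_of_real (g \<theta>) * h \<theta>)"
      by (intro bounded_borel_mult bh bounded_borel_trig[OF g(1)])
    have b2: "bounded_borel (\<lambda>\<theta>. indicator E \<theta> * h \<theta>)"
      by (intro bounded_borel_mult bh bounded_borel_indicator E)
    have b3: "bounded_borel (\<lambda>\<theta>. (- 1) * (indicator E \<theta> * h \<theta>))"
      by (intro bounded_borel_mult[OF bounded_borel_const] b2)
    have bd: "bounded_borel ?d" by (intro bounded_borel_add b1 b3)
    have "entry_integral \<rho> k l ?d = entry_integral \<rho> k l (\<lambda>\<theta>. complex_of_real (g \<theta>) * h \<theta>)
        - entry_integral \<rho> k l (\<lambda>\<theta>. indicator E \<theta> * h \<theta>)"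
      unfolding entry_integral_add[OF mm b1 b3] entry_integral_scale[OF b2] by simp
    moreover have "cmod (entry_integral \<rho> k l ?d) \<le> B * \<delta>"
    proof (rule entry_integral_bound[OF bd])
      fix m :: nat assume "m < 4"
      then have M: "ext_measure \<rho> (polar k l m) \<in> \<M>"
        unfolding \<M>_def by (intro insertI2, intro rev_image_eqI[of "(k, l, m)"]) simp_all
      let ?M = "ext_measure \<rho> (polar k l m)"
      have i: "integrable ?M (\<lambda>\<theta>. \<bar>g \<theta> - indicator E \<theta>\<bar>)"
        using \<M>(2) M by (intro integrable_abs_diff_indicator[OF g(1) E(1)]) blast+
      have "(\<integral>\<theta>. cmod (?d \<theta>) \<partial>?M) \<le> (\<integral>\<theta>. B * \<bar>g \<theta> - indicator E \<theta>\<bar> \<partial>?M)"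
      proof (rule integral_mono_AE')
        show "integrable ?M (\<lambda>\<theta>. B * \<bar>g \<theta> - indicator E \<theta>\<bar>)" using i by simp
        have "cmod (?d \<theta>) \<le> B * \<bar>g \<theta> - indicator E \<theta>\<bar>" for \<theta>
        proof -
          have "?d \<theta> = h \<theta> * complex_of_real (g \<theta> - indicator E \<theta>)"
            by (auto simp: indicator_def algebra_simps)
          then have "cmod (?d \<theta>) = cmod (h \<theta>) * \<bar>g \<theta> - indicator E \<theta>\<bar>"
            by (simp only: norm_mult norm_of_real)
          then show ?thesis using h(2)[of \<theta>] by (simp add: mult_right_mono)
        qed
        then show "AE \<theta> in ?M. cmod (?d \<theta>) \<le> B * \<bar>g \<theta> - indicator E \<theta>\<bar>" by simp
        show "AE \<theta> in ?M. 0 \<le> B * \<bar>g \<theta> - indicator E \<theta>\<bar>" using \<open>0 \<le> B\<close> by simp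
      qed
      also have "\<dots> \<le> B * \<delta>" using int[OF M] \<open>0 \<le> B\<close> by (simp add: mult_left_mono)
      finally show "(\<integral>\<theta>. cmod (?d \<theta>) \<partial>?M) \<le> B * \<delta>" .
    qed
    ultimately show ?thesis using entry_integral_C[OF E bh, of k l] by simp
  qed
  then have "\<forall>k l h B. h \<in> borel_measurable borel \<longrightarrow> (\<forall>\<theta>. cmod (h \<theta>) \<le> B) \<longrightarrow>
      cmod (entry_integral \<rho> k l (\<lambda>\<theta>. complex_of_real (g \<theta>) * h \<theta>)
        - (\<integral>\<theta>. indicator E \<theta> * h \<theta> * W \<theta> $ k $ l \<partial>circ)) \<le> B * \<delta>"
    by simp
  moreover have "(\<integral>\<theta>. \<bar>g \<theta> - indicator E \<theta>\<bar> \<partial>circ) \<le> \<delta>" by (rule int) (simp add: \<M>_def)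
  ultimately show ?thesis using g'(1-3) by (intro exI conjI)
qed

end

lemma decomposed_measure_exists:
  assumes "matrix_measure \<rho>" "lebesgue_decomposition \<rho> W \<rho>\<^sub>s"
  obtains W' N where "decomposed_measure \<rho> W' N" "\<And>\<theta>. \<theta> \<in> {0..<2*pi} \<Longrightarrow> W' \<theta> = W \<theta>"
proof -
  \<comment> \<open>Integrability of \<open>W\<close> is assumed on the interval only; cutting it
    off yields a function measurable on the line.\<close>
  define W' where "W' = (\<lambda>\<theta>. indicator {0..<2*pi} \<theta> *\<^sub>R W \<theta>)"
  obtain N where N: "N \<in> sets circle_borel" "N \<in> null_sets lborel"
    and sing: "\<And>E. E \<in> sets circle_borel \<Longrightarrow> \<rho>\<^sub>s (E - N) = 0"
    using assms(2) by (auto simp: lebesgue_decomposition_def singular_matrix_measure_def)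
  have W: "integrable lborel W'"
    using assms(2) by (simp add: lebesgue_decomposition_def set_integrable_def W'_def)
  have [measurable]: "W' \<in> borel_measurable borel" using borel_measurable_integrable[OF W] by simp
  have W': "integrable circ W'"
  proof (subst integral_circ(2))
    have "(\<lambda>\<theta>. indicator {0..<2*pi} \<theta> *\<^sub>R W' \<theta>) = W'" by (rule ext) (auto simp: W'_def indicator_def)
    with W show "integrable lborel (\<lambda>\<theta>. indicator {0..<2*pi} \<theta> *\<^sub>R W' \<theta>)" by simp
  qed simp
  have dens: "\<rho> E = (\<integral>\<theta>. indicator E \<theta> *\<^sub>R W' \<theta> \<partial>circ)"
    if E: "E \<in> sets borel" "E \<subseteq> {0..<2*pi} - N" for E
  proof -
    have E': "E \<in> sets circle_borel" using E by (auto simp: sets_circle_borel)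
    have "E - N = E" using E by auto
    with sing[OF E'] have "\<rho>\<^sub>s E = 0" by simp
    then have "\<rho> E = (1 / (2*pi)) *\<^sub>R (LINT \<theta>:E|lborel. W \<theta>)"
      using assms(2) E' by (simp add: lebesgue_decomposition_def)
    also have "(LINT \<theta>:E|lborel. W \<theta>) = (\<integral>\<theta>. indicator {0..<2*pi} \<theta> *\<^sub>R (indicator E \<theta> *\<^sub>R W' \<theta>) \<partial>lborel)"
      unfolding set_lebesgue_integral_def using E
      by (intro Bochner_Integration.integral_cong) (auto simp: W'_def indicator_def)
    also have "(1 / (2*pi)) *\<^sub>R \<dots> = (\<integral>\<theta>. indicator E \<theta> *\<^sub>R W' \<theta> \<partial>circ)"
      using E by (intro integral_circ(1)[symmetric]) auto
    finally show ?thesis .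
  qed
  have [measurable]: "N \<in> sets borel" using N by (auto simp: null_sets_def)
  have "AE \<theta> in circ. \<theta> \<in> {0..<2*pi} - N \<longrightarrow> hermitian_psd (W' \<theta>)"
  proof (rule AE_hermitian_psd[OF W'])
    fix E assume "E \<in> sets circ" "E \<subseteq> {0..<2*pi} - N"
    then have "\<rho> E = (\<integral>\<theta>. indicator E \<theta> *\<^sub>R W' \<theta> \<partial>circ)" "E \<in> sets circle_borel"
      using dens by (auto simp: sets_circle_borel)
    with assms(1) show "hermitian_psd (\<integral>\<theta>. indicator E \<theta> *\<^sub>R W' \<theta> \<partial>circ)"
      by (auto simp: matrix_measure_def)
  qed simp
  then have "AE \<theta> in lborel. \<theta> \<in> {0..<2*pi} - N \<longrightarrow> hermitian_psd (W' \<theta>)"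
    unfolding AE_circ by (rule AE_mp) auto
  then obtain N1 where N1: "{\<theta>. \<not> (\<theta> \<in> {0..<2*pi} - N \<longrightarrow> hermitian_psd (W' \<theta>))} \<subseteq> N1" "N1 \<in> null_sets lborel"
    by (auto simp: eventually_ae_filter)
  define N2 where "N2 = N \<union> N1 \<union> {0}"
  have "decomposed_measure \<rho> W' N2"
  proof
    show "N2 \<in> null_sets lborel" unfolding N2_def using N N1 by (intro null_sets.Un) auto
    show "\<rho> E = (\<integral>\<theta>. indicator E \<theta> *\<^sub>R W' \<theta> \<partial>circ)" if "E \<in> sets borel" "E \<subseteq> {0..<2*pi} - N2" for E
      using that by (intro dens) (auto simp: N2_def)
    show "hermitian_psd (W' \<theta>)" if "\<theta> \<in> {0..<2*pi} - N2" for \<theta>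
      using that N1(1) by (auto simp: N2_def)
  qed (use assms W' in \<open>auto simp: N2_def\<close>)
  then show thesis by (rule that) (simp add: W'_def)
qed

section \<open>Toeplitz forms and orthonormal matrix polynomials\<close>

text \<open>\<open>\<integral> c d\<mu> d\<^sup>*\<close> for row polynomials with coefficients \<open>c\<close>, \<open>d\<close> and a matrix measure \<open>\<mu>\<close>
  with moments \<open>M k = \<integral> z\<^sup>k d\<mu>\<close>\<close>

definition tform :: "(int \<Rightarrow> complex^'p^'p) \<Rightarrow> nat \<Rightarrow> (nat \<Rightarrow> complex^'p) \<Rightarrow> (nat \<Rightarrow> complex^'p) \<Rightarrow> complex" where
  "tform M n c d = (\<Sum>i\<le>n. \<Sum>j\<le>n. row_form (M (int i - int j)) (c i) (d j))"

definition shift :: "(nat \<Rightarrow> complex^'p) \<Rightarrow> nat \<Rightarrow> complex^'p" where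
  "shift c i = (case i of 0 \<Rightarrow> 0 | Suc j \<Rightarrow> c j)"

lemma shift_simps [simp]: "shift c 0 = 0" "shift c (Suc i) = c i"
  by (simp_all add: shift_def)

lemma tform_add_left: "tform M n (\<lambda>i. c i + e i) d = tform M n c d + tform M n e d"
  by (simp add: tform_def row_form_add_left sum.distrib)

lemma tform_add_right: "tform M n d (\<lambda>i. c i + e i) = tform M n d c + tform M n d e"
  by (simp add: tform_def row_form_add_right sum.distrib)

text \<open>The form depends on \<open>i - j\<close> only, so multiplication by \<open>z\<close> is
  isometric; vanishing top coefficients keep the shifted rows within degree
  \<open>n\<close>.\<close>

lemma tform_shift:
  assumes "c n = 0" "d n = 0"
  shows "tform M n (shift c) (shift d) = tform M n c d"
proof (cases n)
  case (Suc m)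
  have "tform M n (shift c) (shift d) = (\<Sum>i\<le>m. \<Sum>j\<le>m. row_form (M (int i - int j)) (c i) (d j))"
    unfolding tform_def Suc sum.atMost_Suc_shift by simp
  moreover have "tform M n c d = (\<Sum>i\<le>m. \<Sum>j\<le>m. row_form (M (int i - int j)) (c i) (d j))"
    using assms unfolding tform_def Suc sum.atMost_Suc by simp
  ultimately show ?thesis by simp
qed (use assms in \<open>simp add: tform_def\<close>)

lemma tform_cong:
  "(\<And>i. i \<le> n \<Longrightarrow> c i = c' i) \<Longrightarrow> (\<And>i. i \<le> n \<Longrightarrow> d i = d' i) \<Longrightarrow> tform M n c d = tform M n c' d'"
  unfolding tform_def by (intro sum.cong) auto

lemma sum_single:
  assumes "finite A" "i \<in> A" "\<And>j. j \<in> A \<Longrightarrow> j \<noteq> i \<Longrightarrow> f j = 0"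
  shows "sum f A = f i"
  using assms by (simp add: sum.remove[of A i] sum.neutral)

lemma tform_single:
  assumes "i \<le> n" "j \<le> n"
  shows "tform M n (\<lambda>t. if t = i then u else 0) (\<lambda>t. if t = j then w else 0) = row_form (M (int i - int j)) u w"
proof -
  have "(\<Sum>t\<le>n. row_form (M (int s - int t)) x (if t = j then w else 0)) = row_form (M (int s - int j)) x w" for s x
    using assms by (subst sum_single[of _ j]) auto
  then have "tform M n (\<lambda>t. if t = i then u else 0) (\<lambda>t. if t = j then w else 0)
      = (\<Sum>s\<le>n. row_form (M (int s - int j)) (if s = i then u else 0) w)"
    by (simp only: tform_def)
  also have "\<dots> = row_form (M (int i - int j)) u w"
    using assms by (subst sum_single[of _ i]) auto
  finally show ?thesis .
qed

lemma row_form_eqI: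
  assumes "\<And>u w. row_form A u w = row_form B u w"
  shows "A = B"
proof -
  have "A $ k $ l = B $ k $ l" for k l
    using assms[of "axis k 1" "axis l 1"] by (simp add: row_form_axis_axis)
  then show ?thesis by (simp add: vec_eq_iff)
qed

lemma tendsto_vector_matrix_mult_zero:
  fixes f :: "'a \<Rightarrow> complex^'n" and A :: "complex^'m^'n"
  assumes "(f \<longlongrightarrow> 0) F"
  shows "((\<lambda>x. f x v* A) \<longlongrightarrow> 0) F"
proof (rule vec_tendstoI)
  fix j
  have "((\<lambda>x. \<Sum>i\<in>UNIV. f x $ i * A $ i $ j) \<longlongrightarrow> (\<Sum>i\<in>UNIV. 0 $ i * A $ i $ j)) F"
    by (intro tendsto_intros assms)
  then show "((\<lambda>x. (f x v* A) $ j) \<longlongrightarrow> 0 $ j) F"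
    by (simp add: vector_matrix_mult_def)
qed

lemma tendsto_row_form_zero:
  assumes "(f \<longlongrightarrow> 0) F" "(g \<longlongrightarrow> 0) F"
  shows "((\<lambda>x. row_form A (f x) (g x)) \<longlongrightarrow> 0) F"
proof -
  have "((\<lambda>x. row_form A (f x) (g x)) \<longlongrightarrow> row_form A 0 0) F"
    unfolding row_form_def by (intro tendsto_intros assms)
  then show ?thesis by simp
qed

lemma vector_matrix_scale: "v v* (mat k ** A) = k *s (v v* A)" for A :: "complex^'p^'p"
  by (simp add: vector_matrix_mult_def matrix_matrix_mult_def mat_def vec_eq_iff if_distrib if_distribR
      sum_distrib_left mult_ac cong: if_cong)

lemma vector_matrix_mult_sum_right: "v v* (\<Sum>i\<in>I. A i) = (\<Sum>i\<in>I. v v* A i)" for A :: "nat \<Rightarrow> complex^'p^'p"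
  by (induction I rule: infinite_finite_induct) (simp_all add: vector_matrix_mult_add_rdistrib)

text \<open>Nothing here refers to a measure: \<open>T\<close> is determined by the polynomial alone
  and therefore acts in the same way for two moment sequences for which this polynomial is
  orthonormal.\<close>

locale coefficients =
  fixes a :: "nat \<Rightarrow> complex^'p^'p" and n :: nat
  assumes lead: "invertible (a n)" and beyond: "\<And>i. n < i \<Longrightarrow> a i = 0"
begin

text \<open>The quotient in the right division of \<open>z\<close> times \<open>c\<close> by
  \<open>a\<close>, for a row polynomial \<open>c\<close> of degree less than
  \<open>n\<close>.\<close>

definition lc :: "(nat \<Rightarrow> complex^'p) \<Rightarrow> complex^'p" where
  "lc c = c (n - 1) v* matrix_inv (a n)"

text \<open>Multiplication by \<open>z\<close> modulo left multiples of the matrix polynomial with coefficients \<open>a\<close>\<close>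

definition T :: "(nat \<Rightarrow> complex^'p) \<Rightarrow> nat \<Rightarrow> complex^'p" where
  "T c = (\<lambda>i. shift c i - lc c v* a i)"

definition low :: "(nat \<Rightarrow> complex^'p) \<Rightarrow> bool" where
  "low c \<longleftrightarrow> (\<forall>i\<ge>n. c i = 0)"

lemma lowD: "low c \<Longrightarrow> n \<le> i \<Longrightarrow> c i = 0"
  by (simp add: low_def)

lemma lc_lead: "lc c v* a n = c (n - 1)"
  by (simp add: lc_def vector_matrix_mul_assoc matrix_inv(2)[OF lead])

lemma T_low:
  assumes "0 < n" "low c"
  shows "low (T c)"
  unfolding low_def
proof (intro allI impI)
  fix i assume i: "n \<le> i"
  with assms(1) obtain j where j: "i = Suc j" by (cases i) auto
  show "T c i = 0"
  proof (cases "i = n")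
    case True
    then have "n - 1 = j" using j by simp
    with True have "lc c v* a i = c j" using lc_lead[of c] by simp
    then show ?thesis unfolding T_def j by simp
  next
    case False
    then have "c j = 0" "a i = 0" using i j lowD[OF assms(2), of j] beyond[of i] by auto
    then show ?thesis unfolding T_def by (simp add: j)
  qed
qed

lemma T_pow_low:
  assumes "0 < n" "low c"
  shows "low ((T ^^ m) c)"
  by (induction m) (simp_all add: assms T_low)

lemma shift_eq_T: "shift c = (\<lambda>i. T c i + lc c v* a i)"
  by (simp add: T_def)

text \<open>Orthogonality is demanded on both sides because \<open>M\<close> is not assumed to be
  Hermitian. The condition \<open>d n = 0\<close> expresses degree less than \<open>n\<close>, as
  \<open>tform M n\<close> does not see the coefficients beyond \<open>n\<close>.\<close>

definition orthonormal_for :: "(int \<Rightarrow> complex^'p^'p) \<Rightarrow> bool" where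
  "orthonormal_for M \<longleftrightarrow>
     (\<forall>v d. d n = 0 \<longrightarrow> tform M n (\<lambda>i. v v* a i) d = 0) \<and>
     (\<forall>v d. d n = 0 \<longrightarrow> tform M n d (\<lambda>i. v v* a i) = 0) \<and>
     (\<forall>v w. tform M n (\<lambda>i. v v* a i) (\<lambda>i. w v* a i) = row_form (mat 1) v w)"

text \<open>Multiplication by \<open>z\<close> is isometric, and \<open>z c\<close> is
  \<open>T c\<close> plus a left multiple of \<open>a\<close>. Orthogonality removes the mixed
  terms, and normalization leaves a constant that does not involve \<open>M\<close>.\<close>

lemma tform_T:
  assumes "orthonormal_for M" "0 < n" "low c" "low d"
  shows "tform M n c d = tform M n (T c) (T d) + row_form (mat 1) (lc c) (lc d)"
proof -
  have 0: "T c n = 0" "T d n = 0" "c n = 0" "d n = 0"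
    using lowD[OF T_low[OF assms(2,3)]] lowD[OF T_low[OF assms(2,4)]] lowD[OF assms(3)] lowD[OF assms(4)]
    by simp_all
  then have "tform M n c d = tform M n (shift c) (shift d)"
    by (simp add: tform_shift)
  then show ?thesis using 0 assms(1)
    unfolding shift_eq_T tform_add_left tform_add_right orthonormal_for_def by simp
qed

text \<open>The squares of the top coefficients of \<open>T\<^sup>m c\<close> are summable, and a coefficient that is not on top
  moves up by one in each step, except for a multiple of the top coefficient.\<close>

lemma T_pow_tendsto_zero:
  assumes M: "orthonormal_for M" and n: "0 < n" and c: "low c"
    and pos: "\<And>c. 0 \<le> Re (tform M n c c)"
  shows "(\<lambda>m. (T ^^ m) c i) \<longlonglongrightarrow> 0"
proof -
  define s where "s m = Re (tform M n ((T ^^ m) c) ((T ^^ m) c))" for m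
  define u where "u m = lc ((T ^^ m) c)" for m
  have step: "s m = s (Suc m) + (norm (u m))\<^sup>2" for m
    using tform_T[OF M n T_pow_low[OF n c] T_pow_low[OF n c], of m m]
    by (simp add: s_def u_def row_form_mat1)
  have "s (Suc m) \<le> s m" for m using step[of m] by simp
  then have "decseq s" by (rule decseq_SucI)
  moreover have "\<forall>m. 0 \<le> s m" by (simp add: s_def pos)
  ultimately obtain l where l: "s \<longlonglongrightarrow> l" by (rule decseq_convergent)
  have "(\<lambda>m. s m - s (Suc m)) \<longlonglongrightarrow> l - l"
    by (intro tendsto_diff l LIMSEQ_Suc)
  moreover have "s m - s (Suc m) = (norm (u m))\<^sup>2" for m using step[of m] by simp
  ultimately have "(\<lambda>m. (norm (u m))\<^sup>2) \<longlonglongrightarrow> 0" by simp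
  then have "(\<lambda>m. sqrt ((norm (u m))\<^sup>2)) \<longlonglongrightarrow> sqrt 0" by (rule tendsto_real_sqrt)
  then have u: "u \<longlonglongrightarrow> 0" by (simp add: tendsto_norm_zero_iff)
  show ?thesis
  proof (induction i)
    case 0
    have "(\<lambda>m. 0 - u m v* a 0) \<longlonglongrightarrow> 0 - 0"
      by (intro tendsto_diff tendsto_const tendsto_vector_matrix_mult_zero u)
    then have "(\<lambda>m. (T ^^ Suc m) c 0) \<longlonglongrightarrow> 0" by (simp add: T_def u_def)
    then show ?case by (rule LIMSEQ_imp_Suc)
  next
    case (Suc i)
    have "(\<lambda>m. (T ^^ m) c i - u m v* a (Suc i)) \<longlonglongrightarrow> 0 - 0"
      by (intro tendsto_diff Suc tendsto_vector_matrix_mult_zero u)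
    then have "(\<lambda>m. (T ^^ Suc m) c (Suc i)) \<longlonglongrightarrow> 0" by (simp add: T_def u_def)
    then show ?case by (rule LIMSEQ_imp_Suc)
  qed
qed

text \<open>Both forms change by the same amount under \<open>T\<close>, so their difference on rows
  of degree less than \<open>n\<close> is constant along the iterates of \<open>T\<close>; it is 0
  because the iterates tend to 0. Positivity of one form gives this convergence for both, since they
  share \<open>T\<close>.\<close>

lemma moments_determined:
  assumes M: "orthonormal_for M" and pos: "\<And>c. 0 \<le> Re (tform M n c c)"
    and M': "orthonormal_for M'" and k: "\<bar>k\<bar> \<le> int n"
  shows "M k = M' k"
proof -
  have low: "tform M n c d = tform M' n c d"
    if c: "low c" and d: "low d" for c d
  proof (cases "n = 0")
    case True
    then show ?thesis using lowD[OF c, of 0] by (simp add: tform_def)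
  next
    case False
    then have n: "0 < n" by simp
    define D where "D m = tform M n ((T ^^ m) c) ((T ^^ m) d) - tform M' n ((T ^^ m) c) ((T ^^ m) d)" for m
    have "D m = D 0" for m
    proof (induction m)
      case (Suc m)
      have "D m = D (Suc m)"
        unfolding D_def
        using tform_T[OF M n T_pow_low[OF n c] T_pow_low[OF n d], of m m]
          tform_T[OF M' n T_pow_low[OF n c] T_pow_low[OF n d], of m m] by simp
      with Suc show ?case by simp
    qed simp
    moreover have "D \<longlonglongrightarrow> 0 - 0"
      unfolding D_def tform_def
      by (intro tendsto_diff tendsto_null_sum tendsto_row_form_zero T_pow_tendsto_zero[OF M n _ pos] c d)
    moreover have "D = (\<lambda>_. D 0)" using \<open>\<And>m. D m = D 0\<close> by (rule ext)
    ultimately have "(\<lambda>_::nat. D 0) \<longlonglongrightarrow> 0" by simp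
    then have "D 0 = 0" by (simp add: LIMSEQ_const_iff)
    then show ?thesis by (simp add: D_def)
  qed
  have all: "tform M n c d = tform M' n c d"
    if c: "\<And>i. n < i \<Longrightarrow> c i = 0" and d: "\<And>i. n < i \<Longrightarrow> d i = 0" for c d
  proof -
    \<comment> \<open>Left multiples of \<open>a\<close> clear the coefficients of order
      \<open>n\<close>. This extends the equality from degree less than \<open>n\<close> to degree
      \<open>n\<close>.\<close>
    define v w where "v = c n v* matrix_inv (a n)" and "w = d n v* matrix_inv (a n)"
    define c' d' where "c' = (\<lambda>i. c i - v v* a i)" and "d' = (\<lambda>i. d i - w v* a i)"
    have "v v* a n = c n" "w v* a n = d n"
      by (simp_all add: v_def w_def vector_matrix_mul_assoc matrix_inv lead)
    then have "c' i = 0" "d' i = 0" if "n \<le> i" for i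
      using that c[of i] d[of i] beyond[of i] by (cases "i = n"; simp add: c'_def d'_def)+
    then have supp: "low c'" "low d'" by (simp_all add: low_def)
    have eq: "c = (\<lambda>i. c' i + v v* a i)" "d = (\<lambda>i. d' i + w v* a i)"
      by (simp_all add: c'_def d'_def)
    have "tform M n c' d' = tform M' n c' d'" by (intro low supp)
    then show ?thesis
      using M M' lowD[OF supp(1), of n] lowD[OF supp(2), of n]
      unfolding eq tform_add_left tform_add_right orthonormal_for_def by simp
  qed
  obtain i j where ij: "i \<le> n" "j \<le> n" "k = int i - int j"
  proof (cases "0 \<le> k")
    case True
    then show thesis using k that[of "nat k" 0] by auto
  next
    case False
    then show thesis using k that[of 0 "nat (- k)"] by auto
  qed
  show ?thesis
  proof (rule row_form_eqI)
    fix u w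
    have "tform M n (\<lambda>t. if t = i then u else 0) (\<lambda>t. if t = j then w else 0)
        = tform M' n (\<lambda>t. if t = i then u else 0) (\<lambda>t. if t = j then w else 0)"
      using ij by (intro all) auto
    then show "row_form (M k) u w = row_form (M' k) u w"
      using ij by (simp add: tform_single)
  qed
qed

definition row_eval :: "(nat \<Rightarrow> complex^'p) \<Rightarrow> complex \<Rightarrow> complex^'p" where
  "row_eval c z = (\<Sum>i\<le>n. z ^ i *s c i)"

definition eval_a :: "complex \<Rightarrow> complex^'p^'p" where
  "eval_a z = (\<Sum>i\<le>n. mat (z ^ i) ** a i)"

lemma row_eval_a: "row_eval (\<lambda>i. v v* a i) z = v v* eval_a z"
  by (simp add: row_eval_def eval_a_def vector_matrix_mult_sum_right vector_matrix_scale)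

lemma row_eval_T:
  assumes "0 < n" "low c"
  shows "row_eval (T c) z = z *s row_eval c z - lc c v* eval_a z"
proof -
  obtain m where m: "n = Suc m" using assms(1) by (cases n) auto
  have "row_eval (shift c) z = (\<Sum>i\<le>m. z ^ Suc i *s c i)"
    unfolding row_eval_def unfolding m sum.atMost_Suc_shift by simp
  also have "\<dots> = z *s row_eval c z"
    using lowD[OF assms(2), of n] unfolding row_eval_def unfolding m by (simp add: vec_eq_iff sum_distrib_left mult_ac)
  finally have "row_eval (shift c) z = z *s row_eval c z" .
  moreover have "row_eval (shift c) z = row_eval (T c) z + row_eval (\<lambda>i. lc c v* a i) z"
    unfolding shift_eq_T row_eval_def by (simp add: vec_eq_iff sum.distrib distrib_left)
  ultimately show ?thesis by (simp add: row_eval_a eq_diff_eq)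
qed

text \<open>If \<open>v\<close> annihilates the value at a point \<open>z\<close> of the circle,
  then \<open>x - z\<close> divides \<open>v a(x)\<close>, and the quotient \<open>c\<close>
  satisfies \<open>T c = z c\<close>. As \<open>z\<close> has modulus 1, the iterates of
  \<open>T\<close> at \<open>c\<close> keep their size, although they must tend to 0.\<close>

lemma eval_a_invertible:
  assumes M: "orthonormal_for M" and pos: "\<And>c. 0 \<le> Re (tform M n c c)" and z: "cmod z = 1"
  shows "invertible (eval_a z)"
proof -
  have inj: "v = 0" if v: "v v* eval_a z = 0" for v
  proof (rule ccontr)
    assume "v \<noteq> 0"
    have lead0: "v v* a n \<noteq> 0"
    proof
      assume "v v* a n = 0"
      then have "v v* (a n ** matrix_inv (a n)) = 0" by (simp flip: vector_matrix_mul_assoc)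
      with \<open>v \<noteq> 0\<close> show False by (simp add: matrix_inv lead)
    qed
    show False
    proof (cases "n = 0")
      case True
      have "eval_a z = a 0" unfolding eval_a_def unfolding True by simp
      with v lead0 show False unfolding True by simp
    next
      case False
      then have n: "0 < n" by simp
      \<comment> \<open>The coefficients of the quotient of \<open>v a(x)\<close> by
        \<open>x - z\<close>, from synthetic division.\<close>
      define c where "c = (\<lambda>j. \<Sum>i\<in>{Suc j..n}. z ^ (i - Suc j) *s (v v* a i))"
      have sum_powers: "(\<Sum>i\<in>{Suc j..n}. z ^ (i - j) *s (v v* a i)) = z *s c j" for j
      proof -
        have "z *s c j = (\<Sum>i\<in>{Suc j..n}. z *s (z ^ (i - Suc j) *s (v v* a i)))"
          by (simp add: c_def vec_eq_iff sum_distrib_left mult.assoc)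
        also have "\<dots> = (\<Sum>i\<in>{Suc j..n}. z ^ (i - j) *s (v v* a i))"
        proof (rule sum.cong[OF refl])
          fix i assume "i \<in> {Suc j..n}"
          then have "i - j = Suc (i - Suc j)" by auto
          then show "z *s (z ^ (i - Suc j) *s (v v* a i)) = z ^ (i - j) *s (v v* a i)"
            by (simp add: vec_eq_iff)
        qed
        finally show ?thesis by simp
      qed
      have c0: "low c" by (simp add: c_def low_def)
      have rec: "c j = v v* a (Suc j) + z *s c (Suc j)" for j
      proof (cases "Suc j \<le> n")
        case True
        then have "c j = z ^ 0 *s (v v* a (Suc j)) + (\<Sum>i\<in>{Suc (Suc j)..n}. z ^ (i - Suc j) *s (v v* a i))"
          by (simp add: c_def sum.atLeast_Suc_atMost)
        also have "(\<Sum>i\<in>{Suc (Suc j)..n}. z ^ (i - Suc j) *s (v v* a i)) = z *s c (Suc j)"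
          by (rule sum_powers)
        finally show ?thesis by simp
      next
        case False
        then show ?thesis by (simp add: c_def beyond)
      qed
      have c_last: "c (n - 1) = v v* a n" using rec[of "n - 1"] n lowD[OF c0, of n] by simp
      then have top: "lc c = v"
        by (simp add: lc_def vector_matrix_mul_assoc matrix_inv lead)
      have zero: "v v* a 0 + z *s c 0 = 0"
      proof -
        have "row_eval (\<lambda>i. v v* a i) z = 0" using v by (simp add: row_eval_a)
        moreover have "row_eval (\<lambda>i. v v* a i) z = v v* a 0 + (\<Sum>i\<in>{Suc 0..n}. z ^ i *s (v v* a i))"
          unfolding row_eval_def atMost_atLeast0 by (subst sum.atLeast_Suc_atMost) simp_all
        moreover have "(\<Sum>i\<in>{Suc 0..n}. z ^ i *s (v v* a i)) = z *s c 0"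
          using sum_powers[of 0] by simp
        ultimately show ?thesis by simp
      qed
      have Tc: "T c = (\<lambda>i. z *s c i)"
      proof
        fix i
        show "T c i = z *s c i"
        proof (cases i)
          case 0
          then show ?thesis using zero by (simp add: T_def top neg_eq_iff_add_eq_0)
        next
          case (Suc j)
          then show ?thesis using rec[of j] by (simp add: T_def top)
        qed
      qed
      have T_scale: "T (\<lambda>i. k *s c i) = (\<lambda>i. k *s T c i)" for k
      proof
        fix i
        show "T (\<lambda>i. k *s c i) i = k *s T c i"
          by (cases i) (simp_all add: T_def lc_def scalar_vector_matrix_assoc vec_eq_iff algebra_simps)
      qed
      have pow: "(T ^^ m) c = (\<lambda>i. z ^ m *s c i)" for m
      proof (induction m)
        case (Suc m)
        then show ?case by (simp add: T_scale Tc vec_eq_iff mult_ac)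
      qed simp
      have "(\<lambda>m. (T ^^ m) c (n - 1)) \<longlonglongrightarrow> 0" by (rule T_pow_tendsto_zero[OF M n c0 pos])
      then have "(\<lambda>m. norm ((T ^^ m) c (n - 1))) \<longlonglongrightarrow> 0" by (rule tendsto_norm_zero)
      moreover have "norm (z ^ m *s x) = norm x" for m and x :: "complex^'p"
        using z by (simp add: norm_vec_def norm_mult norm_power)
      ultimately have "norm (c (n - 1)) = 0" by (simp add: pow LIMSEQ_const_iff)
      with lead0 c_last show False by simp
    qed
  qed
  have "inj ((*v) (transpose (eval_a z)))"
  proof (rule injI)
    fix x y assume "transpose (eval_a z) *v x = transpose (eval_a z) *v y"
    then have "(x - y) v* eval_a z = 0" by (simp add: vector_matrix_mult_diff_distrib)
    then show "x = y" using inj by fastforce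
  qed
  then have "invertible (transpose (eval_a z))"
    by (simp only: invertible_left_inverse matrix_left_invertible_injective)
  then show ?thesis by (simp add: invertible_det_nz)
qed

end

lemma sum_swap4:
  "(\<Sum>k\<in>A. \<Sum>l\<in>B. \<Sum>i\<in>I. \<Sum>j\<in>J. f k l i j) = (\<Sum>i\<in>I. \<Sum>j\<in>J. \<Sum>k\<in>A. \<Sum>l\<in>B. f k l i j)"
proof -
  have "(\<Sum>k\<in>A. \<Sum>l\<in>B. \<Sum>i\<in>I. \<Sum>j\<in>J. f k l i j) = (\<Sum>k\<in>A. \<Sum>i\<in>I. \<Sum>l\<in>B. \<Sum>j\<in>J. f k l i j)"
    by (intro sum.cong refl sum.swap)
  also have "\<dots> = (\<Sum>i\<in>I. \<Sum>k\<in>A. \<Sum>l\<in>B. \<Sum>j\<in>J. f k l i j)" by (rule sum.swap)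
  also have "\<dots> = (\<Sum>i\<in>I. \<Sum>k\<in>A. \<Sum>j\<in>J. \<Sum>l\<in>B. f k l i j)" by (intro sum.cong refl sum.swap)
  also have "\<dots> = (\<Sum>i\<in>I. \<Sum>j\<in>J. \<Sum>k\<in>A. \<Sum>l\<in>B. f k l i j)" by (intro sum.cong refl sum.swap)
  finally show ?thesis .
qed

lemma cis_power_trig: "trig n (\<lambda>\<theta>. cis (of_int k * \<theta>))" if "\<bar>k\<bar> \<le> int n"
  using trig_monomial[OF that, of 1] by simp

text \<open>\<open>L\<close> stands both for \<open>entry_integral \<rho>\<close> and for
  integration against the entries of \<open>F n\<close>, so one computation gives the quadratic
  forms of both moment sequences.\<close>

lemma tform_functional:
  fixes L :: "'p::finite \<Rightarrow> 'p \<Rightarrow> (real \<Rightarrow> complex) \<Rightarrow> complex"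
  assumes sum: "\<And>k l (I :: nat set) f. (\<And>i. i \<in> I \<Longrightarrow> bounded_borel (f i)) \<Longrightarrow>
      L k l (\<lambda>\<theta>. \<Sum>i\<in>I. f i \<theta>) = (\<Sum>i\<in>I. L k l (f i))"
    and scale: "\<And>k l c f. bounded_borel f \<Longrightarrow> L k l (\<lambda>\<theta>. c * f \<theta>) = c * L k l f"
  shows "(\<Sum>k\<in>UNIV. \<Sum>l\<in>UNIV. L k l (\<lambda>\<theta>. (\<Sum>i\<le>n. cis \<theta> ^ i *s c i) $ k * cnj ((\<Sum>j\<le>n. cis \<theta> ^ j *s d j) $ l)))
    = tform (\<lambda>m. \<chi> k l. L k l (\<lambda>\<theta>. cis (of_int m * \<theta>))) n c d"
proof -
  let ?e = "\<lambda>i j \<theta>. cis (of_int (int i - int j) * \<theta>)"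
  have e: "bounded_borel (\<lambda>\<theta>. ?e i j \<theta>)" for i j
    by (rule bounded_borel_trig[OF cis_power_trig[of _ "nat \<bar>int i - int j\<bar>"]]) simp
  have e': "bounded_borel (\<lambda>\<theta>. x * ?e i j \<theta>)" for x i j
    by (intro bounded_borel_mult[OF bounded_borel_const] e)
  have "L k l (\<lambda>\<theta>. (\<Sum>i\<le>n. cis \<theta> ^ i *s c i) $ k * cnj ((\<Sum>j\<le>n. cis \<theta> ^ j *s d j) $ l))
      = (\<Sum>i\<le>n. \<Sum>j\<le>n. c i $ k * L k l (?e i j) * cnj (d j $ l))" for k l
  proof -
    have "cis \<theta> ^ i * cnj (cis \<theta> ^ j) = ?e i j \<theta>" for \<theta> i j
    proof -
      have "cis \<theta> ^ i * cnj (cis \<theta> ^ j) = cis (real i * \<theta> + real j * (- \<theta>))"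
        by (simp only: complex_cnj_power cis_cnj Complex.DeMoivre cis_mult mult_minus_right)
      then show ?thesis by (simp add: algebra_simps)
    qed
    then have eq: "(\<Sum>i\<le>n. cis \<theta> ^ i *s c i) $ k * cnj ((\<Sum>j\<le>n. cis \<theta> ^ j *s d j) $ l)
        = (\<Sum>i\<le>n. \<Sum>j\<le>n. (c i $ k * cnj (d j $ l)) * ?e i j \<theta>)" for \<theta>
      by (simp add: sum_component sum_product mult_ac)
    have "L k l (\<lambda>\<theta>. \<Sum>i\<le>n. \<Sum>j\<le>n. (c i $ k * cnj (d j $ l)) * ?e i j \<theta>)
        = (\<Sum>i\<le>n. L k l (\<lambda>\<theta>. \<Sum>j\<le>n. (c i $ k * cnj (d j $ l)) * ?e i j \<theta>))"
      by (rule sum) (intro bounded_borel_sum e')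
    also have "\<dots> = (\<Sum>i\<le>n. \<Sum>j\<le>n. L k l (\<lambda>\<theta>. (c i $ k * cnj (d j $ l)) * ?e i j \<theta>))"
      by (intro sum.cong refl sum e')
    also have "\<dots> = (\<Sum>i\<le>n. \<Sum>j\<le>n. c i $ k * L k l (?e i j) * cnj (d j $ l))"
      by (intro sum.cong refl, subst scale[OF e]) (simp only: mult_ac)
    finally show ?thesis unfolding eq .
  qed
  then show ?thesis
    by (simp only: tform_def row_form_def vec_lambda_beta) (rule sum_swap4)
qed

section \<open>Values of matrix polynomials and integrals on the circle\<close>

lemma mat_poly_eval_bound:
  assumes "degree P \<le> n"
  shows "mat_poly_eval P z = (\<Sum>i\<le>n. mat (z ^ i) ** coeff P i)"
  unfolding mat_poly_eval_def
  using assms by (intro sum.mono_neutral_left) (auto simp: coeff_eq_0)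

lemma vector_mat_poly_eval:
  assumes "degree P \<le> n"
  shows "v v* mat_poly_eval P z = (\<Sum>i\<le>n. z ^ i *s (v v* coeff P i))"
  by (simp add: mat_poly_eval_bound[OF assms] vector_matrix_mult_sum_right vector_matrix_scale)

lemma axis_vector_matrix: "axis r 1 v* A = A $ r" for A :: "complex^'m^'n"
  by (simp add: vec_eq_iff vector_matrix_mult_def axis_def if_distribR if_distrib cong: if_cong)

lemma mat_poly_eval_row:
  assumes "degree P \<le> n"
  shows "mat_poly_eval P z $ r = (\<Sum>i\<le>n. z ^ i *s (coeff P i $ r))"
  using vector_mat_poly_eval[OF assms, of "axis r 1" z] by (simp add: axis_vector_matrix)

lemma row_form_mat1_eq: "row_form (mat 1) x y = (\<Sum>r\<in>UNIV. x $ r * cnj (y $ r))"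
  by (simp add: row_form_eq_vector_matrix)

lemma row_form_expand:
  fixes A B M :: "complex^'p^'p"
  shows "row_form M (v v* A) (w v* B) = (\<Sum>r\<in>UNIV. \<Sum>s\<in>UNIV. v $ r * row_form M (A $ r) (B $ s) * cnj (w $ s))"
proof -
  have "x v* C = (\<Sum>r\<in>UNIV. x $ r *s C $ r)" for x and C :: "complex^'p^'p"
    by (simp add: vec_eq_iff vector_matrix_mult_def sum_component)
  then show ?thesis
    by (simp only: row_form_sum_left row_form_scale_left)
      (simp add: row_form_sum_right row_form_scale_right sum_distrib_left mult_ac)
qed

text \<open>Cramer's rule writes the entries of the inverse as quotients of determinants.\<close>

lemma continuous_on_matrix_inv:
  fixes A :: "'a::topological_space \<Rightarrow> complex^'n^'n"
  assumes c: "\<And>i j. continuous_on S (\<lambda>x. A x $ i $ j)" and inv: "\<And>x. x \<in> S \<Longrightarrow> invertible (A x)"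
  shows "continuous_on S (\<lambda>x. matrix_inv (A x) $ k $ j)"
proof -
  have "matrix_inv (A x) $ k $ j = det (\<chi> i l. if l = k then axis j 1 $ i else A x $ i $ l) / det (A x)"
    if "x \<in> S" for x
  proof -
    have "A x *v (matrix_inv (A x) *v axis j 1) = axis j 1"
      by (simp add: matrix_vector_mul_assoc matrix_inv inv that)
    then have "matrix_inv (A x) *v axis j 1 = (\<chi> k. det (\<chi> i l. if l = k then axis j 1 $ i else A x $ i $ l) / det (A x))"
      using inv[OF that] by (subst (asm) cramer) (simp_all add: invertible_det_nz)
    moreover have "(matrix_inv (A x) *v axis j 1) $ k = matrix_inv (A x) $ k $ j"
      by (simp add: matrix_vector_mult_def axis_def if_distrib cong: if_cong)
    ultimately show ?thesis by simp
  qed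
  moreover have "continuous_on S (\<lambda>x. det (\<chi> i l. if l = k then axis j 1 $ i else A x $ i $ l) / det (A x))"
  proof (intro continuous_on_divide continuous_on_det)
    show "continuous_on S (\<lambda>x. (\<chi> i l. if l = k then axis j 1 $ i else A x $ i $ l) $ i' $ l')" for i' l'
      using c by (cases "l' = k") simp_all
    show "\<forall>x\<in>S. det (A x) \<noteq> 0" using inv by (simp add: invertible_det_nz)
  qed (rule c)
  ultimately show ?thesis by (simp cong: continuous_on_cong)
qed

lemma bounded_borel_circle:
  assumes "continuous_on (sphere 0 1) g"
  shows "bounded_borel (\<lambda>\<theta>. g (cis \<theta>))"
proof -
  have "bounded (g ` sphere 0 1)"
    by (intro compact_imp_bounded compact_continuous_image assms) simp
  then obtain B where "\<forall>y\<in>g ` sphere 0 1. cmod y \<le> B" unfolding bounded_iff by blast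
  then have "cmod (g (cis \<theta>)) \<le> B" for \<theta> by auto
  moreover have "continuous_on UNIV (\<lambda>\<theta>. g (cis \<theta>))"
    by (intro continuous_on_compose2[OF assms] continuous_intros) auto
  ultimately show ?thesis
    unfolding bounded_borel_def by (auto intro!: borel_measurable_continuous_onI exI[of _ B])
qed

lemma bounded_borel_integrable_circ: "bounded_borel f \<Longrightarrow> integrable circ f"
  by (rule bounded_borel_integrable[OF _ finite_measure_circ sets_circ])

lemma integral_circ_cis:
  assumes "k \<noteq> 0"
  shows "(\<integral>\<theta>. cis (of_int k * \<theta>) \<partial>circ) = 0"
proof -
  let ?F = "\<lambda>\<theta>. cis (of_int k * \<theta>) / (\<i> * of_int k)"
  have "(\<integral>\<theta>. indicator {0..2*pi} \<theta> *\<^sub>R cis (of_int k * \<theta>) \<partial>lborel) = ?F (2*pi) - ?F 0"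
  proof (rule integral_FTC_Icc)
    fix x :: real
    have "((\<lambda>\<theta>. cis (of_int k * \<theta>)) has_vector_derivative (of_int k * (\<i> * cis (of_int k * x)))) (at x)"
    proof -
      have "((\<lambda>\<theta>. of_int k * (\<i> * complex_of_real \<theta>)) has_vector_derivative of_int k * (\<i> * of_real 1)) (at x)"
        by (intro has_vector_derivative_mult_right has_vector_derivative_of_real DERIV_ident)
      from field_vector_diff_chain_at[OF this DERIV_exp] show ?thesis
        by (simp add: o_def cis_conv_exp mult_ac)
    qed
    then have "(?F has_vector_derivative (of_int k * (\<i> * cis (of_int k * x)) / (\<i> * of_int k))) (at x)"
      by (rule has_vector_derivative_divide)
    then show "(?F has_vector_derivative cis (of_int k * x)) (at x within {0..2*pi})"
      using assms by (simp add: has_vector_derivative_at_within)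
  qed (auto intro!: continuous_intros)
  also have "\<dots> = 0"
  proof -
    have "cis (of_int k * (2 * pi)) = 1" by (metis cis_multiple_2pi mult.commute Ints_of_int)
    then show ?thesis by simp
  qed
  finally have 0: "(\<integral>\<theta>. indicator {0..2*pi} \<theta> *\<^sub>R cis (of_int k * \<theta>) \<partial>lborel) = 0" .
  have "(\<integral>\<theta>. indicator {0..<2*pi} \<theta> *\<^sub>R cis (of_int k * \<theta>) \<partial>lborel)
      = (\<integral>\<theta>. indicator {0..2*pi} \<theta> *\<^sub>R cis (of_int k * \<theta>) \<partial>lborel)"
  proof (rule integral_cong_AE)
    have "AE \<theta> in lborel. \<theta> \<noteq> 2 * pi" by (rule AE_lborel_singleton)
    then show "AE \<theta> in lborel. indicator {0..<2*pi} \<theta> *\<^sub>R cis (of_int k * \<theta>) = indicator {0..2*pi} \<theta> *\<^sub>R cis (of_int k * \<theta>)"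
      by eventually_elim (auto simp: indicator_def)
  next
    have [measurable]: "(\<lambda>\<theta>. cis (of_int k * \<theta>)) \<in> borel_measurable borel"
      by (intro borel_measurable_continuous_onI continuous_intros)
    show "(\<lambda>\<theta>. indicator {0..<2*pi} \<theta> *\<^sub>R cis (of_int k * \<theta>)) \<in> borel_measurable lborel"
      "(\<lambda>\<theta>. indicator {0..2*pi} \<theta> *\<^sub>R cis (of_int k * \<theta>)) \<in> borel_measurable lborel"
      by measurable
  qed
  then show ?thesis
    by (subst integral_circ(1)) (simp_all add: 0 borel_measurable_continuous_onI continuous_intros)
qed

section \<open>Bernstein-Szego approximation\<close>

locale orthonormal_system = decomposed_measure \<rho> W N
  for \<rho> :: "real set \<Rightarrow> complex^'p^'p" and W N +
  fixes \<phi> :: "nat \<Rightarrow> (complex^'p^'p) poly"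
  assumes nondeg: "nondegenerate \<rho>" and orth: "left_orthonormal \<rho> \<phi>"
begin

definition mom :: "int \<Rightarrow> complex^'p^'p" where
  "mom m = (\<chi> k l. entry_integral \<rho> k l (\<lambda>\<theta>. cis (of_int m * \<theta>)))"

lemma degree_\<phi> [simp]: "degree (\<phi> n) = n"
  using orth by (simp add: left_orthonormal_def)

lemma row_integral_tform:
  "row_integral \<rho> (\<lambda>\<theta>. \<Sum>i\<le>n. cis \<theta> ^ i *s c i) (\<lambda>\<theta>. \<Sum>j\<le>n. cis \<theta> ^ j *s d j) = tform mom n c d"
  unfolding row_integral_def mom_def
  by (rule tform_functional) (simp_all add: entry_integral_sum[OF mm] entry_integral_scale)

lemma tform_matrix_integral:
  assumes "degree P \<le> n" "degree Q \<le> n"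
  shows "tform mom n (\<lambda>i. v v* coeff P i) (\<lambda>j. w v* coeff Q j)
    = row_form (matrix_integral \<rho> (\<lambda>\<theta>. mat_poly_eval P (cis \<theta>)) (\<lambda>\<theta>. mat_poly_eval Q (cis \<theta>))) v w"
proof -
  have "tform mom n (\<lambda>i. v v* coeff P i) (\<lambda>j. w v* coeff Q j)
    = (\<Sum>r\<in>UNIV. \<Sum>s\<in>UNIV. v $ r * tform mom n (\<lambda>i. coeff P i $ r) (\<lambda>j. coeff Q j $ s) * cnj (w $ s))"
    unfolding tform_def row_form_expand
    by (simp only: sum_distrib_left sum_distrib_right) (rule sum_swap4)
  then show ?thesis
    unfolding row_integral_tform[symmetric]
    by (simp add: row_form_def matrix_integral_def mat_poly_eval_row[OF assms(1)] mat_poly_eval_row[OF assms(2)])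
qed

lemma tform_\<phi>:
  assumes "i \<le> n" "j \<le> n"
  shows "tform mom n (\<lambda>t. v v* coeff (\<phi> i) t) (\<lambda>t. w v* coeff (\<phi> j) t) = (if i = j then row_form (mat 1) v w else 0)"
  using orth assms by (simp add: tform_matrix_integral left_orthonormal_def)

lemma coefficients_\<phi>: "coefficients (coeff (\<phi> n)) n"
  using orth by unfold_locales (auto simp: left_orthonormal_def coeff_eq_0 dest!: spec[of _ n])

lemma tform_mom_nonneg: "0 \<le> Re (tform mom n c c)"
proof -
  define v where "v = (\<Sum>i\<le>n. monom (c i) i)"
  have co: "coeff v i = (if i \<le> n then c i else 0)" for i
    unfolding v_def coeff_sum by (cases "i \<le> n") (auto intro!: sum.neutral)
  have "degree v \<le> n" by (rule degree_le) (simp add: co)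
  then have "vec_poly_eval v z = (\<Sum>i\<le>n. z ^ i *s coeff v i)" for z
    unfolding vec_poly_eval_def by (intro sum.mono_neutral_left) (auto simp: coeff_eq_0)
  then have "vec_poly_eval v z = (\<Sum>i\<le>n. z ^ i *s c i)" for z by (simp add: co)
  then have eq: "row_integral \<rho> (\<lambda>\<theta>. vec_poly_eval v (cis \<theta>)) (\<lambda>\<theta>. vec_poly_eval v (cis \<theta>)) = tform mom n c c"
    by (simp add: row_integral_tform)
  show ?thesis
  proof (cases "v = 0")
    case True
    then have "c i = 0" if "i \<le> n" for i using co[of i] that by simp
    then show ?thesis by (simp add: tform_def)
  next
    case False
    then have "0 < tform mom n c c" using nondeg eq by (auto simp: nondegenerate_def)
    then show ?thesis by (simp add: less_complex_def)
  qed
qed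

text \<open>Orthogonality is given against left multiples of the other \<open>\<phi> m\<close>.
  Subtracting such a multiple clears the top coefficient of \<open>d\<close>, because leading
  coefficients are invertible.\<close>

lemma tform_low_zero:
  assumes "m \<le> n" "\<And>i. m \<le> i \<Longrightarrow> d i = 0"
  shows "tform mom n (\<lambda>i. v v* coeff (\<phi> n) i) d = 0 \<and> tform mom n d (\<lambda>i. v v* coeff (\<phi> n) i) = 0"
  using assms
proof (induction m arbitrary: d)
  case 0
  then have "d i = 0" for i by simp
  then show ?case by (simp add: tform_def)
next
  case (Suc m)
  define w where "w = d m v* matrix_inv (coeff (\<phi> m) m)"
  define d' where "d' = (\<lambda>i. d i - w v* coeff (\<phi> m) i)"
  have "invertible (coeff (\<phi> m) m)" using coefficients_\<phi> by (rule coefficients.lead)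
  then have "w v* coeff (\<phi> m) m = d m" by (simp add: w_def vector_matrix_mul_assoc matrix_inv)
  then have "d' i = 0" if "m \<le> i" for i
    using that Suc.prems(2)[of i] by (cases "i = m") (simp_all add: d'_def coeff_eq_0)
  then have IH: "tform mom n (\<lambda>i. v v* coeff (\<phi> n) i) d' = 0" "tform mom n d' (\<lambda>i. v v* coeff (\<phi> n) i) = 0"
    using Suc.IH[of d'] Suc.prems(1) by auto
  have d: "d = (\<lambda>i. d' i + w v* coeff (\<phi> m) i)" by (simp add: d'_def)
  show ?case unfolding d tform_add_left tform_add_right IH
    using Suc.prems(1) by (simp add: tform_\<phi>)
qed

lemma orthonormal_mom: "coefficients.orthonormal_for (coeff (\<phi> n)) n mom"
proof -
  interpret coefficients "coeff (\<phi> n)" n by (rule coefficients_\<phi>)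
  have "tform mom n (\<lambda>i. v v* coeff (\<phi> n) i) d = 0 \<and> tform mom n d (\<lambda>i. v v* coeff (\<phi> n) i) = 0"
    if "d n = 0" for v d
  proof -
    let ?d = "\<lambda>i. if i < n then d i else 0"
    have d: "d i = ?d i" if "i \<le> n" for i using that \<open>d n = 0\<close> by (cases "i = n") auto
    have "tform mom n (\<lambda>i. v v* coeff (\<phi> n) i) d = tform mom n (\<lambda>i. v v* coeff (\<phi> n) i) ?d"
      "tform mom n d (\<lambda>i. v v* coeff (\<phi> n) i) = tform mom n ?d (\<lambda>i. v v* coeff (\<phi> n) i)"
      using d by (intro tform_cong; simp)+
    then show ?thesis using tform_low_zero[of n n ?d v] by simp
  qed
  then show ?thesis by (simp add: orthonormal_for_def tform_\<phi>)
qed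

definition \<Phi> :: "nat \<Rightarrow> real \<Rightarrow> complex^'p^'p" where
  "\<Phi> n \<theta> = mat_poly_eval (\<phi> n) (cis \<theta>)"

definition \<Psi> :: "nat \<Rightarrow> real \<Rightarrow> complex^'p^'p" where
  "\<Psi> n \<theta> = matrix_inv (\<Phi> n \<theta>)"

definition F :: "nat \<Rightarrow> real \<Rightarrow> complex^'p^'p" where
  "F n \<theta> = \<Psi> n \<theta> ** htranspose (\<Psi> n \<theta>)"

lemma eval_a_\<phi>: "coefficients.eval_a (coeff (\<phi> n)) n z = mat_poly_eval (\<phi> n) z"
  by (simp add: coefficients.eval_a_def[OF coefficients_\<phi>] mat_poly_eval_def)

lemma mat_poly_eval_\<phi>_invertible: "cmod z = 1 \<Longrightarrow> invertible (mat_poly_eval (\<phi> n) z)"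
  using coefficients.eval_a_invertible[OF coefficients_\<phi> orthonormal_mom tform_mom_nonneg]
  by (simp add: eval_a_\<phi>)

lemma \<Phi>_invertible: "invertible (\<Phi> n \<theta>)"
  unfolding \<Phi>_def by (rule mat_poly_eval_\<phi>_invertible) simp

lemma \<Phi>_\<Psi> [simp]: "\<Phi> n \<theta> ** \<Psi> n \<theta> = mat 1" and \<Psi>_\<Phi> [simp]: "\<Psi> n \<theta> ** \<Phi> n \<theta> = mat 1"
  unfolding \<Psi>_def by (rule matrix_inv[OF \<Phi>_invertible])+

lemma mat_poly_eval_entry: "mat_poly_eval P z $ r $ s = (\<Sum>i\<le>degree P. z ^ i * coeff P i $ r $ s)"
  by (simp add: mat_poly_eval_row[OF order_refl] sum_component)

lemma bounded_\<Psi>: "bounded_borel (\<lambda>\<theta>. \<Psi> n \<theta> $ r $ s)"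
  unfolding \<Psi>_def \<Phi>_def
proof (rule bounded_borel_circle)
  show "continuous_on (sphere 0 1) (\<lambda>z. matrix_inv (mat_poly_eval (\<phi> n) z) $ r $ s)"
    by (intro continuous_on_matrix_inv mat_poly_eval_\<phi>_invertible)
      (auto simp: mat_poly_eval_entry intro!: continuous_intros)
qed

lemma trig_\<Phi>: "trig n (\<lambda>\<theta>. \<Phi> n \<theta> $ r $ s)"
  unfolding \<Phi>_def mat_poly_eval_entry degree_\<phi>
proof (intro trig_sum)
  fix i assume "i \<in> {..n}"
  then have "trig n (\<lambda>\<theta>. coeff (\<phi> n) i $ r $ s * cis (of_int (int i) * \<theta>))"
    by (intro trig_monomial) simp
  then show "trig n (\<lambda>\<theta>. cis \<theta> ^ i * coeff (\<phi> n) i $ r $ s)"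
    by (simp add: Complex.DeMoivre mult.commute)
qed

lemma F_entry: "F n \<theta> $ r $ s = (\<Sum>t\<in>UNIV. \<Psi> n \<theta> $ r $ t * cnj (\<Psi> n \<theta> $ s $ t))"
  by (simp add: F_def matrix_matrix_mult_def htranspose_def transpose_def)

lemma bounded_F: "bounded_borel (\<lambda>\<theta>. F n \<theta> $ r $ s)"
  unfolding F_entry by (intro bounded_borel_sum bounded_borel_mult bounded_borel_cnj bounded_\<Psi>)

lemma row_form_F: "row_form (F n \<theta>) u w = row_form (mat 1) (u v* \<Psi> n \<theta>) (w v* \<Psi> n \<theta>)"
  using row_form_congruence[of "\<Psi> n \<theta>" "mat 1" "\<Psi> n \<theta>"] by (simp add: F_def)

abbreviation ev :: "nat \<Rightarrow> (nat \<Rightarrow> complex^'p) \<Rightarrow> real \<Rightarrow> complex^'p" where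
  "ev n c \<theta> \<equiv> coefficients.row_eval n c (cis \<theta>)"

lemma ev_eq: "ev n c \<theta> = (\<Sum>i\<le>n. cis \<theta> ^ i *s c i)"
  by (simp add: coefficients.row_eval_def[OF coefficients_\<phi>])

lemma ev_\<phi>: "ev n (\<lambda>i. v v* coeff (\<phi> n) i) \<theta> = v v* \<Phi> n \<theta>"
  by (simp add: coefficients.row_eval_a[OF coefficients_\<phi>] eval_a_\<phi> \<Phi>_def)

lemma bounded_ev: "bounded_borel (\<lambda>\<theta>. ev n c \<theta> $ r)"
  unfolding ev_eq by (rule bounded_borel_circle[of "\<lambda>z. (\<Sum>i\<le>n. z ^ i *s c i) $ r"])
    (auto simp: sum_component intro!: continuous_intros)

lemma bounded_ev_\<Psi>: "bounded_borel (\<lambda>\<theta>. (ev n c \<theta> v* \<Psi> n \<theta>) $ r)"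
  unfolding vector_matrix_mult_def vec_lambda_beta
  by (intro bounded_borel_sum bounded_borel_mult bounded_ev bounded_\<Psi>)

lemma bounded_cis: "bounded_borel (\<lambda>\<theta>. cis (of_int k * \<theta>))"
  by (rule bounded_borel_trig[OF cis_power_trig[of _ "nat \<bar>k\<bar>"]]) simp

text \<open>\<open>\<integral> q \<phi>\<^sub>n\<^sup>-\<^sup>1 dm = 0\<close> for row polynomials \<open>q\<close> of degree less than \<open>n\<close>: with
  \<open>J k q = \<integral> z\<^sup>k q \<phi>\<^sub>n\<^sup>-\<^sup>1 dm\<close> one has \<open>J k (T q) = J (k + 1) q\<close> for \<open>k \<noteq> 0\<close>, hence
  \<open>J 0 q = J (- m) (T\<^sup>m q)\<close>, which tends to \<open>0\<close>.\<close>

lemma integral_low_\<Psi>: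
  assumes "coefficients.low n c"
  shows "(\<integral>\<theta>. (ev n c \<theta> v* \<Psi> n \<theta>) $ r \<partial>circ) = 0"
proof (cases "n = 0")
  case True
  then have "ev n c \<theta> = 0" for \<theta>
    using coefficients.lowD[OF coefficients_\<phi> assms, of 0] by (simp add: ev_eq)
  then show ?thesis by simp
next
  case False
  then have n: "0 < n" by simp
  interpret coefficients "coeff (\<phi> n)" n by (rule coefficients_\<phi>)
  define J where "J k c = (\<integral>\<theta>. cis (of_int k * \<theta>) * (ev n c \<theta> v* \<Psi> n \<theta>) $ r \<partial>circ)" for k c
  have step: "J k (T c) = J (k + 1) c" if "low c" "k \<noteq> 0" for k c
  proof -
    have "cis (of_int k * \<theta>) * (ev n (T c) \<theta> v* \<Psi> n \<theta>) $ r
        = cis (of_int (k + 1) * \<theta>) * (ev n c \<theta> v* \<Psi> n \<theta>) $ r - lc c $ r * cis (of_int k * \<theta>)" for \<theta>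
    proof -
      \<comment> \<open>Dividing the identity for \<open>T c\<close> by \<open>\<phi> n\<close>
        turns the subtracted multiple into a constant row, whose product with \<open>z^k\<close>
        integrates to 0 unless \<open>k = 0\<close>.\<close>
      have "ev n (T c) \<theta> v* \<Psi> n \<theta> = cis \<theta> *s (ev n c \<theta> v* \<Psi> n \<theta>) - lc c"
        using row_eval_T[OF n \<open>low c\<close>, of "cis \<theta>"]
        by (simp add: eval_a_\<phi> vector_matrix_mult_diff_distrib scalar_vector_matrix_assoc vector_matrix_mul_assoc
            flip: \<Phi>_def)
      moreover have "cis (of_int (k + 1) * \<theta>) = cis (of_int k * \<theta>) * cis \<theta>"
        by (simp add: cis_mult algebra_simps)
      ultimately show ?thesis
        by (simp only: vector_minus_component vector_smult_component) (simp add: right_diff_distrib mult_ac)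
    qed
    then have "J k (T c) = (\<integral>\<theta>. cis (of_int (k + 1) * \<theta>) * (ev n c \<theta> v* \<Psi> n \<theta>) $ r - lc c $ r * cis (of_int k * \<theta>) \<partial>circ)"
      by (simp add: J_def)
    also have "\<dots> = J (k + 1) c - (\<integral>\<theta>. lc c $ r * cis (of_int k * \<theta>) \<partial>circ)"
      unfolding J_def
      by (intro Bochner_Integration.integral_diff bounded_borel_integrable_circ bounded_borel_mult
          bounded_borel_const bounded_cis bounded_ev_\<Psi>)
    also have "(\<integral>\<theta>. lc c $ r * cis (of_int k * \<theta>) \<partial>circ) = 0"
      using integral_circ_cis[OF \<open>k \<noteq> 0\<close>] by simp
    finally show ?thesis by simp
  qed
  have c: "low c" by (rule assms)
  \<comment> \<open>The exponents run through \<open>- m\<close>, ..., \<open>- 1\<close> before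
    they reach 0, so the excluded case \<open>k = 0\<close> of \<open>step\<close> never
    occurs.\<close>
  have iter: "J (- int m) ((T ^^ m) c) = J 0 c" for m
  proof (induction m)
    case (Suc m)
    have "J (- int (Suc m)) (T ((T ^^ m) c)) = J (- int (Suc m) + 1) ((T ^^ m) c)"
      by (intro step T_pow_low n c) simp
    then show ?case using Suc by simp
  qed simp
  obtain B where B: "\<And>s \<theta>. cmod (\<Psi> n \<theta> $ s $ r) \<le> B" 
  proof -
    have "\<forall>s. \<exists>B. \<forall>\<theta>. cmod (\<Psi> n \<theta> $ s $ r) \<le> B" using bounded_\<Psi> by (auto simp: bounded_borel_def)
    then obtain b where b: "\<And>s \<theta>. cmod (\<Psi> n \<theta> $ s $ r) \<le> b s" by metis
    have "cmod (\<Psi> n \<theta> $ s $ r) \<le> (\<Sum>s\<in>UNIV. \<bar>b s\<bar>)" for s \<theta>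
      using b[of \<theta> s] member_le_sum[of s UNIV "\<lambda>s. \<bar>b s\<bar>"] by simp
    then show thesis by (rule that)
  qed
  \<comment> \<open>The bound does not depend on \<open>k\<close>, as \<open>cis\<close> has modulus
    1; only the size of the coefficients matters.\<close>
  have bound: "cmod (J k e) \<le> (\<Sum>s\<in>UNIV. \<Sum>i\<le>n. cmod (e i $ s) * B)" for k e
  proof -
    have "cmod (cis (of_int k * \<theta>) * (ev n e \<theta> v* \<Psi> n \<theta>) $ r) \<le> (\<Sum>s\<in>UNIV. \<Sum>i\<le>n. cmod (e i $ s) * B)" for \<theta>
    proof -
      have "cmod ((ev n e \<theta> v* \<Psi> n \<theta>) $ r) \<le> (\<Sum>s\<in>UNIV. cmod (ev n e \<theta> $ s * \<Psi> n \<theta> $ s $ r))"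
        unfolding vector_matrix_mult_def vec_lambda_beta by (rule norm_sum)
      also have "\<dots> \<le> (\<Sum>s\<in>UNIV. (\<Sum>i\<le>n. cmod (e i $ s)) * B)"
      proof (intro sum_mono)
        fix s
        have "cmod (ev n e \<theta> $ s) \<le> (\<Sum>i\<le>n. cmod (cis \<theta> ^ i * e i $ s))"
          unfolding ev_eq sum_component vector_smult_component by (rule norm_sum)
        also have "\<dots> = (\<Sum>i\<le>n. cmod (e i $ s))" by (simp add: norm_mult norm_power)
        finally show "cmod (ev n e \<theta> $ s * \<Psi> n \<theta> $ s $ r) \<le> (\<Sum>i\<le>n. cmod (e i $ s)) * B"
          unfolding norm_mult using B by (intro mult_mono sum_nonneg) auto
      qed
      finally show ?thesis by (simp add: norm_mult sum_distrib_right)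
    qed
    then have "(\<integral>\<theta>. cmod (cis (of_int k * \<theta>) * (ev n e \<theta> v* \<Psi> n \<theta>) $ r) \<partial>circ)
        \<le> (\<integral>\<theta>. (\<Sum>s\<in>UNIV. \<Sum>i\<le>n. cmod (e i $ s) * B) \<partial>circ)"
      by (intro integral_mono integrable_norm bounded_borel_integrable_circ bounded_borel_mult bounded_cis bounded_ev_\<Psi>)
        auto
    then have "(\<integral>\<theta>. cmod (cis (of_int k * \<theta>) * (ev n e \<theta> v* \<Psi> n \<theta>) $ r) \<partial>circ)
        \<le> (\<Sum>s\<in>UNIV. \<Sum>i\<le>n. cmod (e i $ s) * B)" by simp
    with integral_norm_bound show ?thesis unfolding J_def by (rule order_trans)
  qed
  have "(\<lambda>m. \<Sum>s\<in>UNIV. \<Sum>i\<le>n. cmod ((T ^^ m) c i $ s) * B) \<longlonglongrightarrow> (\<Sum>s\<in>UNIV. \<Sum>i\<le>n. cmod ((0 :: complex^'p) $ s) * B)"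
    by (intro tendsto_sum tendsto_mult tendsto_const tendsto_norm tendsto_vec_nth
        T_pow_tendsto_zero[OF orthonormal_mom n c tform_mom_nonneg])
  then have "(\<lambda>m. \<Sum>s\<in>UNIV. \<Sum>i\<le>n. cmod ((T ^^ m) c i $ s) * B) \<longlonglongrightarrow> 0" by simp
  then have "(\<lambda>m. J (- int m) ((T ^^ m) c)) \<longlonglongrightarrow> 0"
    by (rule Lim_null_comparison[rotated]) (simp add: bound)
  then have "J 0 c = 0" by (simp add: iter LIMSEQ_const_iff)
  then show ?thesis by (simp add: J_def)
qed

definition mom_F :: "nat \<Rightarrow> int \<Rightarrow> complex^'p^'p" where
  "mom_F n m = (\<chi> k l. \<integral>\<theta>. cis (of_int m * \<theta>) * F n \<theta> $ k $ l \<partial>circ)"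

lemma bounded_integrable_F: "bounded_borel f \<Longrightarrow> integrable circ (\<lambda>\<theta>. f \<theta> * F n \<theta> $ k $ l)"
  by (intro bounded_borel_integrable_circ bounded_borel_mult bounded_F)

lemma tform_mom_F: "tform (mom_F n) n c d = (\<integral>\<theta>. row_form (F n \<theta>) (ev n c \<theta>) (ev n d \<theta>) \<partial>circ)"
proof -
  have "tform (mom_F n) n c d = (\<Sum>k\<in>UNIV. \<Sum>l\<in>UNIV. \<integral>\<theta>. (\<Sum>i\<le>n. cis \<theta> ^ i *s c i) $ k
      * cnj ((\<Sum>j\<le>n. cis \<theta> ^ j *s d j) $ l) * F n \<theta> $ k $ l \<partial>circ)"
    unfolding mom_F_def
  proof (rule tform_functional[symmetric])
    show "(\<integral>\<theta>. (\<Sum>i\<in>I. f i \<theta>) * F n \<theta> $ k $ l \<partial>circ) = (\<Sum>i\<in>I. \<integral>\<theta>. f i \<theta> * F n \<theta> $ k $ l \<partial>circ)"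
      if "\<And>i. i \<in> I \<Longrightarrow> bounded_borel (f i)" for k l and I :: "nat set" and f
      unfolding sum_distrib_right using that by (intro Bochner_Integration.integral_sum bounded_integrable_F)
    show "(\<integral>\<theta>. a * f \<theta> * F n \<theta> $ k $ l \<partial>circ) = a * (\<integral>\<theta>. f \<theta> * F n \<theta> $ k $ l \<partial>circ)" for k l a f
      by (simp add: mult.assoc)
  qed
  also have "\<dots> = (\<Sum>k\<in>UNIV. \<Sum>l\<in>UNIV. \<integral>\<theta>. ev n c \<theta> $ k * cnj (ev n d \<theta> $ l) * F n \<theta> $ k $ l \<partial>circ)"
    by (simp only: ev_eq)
  also have "\<dots> = (\<integral>\<theta>. (\<Sum>k\<in>UNIV. \<Sum>l\<in>UNIV. ev n c \<theta> $ k * cnj (ev n d \<theta> $ l) * F n \<theta> $ k $ l) \<partial>circ)"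
    by (subst Bochner_Integration.integral_sum, intro Bochner_Integration.integrable_sum bounded_integrable_F bounded_borel_mult bounded_borel_cnj bounded_ev)
      (intro sum.cong refl Bochner_Integration.integral_sum[symmetric] bounded_integrable_F bounded_borel_mult bounded_borel_cnj bounded_ev)
  also have "\<dots> = (\<integral>\<theta>. row_form (F n \<theta>) (ev n c \<theta>) (ev n d \<theta>) \<partial>circ)"
    by (simp only: row_form_def mult_ac)
  finally show ?thesis .
qed

text \<open>Dividing a row \<open>v \<phi> n\<close> by \<open>\<phi> n\<close> leaves the constant
  \<open>v\<close>. Orthogonality with respect to \<open>F n\<close> thus reduces to the vanishing
  integrals of \<open>integral_low_\<Psi>\<close>, and normalization is immediate.\<close>

lemma orthonormal_mom_F: "coefficients.orthonormal_for (coeff (\<phi> n)) n (mom_F n)"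
proof -
  interpret coefficients "coeff (\<phi> n)" n by (rule coefficients_\<phi>)
  have cancel: "v v* \<Phi> n \<theta> v* \<Psi> n \<theta> = v" for v \<theta> by (simp add: vector_matrix_mul_assoc)
  have "tform (mom_F n) n (\<lambda>i. v v* coeff (\<phi> n) i) d = 0 \<and> tform (mom_F n) n d (\<lambda>i. v v* coeff (\<phi> n) i) = 0"
    if "d n = 0" for v d
  proof -
    \<comment> \<open>\<open>low\<close> asks for zeros at all indices from \<open>n\<close> on,
      whereas \<open>d\<close> is controlled only at \<open>n\<close>; the form does not see the
      difference.\<close>
    let ?d = "\<lambda>i. if i < n then d i else 0"
    have d: "d i = ?d i" if "i \<le> n" for i using that \<open>d n = 0\<close> by (cases "i = n") auto
    have low: "low ?d" by (simp add: low_def)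
    have 0: "(\<integral>\<theta>. (ev n ?d \<theta> v* \<Psi> n \<theta>) $ r \<partial>circ) = 0" for r
      by (rule integral_low_\<Psi>[OF low])
    have cnj0: "(\<integral>\<theta>. cnj ((ev n ?d \<theta> v* \<Psi> n \<theta>) $ r) \<partial>circ) = 0" for r
      using 0[of r] by simp
    have "tform (mom_F n) n (\<lambda>i. v v* coeff (\<phi> n) i) ?d
        = (\<integral>\<theta>. (\<Sum>r\<in>UNIV. v $ r * cnj ((ev n ?d \<theta> v* \<Psi> n \<theta>) $ r)) \<partial>circ)"
      unfolding tform_mom_F ev_\<phi> row_form_F cancel row_form_mat1_eq ..
    also have "\<dots> = (\<Sum>r\<in>UNIV. v $ r * (\<integral>\<theta>. cnj ((ev n ?d \<theta> v* \<Psi> n \<theta>) $ r) \<partial>circ))"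
      by (subst Bochner_Integration.integral_sum)
        (auto intro!: bounded_borel_integrable_circ bounded_borel_mult bounded_borel_cnj bounded_borel_const bounded_ev_\<Psi>
          simp del: integral_cnj)
    finally have 1: "tform (mom_F n) n (\<lambda>i. v v* coeff (\<phi> n) i) ?d = 0" by (simp only: cnj0) simp
    have "tform (mom_F n) n ?d (\<lambda>i. v v* coeff (\<phi> n) i)
        = (\<integral>\<theta>. (\<Sum>r\<in>UNIV. (ev n ?d \<theta> v* \<Psi> n \<theta>) $ r * cnj (v $ r)) \<partial>circ)"
      unfolding tform_mom_F ev_\<phi> row_form_F cancel row_form_mat1_eq ..
    also have "\<dots> = (\<Sum>r\<in>UNIV. (\<integral>\<theta>. (ev n ?d \<theta> v* \<Psi> n \<theta>) $ r \<partial>circ) * cnj (v $ r))"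
      by (subst Bochner_Integration.integral_sum)
        (auto intro!: bounded_borel_integrable_circ bounded_borel_mult bounded_borel_const bounded_ev_\<Psi>)
    finally have 2: "tform (mom_F n) n ?d (\<lambda>i. v v* coeff (\<phi> n) i) = 0" by (simp only: 0) simp
    have "tform (mom_F n) n (\<lambda>i. v v* coeff (\<phi> n) i) d = tform (mom_F n) n (\<lambda>i. v v* coeff (\<phi> n) i) ?d"
      "tform (mom_F n) n d (\<lambda>i. v v* coeff (\<phi> n) i) = tform (mom_F n) n ?d (\<lambda>i. v v* coeff (\<phi> n) i)"
      using d by (intro tform_cong; simp)+
    with 1 2 show ?thesis by simp
  qed
  moreover have "tform (mom_F n) n (\<lambda>i. v v* coeff (\<phi> n) i) (\<lambda>i. w v* coeff (\<phi> n) i) = row_form (mat 1) v w" for v w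
    unfolding tform_mom_F ev_\<phi> row_form_F cancel by simp
  ultimately show ?thesis by (simp add: orthonormal_for_def)
qed

text \<open>Both sides are linear in \<open>h\<close>, and the moments up to order \<open>n\<close>
  agree because \<open>\<phi> n\<close> is orthonormal for both.\<close>

theorem Bernstein_Szego:
  assumes "trig n h"
  shows "entry_integral \<rho> k l h = (\<integral>\<theta>. h \<theta> * F n \<theta> $ k $ l \<partial>circ)"
  using assms
proof (induction rule: trig.induct)
  case (trig_step m f c)
  have "mom m = mom_F n m"
    using coefficients.moments_determined[OF coefficients_\<phi> orthonormal_mom tform_mom_nonneg orthonormal_mom_F] trig_step
    by blast
  then have "mom m $ k $ l = mom_F n m $ k $ l" by simp
  then have "entry_integral \<rho> k l (\<lambda>\<theta>. cis (of_int m * \<theta>)) = (\<integral>\<theta>. cis (of_int m * \<theta>) * F n \<theta> $ k $ l \<partial>circ)"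
    by (simp add: mom_def mom_F_def)
  moreover have "entry_integral \<rho> k l (\<lambda>\<theta>. c * cis (of_int m * \<theta>) + f \<theta>)
      = c * entry_integral \<rho> k l (\<lambda>\<theta>. cis (of_int m * \<theta>)) + entry_integral \<rho> k l f"
    using trig_step by (subst entry_integral_add[OF mm])
      (auto intro: bounded_borel_mult bounded_borel_const bounded_cis bounded_borel_trig simp: entry_integral_scale bounded_cis)
  moreover have "(\<integral>\<theta>. (c * cis (of_int m * \<theta>) + f \<theta>) * F n \<theta> $ k $ l \<partial>circ)
      = c * (\<integral>\<theta>. cis (of_int m * \<theta>) * F n \<theta> $ k $ l \<partial>circ) + (\<integral>\<theta>. f \<theta> * F n \<theta> $ k $ l \<partial>circ)"
  proof -
    have "(\<integral>\<theta>. (c * cis (of_int m * \<theta>)) * F n \<theta> $ k $ l + f \<theta> * F n \<theta> $ k $ l \<partial>circ)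
      = (\<integral>\<theta>. (c * cis (of_int m * \<theta>)) * F n \<theta> $ k $ l \<partial>circ) + (\<integral>\<theta>. f \<theta> * F n \<theta> $ k $ l \<partial>circ)"
      using trig_step by (intro Bochner_Integration.integral_add bounded_integrable_F bounded_borel_mult bounded_borel_const bounded_cis)
        (auto intro: bounded_borel_trig)
    then show ?thesis by (simp add: distrib_right mult.assoc)
  qed
  ultimately show ?case using trig_step by simp
qed (simp add: entry_integral_zero)

end

lemma trace_mult_eq: "trace (P ** Y) = (\<Sum>i\<in>UNIV. \<Sum>k\<in>UNIV. P $ i $ k * Y $ k $ i)"
  by (simp add: trace_def matrix_matrix_mult_def)

text \<open>Gaussian elimination: subtracting \<open>Y e\<^sub>k e\<^sub>k\<^sup>* Y / Y\<^sub>k\<^sub>k\<close> keeps \<open>Y\<close> positive semidefinite by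
  the Cauchy-Schwarz inequality and kills the \<open>k\<close>-th diagonal entry.\<close>

lemma trace_psd_mult_nonneg:
  fixes P Y :: "complex^'p^'p"
  assumes P: "hermitian_psd P" and "hermitian_psd Y"
  shows "0 \<le> Re (trace (P ** Y))"
  using assms(2)
proof (induction "card {k. Y $ k $ k \<noteq> 0}" arbitrary: Y rule: less_induct)
  case less
  note Y = \<open>hermitian_psd Y\<close>
  have herm: "cnj (Y $ a $ b) = Y $ b $ a" for a b
    using Y unfolding hermitian_psd_def htranspose_def by (auto simp: vec_eq_iff transpose_def)
  have CS: "(cmod (Y $ a $ b))\<^sup>2 \<le> Re (Y $ a $ a) * Re (Y $ b $ b)" for a b
    using hermitian_psd_Cauchy_Schwarz[OF Y, of "axis a 1" "axis b 1"] by (simp add: row_form_axis_axis)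
  show ?case
  proof (cases "\<exists>k. Y $ k $ k \<noteq> 0")
    case False
    then have "Y $ a $ b = 0" for a b using CS[of a b] by simp
    then have "Y = 0" by (simp add: vec_eq_iff)
    then show ?thesis by (simp add: trace_def)
  next
    case True
    then obtain k where k: "Y $ k $ k \<noteq> 0" by blast
    define y where "y = Re (Y $ k $ k)"
    have Ykk: "Y $ k $ k = complex_of_real y"
      using herm[of k k] by (simp add: y_def complex_eq_iff)
    have "0 \<le> y" using hermitian_psd_nonneg[OF Y, of "axis k 1"] by (simp add: row_form_axis_axis y_def)
    with k Ykk have y: "0 < y" by (cases "y = 0") auto
    define Y' :: "complex^'p^'p" where "Y' = (\<chi> a b. Y $ a $ b - Y $ a $ k * Y $ k $ b / Y $ k $ k)"
    have form: "row_form Y' u u = row_form Y u u - row_form Y u (axis k 1) * cnj (row_form Y u (axis k 1)) / y" for u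
    proof -
      have 1: "row_form Y u (axis k 1) = (\<Sum>a\<in>UNIV. u $ a * Y $ a $ k)"
        unfolding row_form_def axis_def by (simp add: if_distrib cong: if_cong)
      have 2: "cnj (row_form Y u (axis k 1)) = (\<Sum>b\<in>UNIV. Y $ k $ b * cnj (u $ b))"
        unfolding 1 by (simp add: herm mult.commute)
      have "row_form Y' u u = row_form Y u u - (\<Sum>a\<in>UNIV. \<Sum>b\<in>UNIV. (u $ a * Y $ a $ k) * (Y $ k $ b * cnj (u $ b)) / y)"
        by (simp add: row_form_def Y'_def Ykk algebra_simps sum_subtractf)
      also have "(\<Sum>a\<in>UNIV. \<Sum>b\<in>UNIV. (u $ a * Y $ a $ k) * (Y $ k $ b * cnj (u $ b)) / y)
          = (\<Sum>a\<in>UNIV. u $ a * Y $ a $ k) * (\<Sum>b\<in>UNIV. Y $ k $ b * cnj (u $ b)) / y"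
        unfolding sum_product sum_divide_distrib ..
      finally show ?thesis unfolding 1 2[unfolded 1] .
    qed
    have Y': "hermitian_psd Y'"
    proof (rule hermitian_psdI)
      show "htranspose Y' = Y'"
        by (simp add: Y'_def htranspose_def transpose_def vec_eq_iff herm mult.commute)
      fix u
      have "(cmod (row_form Y u (axis k 1)))\<^sup>2 \<le> Re (row_form Y u u) * y"
        using hermitian_psd_Cauchy_Schwarz[OF Y, of u "axis k 1"] by (simp add: row_form_axis_axis y_def)
      then have "(cmod (row_form Y u (axis k 1)))\<^sup>2 / y \<le> Re (row_form Y u u)"
        using y by (simp add: field_simps)
      then show "0 \<le> Re (row_form Y' u u)"
        unfolding form complex_norm_square[symmetric] by (simp flip: of_real_power of_real_divide)
    qed
    \<comment> \<open>A zero on the diagonal of \<open>Y\<close> forces its row to vanish by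
      \<open>CS\<close> and so persists in \<open>Y'\<close>; the entry at \<open>k\<close> is a new
      zero.\<close>
    have "{a. Y' $ a $ a \<noteq> 0} \<subset> {a. Y $ a $ a \<noteq> 0}"
    proof
      show "{a. Y' $ a $ a \<noteq> 0} \<subseteq> {a. Y $ a $ a \<noteq> 0}"
        using CS by (auto simp: Y'_def) (metis mult_zero_left zero_complex.sel(1) zero_less_power2 norm_eq_zero not_less)
      have "Y' $ k $ k = 0" by (simp add: Y'_def k)
      then show "{a. Y' $ a $ a \<noteq> 0} \<noteq> {a. Y $ a $ a \<noteq> 0}" using k by auto
    qed
    then have "card {a. Y' $ a $ a \<noteq> 0} < card {a. Y $ a $ a \<noteq> 0}" by (intro psubset_card_mono) auto
    from less.hyps[OF this Y'] have IH: "0 \<le> Re (trace (P ** Y'))" .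
    \<comment> \<open>The subtracted rank-one part contributes the form of \<open>P\<close> at the
      \<open>k\<close>-th row of \<open>Y\<close>.\<close>
    have "trace (P ** Y) = trace (P ** Y') + row_form P (Y $ k) (Y $ k) / y"
    proof -
      have "row_form P (Y $ k) (Y $ k) / y = (\<Sum>i\<in>UNIV. \<Sum>b\<in>UNIV. P $ i $ b * (Y $ b $ k * Y $ k $ i / Y $ k $ k))"
        unfolding row_form_def sum_divide_distrib Ykk herm by (simp add: mult_ac)
      then show ?thesis
        unfolding trace_mult_eq Y'_def by (simp add: right_diff_distrib sum_subtractf)
    qed
    moreover have "0 \<le> Re (row_form P (Y $ k) (Y $ k) / y)"
      using hermitian_psd_nonneg[OF P] y by simp
    ultimately show ?thesis using IH by simp
  qed
qed

section \<open>The weighted matrices \<open>A\<close> and \<open>G\<close> and their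
  integrals\<close>

context orthonormal_system
begin

definition A :: "nat \<Rightarrow> real \<Rightarrow> complex^'p^'p" where
  "A n \<theta> = \<Phi> n \<theta> ** W \<theta> ** htranspose (\<Phi> n \<theta>)"

definition G :: "nat \<Rightarrow> nat \<Rightarrow> real \<Rightarrow> complex^'p^'p" where
  "G n m \<theta> = \<Phi> n \<theta> ** F m \<theta> ** htranspose (\<Phi> n \<theta>)"

lemma G_eq: "G n m \<theta> = \<Phi> n \<theta> ** matrix_inv (\<Phi> m \<theta>) ** matrix_inv (htranspose (\<Phi> m \<theta>)) ** htranspose (\<Phi> n \<theta>)"
  unfolding G_def F_def \<Psi>_def matrix_inv_htranspose(1)[OF \<Phi>_invertible] by (simp only: matrix_mul_assoc)

lemma psd_F: "hermitian_psd (F n \<theta>)"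
  using hermitian_psd_congruence[OF posdef_imp_psd[OF posdef_mat1], of "\<Psi> n \<theta>"] by (simp add: F_def)

lemma psd_G: "hermitian_psd (G n m \<theta>)"
  unfolding G_def by (rule hermitian_psd_congruence[OF psd_F])

lemma psd_A: "\<theta> \<in> C \<Longrightarrow> hermitian_psd (A n \<theta>)"
  unfolding A_def by (rule hermitian_psd_congruence[OF W_psd])

lemma row_form_A: "row_form (A n \<theta>) u w = row_form (W \<theta>) (u v* \<Phi> n \<theta>) (w v* \<Phi> n \<theta>)"
  unfolding A_def by (rule row_form_congruence)

lemma row_form_G: "row_form (G n m \<theta>) u w = row_form (F m \<theta>) (u v* \<Phi> n \<theta>) (w v* \<Phi> n \<theta>)"
  unfolding G_def by (rule row_form_congruence)

lemma congruence_entry: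
  fixes P M :: "complex^'p^'p"
  shows "(P ** M ** htranspose P) $ i $ j = (\<Sum>k\<in>UNIV. \<Sum>l\<in>UNIV. (P $ i $ k * cnj (P $ j $ l)) * M $ k $ l)"
proof -
  have "(P ** M ** htranspose P) $ i $ j = row_form M (P $ i) (P $ j)"
    using row_form_congruence[of P M P "axis i 1" "axis j 1"] by (simp add: row_form_axis_axis axis_vector_matrix)
  then show ?thesis by (simp add: row_form_def mult_ac)
qed

abbreviation \<Phi>\<Phi> :: "nat \<Rightarrow> 'p \<Rightarrow> 'p \<Rightarrow> 'p \<Rightarrow> 'p \<Rightarrow> real \<Rightarrow> complex" where
  "\<Phi>\<Phi> n i j k l \<theta> \<equiv> \<Phi> n \<theta> $ i $ k * cnj (\<Phi> n \<theta> $ j $ l)"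

lemma trig_\<Phi>\<Phi>: "trig (n + n) (\<Phi>\<Phi> n i j k l)"
  by (intro trig_mult trig_cnj trig_\<Phi>)

lemma bounded_G: "bounded_borel (\<lambda>\<theta>. G n m \<theta> $ i $ j)"
  unfolding G_def congruence_entry
  by (intro bounded_borel_sum bounded_borel_mult[OF bounded_borel_trig[OF trig_\<Phi>\<Phi>]] bounded_F)

lemma integrable_A: "integrable circ (\<lambda>\<theta>. indicator E \<theta> * A n \<theta> $ i $ j)" if "E \<in> sets borel"
proof -
  have *: "indicator E \<theta> * A n \<theta> $ i $ j = (\<Sum>k\<in>UNIV. \<Sum>l\<in>UNIV. (indicator E \<theta> * \<Phi>\<Phi> n i j k l \<theta>) * W \<theta> $ k $ l)" for \<theta>
    unfolding A_def congruence_entry by (simp add: sum_distrib_left mult.assoc)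
  show ?thesis unfolding *
  proof (intro Bochner_Integration.integrable_sum)
    fix k l
    have "bounded_borel (\<lambda>\<theta>. indicator E \<theta> * \<Phi>\<Phi> n i j k l \<theta>)"
      by (intro bounded_borel_mult[OF bounded_borel_indicator[OF that]] bounded_borel_trig[OF trig_\<Phi>\<Phi>])
    then obtain B where "\<And>\<theta>. cmod (indicator E \<theta> * \<Phi>\<Phi> n i j k l \<theta>) \<le> B"
      "(\<lambda>\<theta>. indicator E \<theta> * \<Phi>\<Phi> n i j k l \<theta>) \<in> borel_measurable borel"
      by (auto simp: bounded_borel_def)
    then show "integrable circ (\<lambda>\<theta>. (indicator E \<theta> * \<Phi>\<Phi> n i j k l \<theta>) * W \<theta> $ k $ l)"
      by (intro bounded_bochner_integrable[OF W_entry_int]) auto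
  qed
qed

text \<open>For \<open>n \<le> m\<close> the rows of \<open>\<phi> n\<close> have degree at most
  \<open>m\<close>, so integration against \<open>F m\<close> may be replaced by integration against
  \<open>\<rho>\<close>, for which \<open>\<phi> n\<close> is orthonormal.\<close>

lemma integral_G:
  assumes "n \<le> m"
  shows "(\<integral>\<theta>. G n m \<theta> $ i $ j \<partial>circ) = (if i = j then 1 else 0)"
proof -
  have ev: "ev m (\<lambda>t. v v* coeff (\<phi> n) t) \<theta> = v v* \<Phi> n \<theta>" for v \<theta>
    using assms by (simp add: ev_eq \<Phi>_def vector_mat_poly_eval)
  have mom: "mom k = mom_F m k" if "\<bar>k\<bar> \<le> int m" for k
    using coefficients.moments_determined[OF coefficients_\<phi> orthonormal_mom tform_mom_nonneg orthonormal_mom_F that] .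
  have "(\<integral>\<theta>. G n m \<theta> $ i $ j \<partial>circ) = tform (mom_F m) m (\<lambda>t. axis i 1 v* coeff (\<phi> n) t) (\<lambda>t. axis j 1 v* coeff (\<phi> n) t)"
    unfolding tform_mom_F ev row_form_G[symmetric] row_form_axis_axis ..
  also have "\<dots> = tform mom m (\<lambda>t. axis i 1 v* coeff (\<phi> n) t) (\<lambda>t. axis j 1 v* coeff (\<phi> n) t)"
    unfolding tform_def by (intro sum.cong refl) (simp add: mom)
  also have "\<dots> = row_form (mat 1) (axis i 1) (axis j 1)" using assms by (simp add: tform_\<phi>)
  also have "\<dots> = (if i = j then 1 else 0)" by (simp add: row_form_axis_axis mat_def)
  finally show ?thesis .
qed

lemma integral_trace_G:
  assumes "n \<le> m"
  shows "(\<integral>\<theta>. Re (trace (G n m \<theta>)) \<partial>circ) = CARD('p)"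
    and "integrable circ (\<lambda>\<theta>. Re (trace (G n m \<theta>)))"
proof -
  have int: "integrable circ (\<lambda>\<theta>. G n m \<theta> $ i $ i)" for i by (intro bounded_borel_integrable_circ bounded_G)
  then have int': "integrable circ (\<lambda>\<theta>. trace (G n m \<theta>))" unfolding trace_def by (intro Bochner_Integration.integrable_sum)
  have "(\<integral>\<theta>. trace (G n m \<theta>) \<partial>circ) = CARD('p)"
    unfolding trace_def by (simp add: Bochner_Integration.integral_sum int integral_G[OF assms])
  then show "(\<integral>\<theta>. Re (trace (G n m \<theta>)) \<partial>circ) = CARD('p)"
    by (simp add: integral_Re[OF int'])
  show "integrable circ (\<lambda>\<theta>. Re (trace (G n m \<theta>)))" by (rule integrable_Re[OF int'])
qed

text \<open>The products have degree at most \<open>q + 2 n\<close>. Once \<open>m\<close> reaches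
  this order Bernstein-Szego applies, so the right side is the same for all such
  \<open>m\<close>.\<close>

lemma entry_integral_\<Phi>\<Phi>_trig:
  assumes g: "trig q g" and m: "q + (n + n) \<le> m"
  shows "(\<Sum>k\<in>UNIV. \<Sum>l\<in>UNIV. entry_integral \<rho> k l (\<lambda>\<theta>. g \<theta> * \<Phi>\<Phi> n i j k l \<theta>)) = (\<integral>\<theta>. g \<theta> * G n m \<theta> $ i $ j \<partial>circ)"
proof -
  have t: "trig m (\<lambda>\<theta>. g \<theta> * \<Phi>\<Phi> n i j k l \<theta>)" for k l
    by (rule trig_mono[OF trig_mult[OF g trig_\<Phi>\<Phi>] m])
  have "(\<Sum>k\<in>UNIV. \<Sum>l\<in>UNIV. entry_integral \<rho> k l (\<lambda>\<theta>. g \<theta> * \<Phi>\<Phi> n i j k l \<theta>))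
      = (\<Sum>k\<in>UNIV. \<Sum>l\<in>UNIV. \<integral>\<theta>. (g \<theta> * \<Phi>\<Phi> n i j k l \<theta>) * F m \<theta> $ k $ l \<partial>circ)"
    by (simp only: Bernstein_Szego[OF t])
  also have "\<dots> = (\<Sum>k\<in>UNIV. \<integral>\<theta>. (\<Sum>l\<in>UNIV. (g \<theta> * \<Phi>\<Phi> n i j k l \<theta>) * F m \<theta> $ k $ l) \<partial>circ)"
    by (intro sum.cong refl Bochner_Integration.integral_sum[symmetric] bounded_integrable_F bounded_borel_trig[OF t])
  also have "\<dots> = (\<integral>\<theta>. (\<Sum>k\<in>UNIV. \<Sum>l\<in>UNIV. (g \<theta> * \<Phi>\<Phi> n i j k l \<theta>) * F m \<theta> $ k $ l) \<partial>circ)"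
    by (intro Bochner_Integration.integral_sum[symmetric] Bochner_Integration.integrable_sum bounded_integrable_F bounded_borel_trig[OF t])
  also have "\<dots> = (\<integral>\<theta>. g \<theta> * G n m \<theta> $ i $ j \<partial>circ)"
    unfolding G_def congruence_entry by (simp add: sum_distrib_left mult.assoc)
  finally show ?thesis .
qed

lemma \<Phi>\<Phi>_bound: obtains B where "0 < B" "\<And>i j k l \<theta>. cmod (\<Phi>\<Phi> n i j k l \<theta>) \<le> B"
proof -
  have "\<forall>i j k l. \<exists>B. \<forall>\<theta>. cmod (\<Phi>\<Phi> n i j k l \<theta>) \<le> B" using trig_bounded[OF trig_\<Phi>\<Phi>] by blast
  then obtain b where b: "\<And>i j k l \<theta>. cmod (\<Phi>\<Phi> n i j k l \<theta>) \<le> b i j k l" by metis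
  define B where "B = 1 + (\<Sum>x\<in>UNIV. case x of (i, j, k, l) \<Rightarrow> \<bar>b i j k l\<bar>)"
  have "\<bar>b i j k l\<bar> \<le> (\<Sum>x\<in>UNIV. case x of (i, j, k, l) \<Rightarrow> \<bar>b i j k l\<bar>)" for i j k l
    using member_le_sum[of "(i, j, k, l)" UNIV "\<lambda>x. case x of (i, j, k, l) \<Rightarrow> \<bar>b i j k l\<bar>"] by (auto split: prod.splits)
  moreover have "cmod (\<Phi>\<Phi> n i j k l \<theta>) \<le> b i j k l" for i j k l \<theta> by (rule b)
  ultimately have "cmod (\<Phi>\<Phi> n i j k l \<theta>) \<le> B" for i j k l \<theta>
    unfolding B_def by (smt (verit))
  moreover have "0 < B" unfolding B_def by (intro add_pos_nonneg sum_nonneg) (auto split: prod.splits)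
  ultimately show thesis by (intro that)
qed

text \<open>This makes quantitative that \<open>G n m\<close> times \<open>circ\<close> converges
  weakly to \<open>\<rho>\<close> weighted by \<open>\<phi> n\<close> as \<open>m\<close> grows. One
  \<open>g\<close> serves all large \<open>m\<close>, and as \<open>E\<close> avoids
  \<open>N\<close> only the part with density \<open>A n\<close> remains.\<close>

lemma integral_A_approx:
  assumes E: "E \<in> sets borel" "E \<subseteq> C" and "0 < \<delta>"
  shows "\<exists>q g. trig q (\<lambda>\<theta>. complex_of_real (g \<theta>)) \<and> (\<forall>\<theta>. 0 \<le> g \<theta>) \<and> (\<forall>\<theta>. g \<theta> \<le> 1 + \<delta>) \<and>
    (\<integral>\<theta>. \<bar>g \<theta> - indicator E \<theta>\<bar> \<partial>circ) \<le> \<delta> \<and>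
    (\<forall>m\<ge>q + (n + n). \<forall>i j. cmod ((\<integral>\<theta>. complex_of_real (g \<theta>) * G n m \<theta> $ i $ j \<partial>circ)
      - (\<integral>\<theta>. indicator E \<theta> * A n \<theta> $ i $ j \<partial>circ)) \<le> \<delta>)"
proof -
  obtain B where B: "0 < B" "\<And>i j k l \<theta>. cmod (\<Phi>\<Phi> n i j k l \<theta>) \<le> B" using \<Phi>\<Phi>_bound by blast
  define p2 where "p2 = real CARD('p) * real CARD('p)"
  have p2: "0 < p2" by (simp add: p2_def)
  \<comment> \<open>\<open>B\<close> bounds the products of two entries of \<open>\<phi> n\<close>,
    and \<open>p2\<close> pairs of indices contribute.\<close>
  define \<delta>' where "\<delta>' = min \<delta> (\<delta> / (p2 * B))"
  have \<delta>': "0 < \<delta>'" "\<delta>' \<le> \<delta>" "p2 * (B * \<delta>') \<le> \<delta>"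
  proof -
    have "\<delta>' \<le> \<delta> / (p2 * B)" by (simp add: \<delta>'_def)
    then have "(p2 * B) * \<delta>' \<le> (p2 * B) * (\<delta> / (p2 * B))" using B(1) p2 by (intro mult_left_mono) auto
    then show "p2 * (B * \<delta>') \<le> \<delta>" using B(1) p2 by simp
  qed (use \<open>0 < \<delta>\<close> B(1) p2 in \<open>auto simp: \<delta>'_def\<close>)
  obtain q g where g': "trig q (\<lambda>\<theta>. complex_of_real (g \<theta>))" "\<forall>\<theta>. 0 \<le> g \<theta>" "\<forall>\<theta>. g \<theta> \<le> 1 + \<delta>'"
    and int: "(\<integral>\<theta>. \<bar>g \<theta> - indicator E \<theta>\<bar> \<partial>circ) \<le> \<delta>'"
    and ap': "\<forall>k l h B. h \<in> borel_measurable borel \<longrightarrow> (\<forall>\<theta>. cmod (h \<theta>) \<le> B) \<longrightarrow>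
      cmod (entry_integral \<rho> k l (\<lambda>\<theta>. complex_of_real (g \<theta>) * h \<theta>)
        - (\<integral>\<theta>. indicator E \<theta> * h \<theta> * W \<theta> $ k $ l \<partial>circ)) \<le> B * \<delta>'"
    using trig_approx_C[OF E \<delta>'(1)] by (elim exE conjE)
  note g = g'(1) g'(2)[rule_format] g'(3)[rule_format] and ap = ap'[rule_format]
  have "cmod ((\<integral>\<theta>. complex_of_real (g \<theta>) * G n m \<theta> $ i $ j \<partial>circ) - (\<integral>\<theta>. indicator E \<theta> * A n \<theta> $ i $ j \<partial>circ)) \<le> \<delta>"
    if m: "q + (n + n) \<le> m" for m i j
  proof -
    have hm: "\<Phi>\<Phi> n i j k l \<in> borel_measurable borel" for k l by (rule trig_measurable[OF trig_\<Phi>\<Phi>])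
    have intW: "integrable circ (\<lambda>\<theta>. indicator E \<theta> * \<Phi>\<Phi> n i j k l \<theta> * W \<theta> $ k $ l)" for k l
    proof (rule bounded_bochner_integrable[OF W_entry_int])
      show "(\<lambda>\<theta>. indicator E \<theta> * \<Phi>\<Phi> n i j k l \<theta>) \<in> borel_measurable circ"
        using bounded_borel_measurable[OF bounded_borel_mult[OF bounded_borel_indicator[OF E(1)] bounded_borel_trig[OF trig_\<Phi>\<Phi>]]]
        by simp
      show "cmod (indicator E \<theta> * \<Phi>\<Phi> n i j k l \<theta>) \<le> B" for \<theta>
        using B(1) by (cases "\<theta> \<in> E") (simp_all add: B(2) del: complex_mod_cnj norm_mult)
    qed
    have "(\<integral>\<theta>. indicator E \<theta> * A n \<theta> $ i $ j \<partial>circ)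
        = (\<integral>\<theta>. (\<Sum>k\<in>UNIV. \<Sum>l\<in>UNIV. indicator E \<theta> * \<Phi>\<Phi> n i j k l \<theta> * W \<theta> $ k $ l) \<partial>circ)"
      unfolding A_def congruence_entry by (simp add: sum_distrib_left mult.assoc)
    also have "\<dots> = (\<Sum>k\<in>UNIV. \<Sum>l\<in>UNIV. \<integral>\<theta>. indicator E \<theta> * \<Phi>\<Phi> n i j k l \<theta> * W \<theta> $ k $ l \<partial>circ)"
      by (subst Bochner_Integration.integral_sum, intro Bochner_Integration.integrable_sum intW)
        (intro sum.cong refl Bochner_Integration.integral_sum intW)
    finally have "(\<integral>\<theta>. complex_of_real (g \<theta>) * G n m \<theta> $ i $ j \<partial>circ) - (\<integral>\<theta>. indicator E \<theta> * A n \<theta> $ i $ j \<partial>circ)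
        = (\<Sum>k\<in>UNIV. \<Sum>l\<in>UNIV. entry_integral \<rho> k l (\<lambda>\<theta>. complex_of_real (g \<theta>) * \<Phi>\<Phi> n i j k l \<theta>)
          - (\<integral>\<theta>. indicator E \<theta> * \<Phi>\<Phi> n i j k l \<theta> * W \<theta> $ k $ l \<partial>circ))"
      unfolding entry_integral_\<Phi>\<Phi>_trig[OF g(1) m, symmetric] by (simp only: sum_subtractf)
    also have "cmod \<dots> \<le> (\<Sum>k\<in>(UNIV :: 'p set). \<Sum>l\<in>(UNIV :: 'p set). B * \<delta>')"
      by (intro sum_norm_le ap hm B(2))
    also have "\<dots> = p2 * (B * \<delta>')" by (simp add: p2_def)
    finally show ?thesis using \<delta>'(3) by simp
  qed
  then have "\<forall>m\<ge>q + (n + n). \<forall>i j. cmod ((\<integral>\<theta>. complex_of_real (g \<theta>) * G n m \<theta> $ i $ j \<partial>circ)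
      - (\<integral>\<theta>. indicator E \<theta> * A n \<theta> $ i $ j \<partial>circ)) \<le> \<delta>" by simp
  moreover have "g \<theta> \<le> 1 + \<delta>" for \<theta> using g(3)[of \<theta>] \<delta>' by simp
  then have "\<forall>\<theta>. g \<theta> \<le> 1 + \<delta>" ..
  moreover have "(\<integral>\<theta>. \<bar>g \<theta> - indicator E \<theta>\<bar> \<partial>circ) \<le> \<delta>" using int \<delta>' by simp
  ultimately show ?thesis using g'(1,2) by (intro exI conjI)
qed

text \<open>\<open>g\<close> is at most \<open>1 + \<delta>\<close>, and the diagonal of
  \<open>G n m\<close> is nonnegative with integral 1. Equality can fail, because the singular part
  of \<open>\<rho>\<close> also carries some of this mass.\<close>

lemma integral_A_diag_le:
  assumes E: "E \<in> sets borel" "E \<subseteq> C"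
  shows "Re (\<integral>\<theta>. indicator E \<theta> * A n \<theta> $ i $ i \<partial>circ) \<le> 1"
proof (rule field_le_epsilon)
  fix e :: real assume "0 < e"
  define \<delta> where "\<delta> = e / 2"
  have "0 < \<delta>" using \<open>0 < e\<close> by (simp add: \<delta>_def)
  obtain q g where g: "trig q (\<lambda>\<theta>. complex_of_real (g \<theta>))" "\<forall>\<theta>. 0 \<le> g \<theta>" "\<forall>\<theta>. g \<theta> \<le> 1 + \<delta>"
    and ap: "\<forall>m\<ge>q + (n + n). \<forall>i j. cmod ((\<integral>\<theta>. complex_of_real (g \<theta>) * G n m \<theta> $ i $ j \<partial>circ)
      - (\<integral>\<theta>. indicator E \<theta> * A n \<theta> $ i $ j \<partial>circ)) \<le> \<delta>"
    using integral_A_approx[OF E \<open>0 < \<delta>\<close>, of n] by blast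
  define m where "m = q + (n + n)"
  have bG: "bounded_borel (\<lambda>\<theta>. complex_of_real (g \<theta>) * G n m \<theta> $ i $ i)"
    by (intro bounded_borel_mult bounded_borel_trig[OF g(1)] bounded_G)
  have intG: "integrable circ (\<lambda>\<theta>. complex_of_real (g \<theta>) * G n m \<theta> $ i $ i)" "integrable circ (\<lambda>\<theta>. G n m \<theta> $ i $ i)"
    by (intro bounded_borel_integrable_circ bG bounded_G)+
  have G0: "0 \<le> Re (G n m \<theta> $ i $ i)" for \<theta>
    using hermitian_psd_nonneg[OF psd_G, where u="axis i 1"] by (simp add: row_form_axis_axis)
  have "Re (\<integral>\<theta>. complex_of_real (g \<theta>) * G n m \<theta> $ i $ i \<partial>circ) = (\<integral>\<theta>. Re (complex_of_real (g \<theta>) * G n m \<theta> $ i $ i) \<partial>circ)"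
    by (rule integral_Re[OF intG(1), symmetric])
  also have "\<dots> \<le> (\<integral>\<theta>. (1 + \<delta>) * Re (G n m \<theta> $ i $ i) \<partial>circ)"
    using g(3) G0 by (intro integral_mono integrable_Re intG integrable_mult_right) (auto intro: mult_right_mono)
  also have "\<dots> = (1 + \<delta>) * (\<integral>\<theta>. Re (G n m \<theta> $ i $ i) \<partial>circ)" by simp
  also have "(\<integral>\<theta>. Re (G n m \<theta> $ i $ i) \<partial>circ) = 1"
    using integral_Re[OF intG(2)] integral_G[of n m i i] by (simp add: m_def)
  finally have "Re (\<integral>\<theta>. complex_of_real (g \<theta>) * G n m \<theta> $ i $ i \<partial>circ) \<le> 1 + \<delta>" by simp
  moreover have "cmod ((\<integral>\<theta>. complex_of_real (g \<theta>) * G n m \<theta> $ i $ i \<partial>circ) - (\<integral>\<theta>. indicator E \<theta> * A n \<theta> $ i $ i \<partial>circ)) \<le> \<delta>"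
    using ap by (simp add: m_def)
  then have "\<bar>Re ((\<integral>\<theta>. complex_of_real (g \<theta>) * G n m \<theta> $ i $ i \<partial>circ) - (\<integral>\<theta>. indicator E \<theta> * A n \<theta> $ i $ i \<partial>circ))\<bar> \<le> \<delta>"
    using abs_Re_le_cmod order_trans by blast
  ultimately show "Re (\<integral>\<theta>. indicator E \<theta> * A n \<theta> $ i $ i \<partial>circ) \<le> 1 + e"
    unfolding minus_complex.sel \<delta>_def by linarith
qed

lemma integral_trace_A_le:
  shows "(\<integral>\<theta>. indicator C \<theta> * Re (trace (A n \<theta>)) \<partial>circ) \<le> CARD('p)"
    and "integrable circ (\<lambda>\<theta>. indicator C \<theta> * Re (trace (A n \<theta>)))"
proof -
  have C: "C \<in> sets borel" by simp
  have eq: "indicator C \<theta> * Re (trace (A n \<theta>)) = (\<Sum>i\<in>UNIV. Re (indicator C \<theta> * A n \<theta> $ i $ i))" for \<theta>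
    by (simp add: trace_def sum_distrib_left indicator_def)
  have int: "integrable circ (\<lambda>\<theta>. Re (indicator C \<theta> * A n \<theta> $ i $ i))" for i
    by (intro integrable_Re integrable_A C)
  show "integrable circ (\<lambda>\<theta>. indicator C \<theta> * Re (trace (A n \<theta>)))" unfolding eq by (intro Bochner_Integration.integrable_sum int)
  have "(\<integral>\<theta>. indicator C \<theta> * Re (trace (A n \<theta>)) \<partial>circ) = (\<Sum>i\<in>UNIV. \<integral>\<theta>. Re (indicator C \<theta> * A n \<theta> $ i $ i) \<partial>circ)"
    unfolding eq by (intro Bochner_Integration.integral_sum int)
  also have "\<dots> = (\<Sum>i\<in>UNIV. Re (\<integral>\<theta>. indicator C \<theta> * A n \<theta> $ i $ i \<partial>circ))"
    by (intro sum.cong refl integral_Re integrable_A C)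
  also have "\<dots> \<le> (\<Sum>i\<in>(UNIV :: 'p set). 1)" by (intro sum_mono integral_A_diag_le) auto
  finally show "(\<integral>\<theta>. indicator C \<theta> * Re (trace (A n \<theta>)) \<partial>circ) \<le> CARD('p)" by simp
qed

end

section \<open>Convergence in measure of the weighted polynomials\<close>

text \<open>Closeness is measured relative to the form of \<open>V\<close>. This is invariant under
  congruence, so it passes from \<open>V\<close> and \<open>W\<close> to their congruences by
  \<open>\<phi> n\<close> although nothing is known about the size of
  \<open>\<phi> n\<close>.\<close>

definition near :: "real \<Rightarrow> complex^'p^'p \<Rightarrow> complex^'p^'p \<Rightarrow> bool" where
  "near e V X \<longleftrightarrow> (\<forall>y. (1 - e) * Re (row_form V y y) \<le> Re (row_form X y y) \<and>
     Re (row_form X y y) \<le> (1 + e) * Re (row_form V y y))"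

lemma row_form_norm_bound:
  fixes D :: "complex^'p^'p"
  shows "cmod (row_form D y y) \<le> (real CARD('p))\<^sup>2 * norm D * (norm y)\<^sup>2"
proof -
  have "cmod (y $ k * D $ k $ l * cnj (y $ l)) \<le> norm y * norm D * norm y" for k l
  proof -
    have "cmod (D $ k $ l) \<le> norm D"
      using Finite_Cartesian_Product.norm_nth_le order_trans by metis
    then show ?thesis unfolding norm_mult complex_mod_cnj
      using Finite_Cartesian_Product.norm_nth_le[of y k] Finite_Cartesian_Product.norm_nth_le[of y l]
      by (intro mult_mono mult_nonneg_nonneg) auto
  qed
  then have "cmod (row_form D y y) \<le> (\<Sum>k\<in>(UNIV :: 'p set). \<Sum>l\<in>(UNIV :: 'p set). norm y * norm D * norm y)"
    unfolding row_form_def by (intro sum_norm_le) auto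
  then show ?thesis by (simp add: power2_eq_square mult_ac)
qed

text \<open>The trace of the inverse replaces the reciprocal of the smallest eigenvalue; this is
  \<open>posdef_inverse_pairing\<close> with one factor cancelled.\<close>

lemma posdef_coercive:
  assumes "posdef V"
  shows "(norm y)\<^sup>2 \<le> Re (trace (matrix_inv V)) * Re (row_form V y y)"
proof (cases "y = 0")
  case False
  have "((norm y)\<^sup>2)\<^sup>2 \<le> Re (row_form V y y) * Re (row_form (matrix_inv V) y y)"
    by (rule posdef_inverse_pairing[OF assms])
  also have "\<dots> \<le> Re (row_form V y y) * (Re (trace (matrix_inv V)) * (norm y)\<^sup>2)"
    using assms by (intro mult_left_mono row_form_le_trace hermitian_psd_nonneg posdef_imp_psd posdef_matrix_inv)
  finally have "(norm y)\<^sup>2 * (norm y)\<^sup>2 \<le> (Re (trace (matrix_inv V)) * Re (row_form V y y)) * (norm y)\<^sup>2"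
    by (simp add: power2_eq_square mult_ac)
  then show ?thesis by (rule mult_right_le_imp_le) (use False in simp)
qed simp

lemma near_neighbourhood:
  fixes V :: "complex^'p^'p"
  assumes "posdef V" "0 < e"
  shows "\<exists>r>0. \<forall>X. dist V X < r \<longrightarrow> near e V X"
proof -
  define t q where "t = Re (trace (matrix_inv V))" and "q = (real CARD('p))\<^sup>2"
  have t: "0 \<le> t" using assms by (auto simp: t_def intro: hermitian_psd_trace_nonneg posdef_imp_psd posdef_matrix_inv)
  have q: "0 < q" by (simp add: q_def)
  \<comment> \<open>\<open>q\<close> comes from \<open>row_form_norm_bound\<close> and
    \<open>t\<close> from \<open>posdef_coercive\<close>; \<open>t + 1\<close> keeps the divisor
    positive.\<close>
  define r where "r = e / (q * (t + 1))"
  have "0 < r" using assms t q by (simp add: r_def)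
  moreover have "near e V X" if "dist V X < r" for X
    unfolding near_def
  proof
    fix y
    let ?v = "Re (row_form V y y)"
    have v: "0 \<le> ?v" using assms by (intro hermitian_psd_nonneg posdef_imp_psd)
    have "\<bar>Re (row_form (X - V) y y)\<bar> \<le> q * norm (X - V) * (norm y)\<^sup>2"
      using order_trans[OF abs_Re_le_cmod row_form_norm_bound] by (simp add: q_def)
    also have "\<dots> \<le> q * r * (t * ?v)"
      using that q posdef_coercive[OF assms(1), of y] \<open>0 < r\<close>
      by (intro mult_mono) (auto simp: dist_norm norm_minus_commute t_def)
    also have "\<dots> = (e * (t / (t + 1))) * ?v" using q t by (simp add: r_def)
    also have "\<dots> \<le> e * ?v"
      using t assms v by (intro mult_right_mono mult_left_le) (auto simp: divide_le_eq)
    finally have "\<bar>Re (row_form X y y) - ?v\<bar> \<le> e * ?v"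
      by (simp add: row_form_diff_matrix mult.assoc)
    then show "(1 - e) * ?v \<le> Re (row_form X y y) \<and> Re (row_form X y y) \<le> (1 + e) * ?v"
      by (simp add: abs_le_iff algebra_simps)
  qed
  ultimately show ?thesis by blast
qed

text \<open>Every positive definite matrix has a ball on which relative closeness holds; Lindelof
  extracts countably many of these balls that still cover.\<close>

lemma countable_near_cover:
  assumes "0 < e"
  obtains V :: "nat \<Rightarrow> complex^'p^'p" and r where "\<And>j. posdef (V j)"
    "\<And>j X. X \<in> ball (V j) (r j) \<Longrightarrow> near e (V j) X" "\<And>X. posdef X \<Longrightarrow> \<exists>j. X \<in> ball (V j) (r j)"
proof -
  have "\<forall>V :: complex^'p^'p. \<exists>r. posdef V \<longrightarrow> 0 < r \<and> (\<forall>X. dist V X < r \<longrightarrow> near e V X)"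
    using near_neighbourhood[OF _ assms] by blast
  then obtain R where R: "\<And>V :: complex^'p^'p. posdef V \<Longrightarrow> 0 < R V"
    "\<And>V X :: complex^'p^'p. posdef V \<Longrightarrow> dist V X < R V \<Longrightarrow> near e V X" by metis
  let ?PD = "{V :: complex^'p^'p. posdef V}"
  obtain \<F> where \<F>: "\<F> \<subseteq> (\<lambda>V. ball V (R V)) ` ?PD" "countable \<F>" "\<Union>\<F> = \<Union>((\<lambda>V. ball V (R V)) ` ?PD)"
    using Lindelof[of "(\<lambda>V. ball V (R V)) ` ?PD"] by auto
  from \<F>(1,2) obtain D where D: "D \<subseteq> ?PD" "countable D" "\<F> = (\<lambda>V. ball V (R V)) ` D"
    using countable_subset_image[of \<F> "\<lambda>V. ball V (R V)" ?PD] by auto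
  have cover: "\<exists>V\<in>D. X \<in> ball V (R V)" if "posdef X" for X
  proof -
    have "X \<in> \<Union>((\<lambda>V. ball V (R V)) ` ?PD)" using that R(1)[of X] by auto
    then have "X \<in> \<Union>\<F>" using \<F>(3) by simp
    then show ?thesis using D(3) by auto
  qed
  have "D \<noteq> {}" using cover[OF posdef_mat1] by auto
  define V where "V = from_nat_into D"
  have VD: "V j \<in> D" for j using from_nat_into[OF \<open>D \<noteq> {}\<close>] by (simp add: V_def)
  have "posdef (V j)" for j using VD D(1) by auto
  moreover have "near e (V j) X" if "X \<in> ball (V j) (R (V j))" for j X using that R(2) calculation by simp
  moreover have "\<exists>j. X \<in> ball (V j) (R (V j))" if X: "posdef X" for X
  proof -
    obtain U where "U \<in> D" "X \<in> ball U (R U)" using cover[OF X] by blast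
    moreover obtain j where "V j = U" using from_nat_into_surj[OF D(2) \<open>U \<in> D\<close>] by (auto simp: V_def)
    ultimately show ?thesis by blast
  qed
  ultimately show thesis by (rule that)
qed

context decomposed_measure
begin

text \<open>Neither \<open>W\<close> nor its inverse need be bounded, so constants approximate
  \<open>W\<close> in the relative sense. Countably many pieces cover almost all of the circle, and
  finitely many of them miss less than \<open>e\<close> of its measure.\<close>

lemma posdef_partition:
  assumes pd: "AE \<theta> in circ. posdef (W \<theta>)" and e: "0 < e"
  shows "\<exists>(J :: nat) V E. (\<forall>j. posdef (V j)) \<and> (\<forall>j. E j \<in> sets borel) \<and> (\<forall>j. E j \<subseteq> C) \<and> disjoint_family E \<and>
    (\<forall>j. \<forall>\<theta>\<in>E j. near e (V j) (W \<theta>)) \<and> 1 - e < measure circ (\<Union>j<J. E j)"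
proof -
  obtain V :: "nat \<Rightarrow> complex^'p^'p" and r where V: "\<And>j. posdef (V j)"
    "\<And>j X. X \<in> ball (V j) (r j) \<Longrightarrow> near e (V j) X" "\<And>X. posdef X \<Longrightarrow> \<exists>j. X \<in> ball (V j) (r j)"
    using countable_near_cover[OF e] by blast
  define S where "S j = C \<inter> W -` ball (V j) (r j)" for j
  have S: "S j \<in> sets borel" for j
    unfolding S_def using measurable_sets[OF W_measurable, of "ball (V j) (r j)"] by (intro sets.Int) simp_all
  define E where "E = disjointed S"
  have ES: "E j \<subseteq> S j" for j unfolding E_def by (rule disjointed_subset)
  have E: "E j \<in> sets borel" for j
    using sets.range_disjointed_sets[of S borel] S unfolding E_def by auto
  have "measure circ (\<Union>j. E j) = measure circ (space circ)"
  proof (rule measure_eq_AE)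
    show "AE \<theta> in circ. (\<theta> \<in> (\<Union>j. E j)) = (\<theta> \<in> space circ)"
      using pd AE_C
    proof eventually_elim
      case (elim \<theta>)
      then obtain j where "\<theta> \<in> S j" using V(3)[of "W \<theta>"] by (auto simp: S_def)
      then have "\<theta> \<in> (\<Union>j. E j)" unfolding E_def UN_disjointed_eq by blast
      then show ?case by simp
    qed
  qed (use E in auto)
  then have 1: "measure circ (\<Union>j. E j) = 1" by simp
  have "(\<Union>i. \<Union>j<i. E j) = (\<Union>j. E j)" by auto
  moreover have "(\<lambda>i. measure circ (\<Union>j<i. E j)) \<longlonglongrightarrow> measure circ (\<Union>i. \<Union>j<i. E j)"
  proof (rule circ.finite_Lim_measure_incseq)
    show "range (\<lambda>i. \<Union>j<i. E j) \<subseteq> sets circ" using E by auto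
    show "incseq (\<lambda>i. \<Union>j<i. E j)" by (intro monoI UN_mono) auto
  qed
  ultimately have "(\<lambda>i. measure circ (\<Union>j<i. E j)) \<longlonglongrightarrow> 1" using 1 by simp
  then have "eventually (\<lambda>i. 1 - e < measure circ (\<Union>j<i. E j)) sequentially"
    by (rule order_tendstoD) (use e in simp)
  then obtain J where J: "1 - e < measure circ (\<Union>j<J. E j)" by (auto simp: eventually_sequentially)
  have "\<forall>j. E j \<subseteq> C" using ES by (auto simp: S_def)
  moreover have "\<forall>j. \<forall>\<theta>\<in>E j. near e (V j) (W \<theta>)" using ES V(2) by (fastforce simp: S_def)
  moreover have "disjoint_family E" unfolding E_def by (rule disjoint_family_disjointed)
  ultimately show ?thesis using V(1) E J by blast
qed

end

section \<open>Trace estimates for \<open>A n\<close> and \<open>F n\<close>\<close>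

context orthonormal_system
begin

lemma integrable_trace_F:
  assumes "trig q (\<lambda>\<theta>. complex_of_real (g \<theta>))"
  shows "integrable circ (\<lambda>\<theta>. g \<theta> * Re (trace (P ** F n \<theta>)))"
proof -
  have "bounded_borel (\<lambda>\<theta>. complex_of_real (g \<theta>) * trace (P ** F n \<theta>))"
    unfolding trace_mult_eq
    by (intro bounded_borel_mult[OF bounded_borel_trig[OF assms]] bounded_borel_sum bounded_borel_mult bounded_borel_const bounded_F)
  from integrable_Re[OF bounded_borel_integrable_circ[OF this]] show ?thesis by simp
qed

text \<open>Bernstein-Szego turns the integral of \<open>g\<close> times \<open>F n\<close> into one
  against \<open>\<rho>\<close>, which is close to that of \<open>W\<close> over \<open>E\<close>.
  There \<open>W\<close> is at most \<open>(1 + e) V\<close> as a form, which bounds the trace of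
  \<open>V^-1 W\<close>.\<close>

lemma integral_trace_F_le:
  fixes \<delta> :: real
  assumes V: "posdef V" and E: "E \<in> sets borel" "E \<subseteq> C" and near: "\<forall>\<theta>\<in>E. near e V (W \<theta>)"
    and g: "trig n (\<lambda>\<theta>. complex_of_real (g \<theta>))"
    and ap: "\<And>k l. cmod (entry_integral \<rho> k l (\<lambda>\<theta>. complex_of_real (g \<theta>)) - (\<integral>\<theta>. indicator E \<theta> * W \<theta> $ k $ l \<partial>circ)) \<le> \<delta>"
  shows "(\<integral>\<theta>. g \<theta> * Re (trace (matrix_inv V ** F n \<theta>)) \<partial>circ)
    \<le> (1 + e) * CARD('p) * measure circ E + \<delta> * (\<Sum>k\<in>UNIV. \<Sum>l\<in>UNIV. cmod (matrix_inv V $ k $ l))"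
proof -
  let ?P = "matrix_inv V"
  have gF: "integrable circ (\<lambda>\<theta>. complex_of_real (g \<theta>) * F n \<theta> $ k $ l)" for k l
    by (rule bounded_integrable_F[OF bounded_borel_trig[OF g]])
  have EW: "integrable circ (\<lambda>\<theta>. indicator E \<theta> * W \<theta> $ k $ l)" for k l
    using E(1) by (intro bounded_bochner_integrable[OF W_entry_int, of _ 1]) (auto simp: indicator_def)
  have tr: "c * trace (?P ** X) = (\<Sum>k\<in>UNIV. \<Sum>l\<in>UNIV. ?P $ k $ l * (c * X $ l $ k))" for c and X :: "complex^'p^'p"
    by (simp add: trace_mult_eq sum_distrib_left mult_ac)
  have int: "integrable circ (\<lambda>\<theta>. c \<theta> * trace (?P ** X \<theta>))"
    "(\<integral>\<theta>. c \<theta> * trace (?P ** X \<theta>) \<partial>circ) = (\<Sum>k\<in>UNIV. \<Sum>l\<in>UNIV. ?P $ k $ l * (\<integral>\<theta>. c \<theta> * X \<theta> $ l $ k \<partial>circ))"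
    if "\<And>k l. integrable circ (\<lambda>\<theta>. c \<theta> * X \<theta> $ k $ l)" for c and X :: "real \<Rightarrow> complex^'p^'p"
  proof -
    have i: "integrable circ (\<lambda>\<theta>. ?P $ k $ l * (c \<theta> * X \<theta> $ l $ k))" for k l
      using that by (intro integrable_mult_right)
    show "integrable circ (\<lambda>\<theta>. c \<theta> * trace (?P ** X \<theta>))"
      unfolding tr by (intro Bochner_Integration.integrable_sum i)
    have "(\<integral>\<theta>. c \<theta> * trace (?P ** X \<theta>) \<partial>circ) = (\<Sum>k\<in>UNIV. \<integral>\<theta>. (\<Sum>l\<in>UNIV. ?P $ k $ l * (c \<theta> * X \<theta> $ l $ k)) \<partial>circ)"
      unfolding tr by (intro Bochner_Integration.integral_sum Bochner_Integration.integrable_sum i)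
    also have "\<dots> = (\<Sum>k\<in>UNIV. \<Sum>l\<in>UNIV. \<integral>\<theta>. ?P $ k $ l * (c \<theta> * X \<theta> $ l $ k) \<partial>circ)"
      by (intro sum.cong refl Bochner_Integration.integral_sum i)
    finally show "(\<integral>\<theta>. c \<theta> * trace (?P ** X \<theta>) \<partial>circ) = (\<Sum>k\<in>UNIV. \<Sum>l\<in>UNIV. ?P $ k $ l * (\<integral>\<theta>. c \<theta> * X \<theta> $ l $ k \<partial>circ))"
      by simp
  qed
  note intF = int[of "\<lambda>\<theta>. complex_of_real (g \<theta>)" "F n", OF gF]
  note intW = int[of "indicator E" W, OF EW]
  have "(\<integral>\<theta>. complex_of_real (g \<theta>) * trace (?P ** F n \<theta>) \<partial>circ) - (\<integral>\<theta>. indicator E \<theta> * trace (?P ** W \<theta>) \<partial>circ)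
      = (\<Sum>k\<in>UNIV. \<Sum>l\<in>UNIV. ?P $ k $ l * (entry_integral \<rho> l k (\<lambda>\<theta>. complex_of_real (g \<theta>)) - (\<integral>\<theta>. indicator E \<theta> * W \<theta> $ l $ k \<partial>circ)))"
    unfolding intF intW Bernstein_Szego[OF g] by (simp add: sum_subtractf right_diff_distrib)
  also have "cmod \<dots> \<le> (\<Sum>k\<in>UNIV. \<Sum>l\<in>UNIV. cmod (?P $ k $ l) * \<delta>)"
    by (intro sum_norm_le) (simp add: norm_mult ap mult_left_mono)
  finally have diff: "cmod ((\<integral>\<theta>. complex_of_real (g \<theta>) * trace (?P ** F n \<theta>) \<partial>circ) - (\<integral>\<theta>. indicator E \<theta> * trace (?P ** W \<theta>) \<partial>circ))
      \<le> \<delta> * (\<Sum>k\<in>UNIV. \<Sum>l\<in>UNIV. cmod (?P $ k $ l))" by (simp add: sum_distrib_left mult.commute)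
  have tW: "Re (trace (?P ** W \<theta>)) \<le> (1 + e) * CARD('p)" if "\<theta> \<in> E" for \<theta>
  proof -
    let ?Y = "(1 + e) *\<^sub>R V - W \<theta>"
    have W: "hermitian_psd (W \<theta>)" using that E(2) by (intro W_psd) auto
    have "hermitian_psd ?Y"
    proof (rule hermitian_psdI)
      show "htranspose ?Y = ?Y"
        using V W unfolding posdef_def hermitian_psd_def htranspose_def
        by (auto simp: vec_eq_iff transpose_def)
      show "0 \<le> Re (row_form ?Y u u)" for u
        using near that by (simp add: near_def row_form_diff_matrix row_form_scaleR_matrix)
    qed
    then have "0 \<le> Re (trace (?P ** ?Y))"
      by (rule trace_psd_mult_nonneg[OF posdef_imp_psd[OF posdef_matrix_inv[OF V]]])
    also have "trace (?P ** ?Y) = (1 + e) * trace (?P ** V) - trace (?P ** W \<theta>)"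
      by (simp add: trace_mult_eq algebra_simps sum.distrib sum_subtractf sum_distrib_left
          scaleR_conv_of_real[where 'a=complex])
    also have "?P ** V = mat 1" by (rule matrix_inv[OF posdef_invertible[OF V]])
    also have "trace (mat 1 :: complex^'p^'p) = CARD('p)" by (simp add: trace_def mat_def)
    finally show ?thesis by simp
  qed
  have "Re (\<integral>\<theta>. indicator E \<theta> * trace (?P ** W \<theta>) \<partial>circ) = (\<integral>\<theta>. Re (indicator E \<theta> * trace (?P ** W \<theta>)) \<partial>circ)"
    by (rule integral_Re[OF intW(1), symmetric])
  also have "\<dots> \<le> (\<integral>\<theta>. ((1 + e) * CARD('p)) * indicator E \<theta> \<partial>circ)"
  proof (intro integral_mono integrable_Re intW(1))
    show "integrable circ (\<lambda>\<theta>. ((1 + e) * CARD('p)) * indicator E \<theta>)"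
      using E(1) by (intro integrable_mult_right integrable_real_indicator) (auto simp: circ.emeasure_eq_measure)
    show "Re (indicator E \<theta> * trace (?P ** W \<theta>)) \<le> ((1 + e) * CARD('p)) * indicator E \<theta>" for \<theta>
      using tW[of \<theta>] by (simp add: indicator_def)
  qed
  also have "\<dots> = (1 + e) * CARD('p) * measure circ E" using E(1) by simp
  finally have "Re (\<integral>\<theta>. indicator E \<theta> * trace (?P ** W \<theta>) \<partial>circ) \<le> (1 + e) * CARD('p) * measure circ E" .
  moreover have "(\<integral>\<theta>. g \<theta> * Re (trace (?P ** F n \<theta>)) \<partial>circ) = Re (\<integral>\<theta>. complex_of_real (g \<theta>) * trace (?P ** F n \<theta>) \<partial>circ)"
    unfolding integral_Re[OF intF(1), symmetric] by simp
  moreover have "Re ((\<integral>\<theta>. complex_of_real (g \<theta>) * trace (?P ** F n \<theta>) \<partial>circ) - (\<integral>\<theta>. indicator E \<theta> * trace (?P ** W \<theta>) \<partial>circ))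
      \<le> \<delta> * (\<Sum>k\<in>UNIV. \<Sum>l\<in>UNIV. cmod (?P $ k $ l))"
    using order_trans[OF complex_Re_le_cmod diff] .
  ultimately show ?thesis unfolding minus_complex.sel by linarith
qed

text \<open>For \<open>B\<close>, the congruence of \<open>V\<close> by \<open>\<phi> n\<close>,
  cyclicity of the trace makes the trace of \<open>B^-1\<close> that of \<open>V^-1 F n\<close>. So
  \<open>T\<close> is at least \<open>1 - e\<close> times the trace of \<open>B + B^-1\<close>. By
  \<open>posdef_trace_inverse\<close> this trace is at least twice the dimension, and a small excess
  forces \<open>B\<close>, hence \<open>A n\<close>, close to the identity.\<close>

lemma trace_sum_lower:
  fixes e g :: real and n :: nat
  assumes V: "posdef V" and near: "near e V (W \<theta>)" and e: "0 < e" "e < 1" and g: "1 - e \<le> g"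
  defines "T \<equiv> Re (trace (A n \<theta>)) + g * Re (trace (matrix_inv V ** F n \<theta>))"
  shows "(1 - e) * (2 * CARD('p)) \<le> T"
    and "T < (1 - e) * (2 * CARD('p) + \<eta>\<^sup>2 / 4) \<Longrightarrow> e \<le> \<eta> \<Longrightarrow> \<eta> \<le> 1 \<Longrightarrow> near (3 * \<eta>) (mat 1) (A n \<theta>)"
proof -
  define B where "B = \<Phi> n \<theta> ** V ** htranspose (\<Phi> n \<theta>)"
  have B: "posdef B" unfolding B_def by (rule posdef_congruence[OF V \<Phi>_invertible])
  have B_form: "row_form B y y = row_form V (y v* \<Phi> n \<theta>) (y v* \<Phi> n \<theta>)" for y
    unfolding B_def by (rule row_form_congruence)
  have AB: "(1 - e) * Re (row_form B y y) \<le> Re (row_form (A n \<theta>) y y)"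
    "Re (row_form (A n \<theta>) y y) \<le> (1 + e) * Re (row_form B y y)" for y
    using near unfolding near_def B_form row_form_A by blast+
  have Binv: "matrix_inv B = htranspose (\<Psi> n \<theta>) ** (matrix_inv V ** \<Psi> n \<theta>)"
  proof (rule matrix_inv_unique(1))
    have "B ** (htranspose (\<Psi> n \<theta>) ** (matrix_inv V ** \<Psi> n \<theta>))
        = \<Phi> n \<theta> ** V ** (htranspose (\<Phi> n \<theta>) ** htranspose (\<Psi> n \<theta>)) ** matrix_inv V ** \<Psi> n \<theta>"
      unfolding B_def by (simp only: matrix_mul_assoc)
    also have "htranspose (\<Phi> n \<theta>) ** htranspose (\<Psi> n \<theta>) = mat 1"
      unfolding htranspose_mult[symmetric] by simp
    also have "\<Phi> n \<theta> ** V ** mat 1 ** matrix_inv V ** \<Psi> n \<theta> = \<Phi> n \<theta> ** (V ** matrix_inv V) ** \<Psi> n \<theta>"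
      by (simp add: matrix_mul_assoc)
    also have "\<dots> = mat 1" by (simp add: matrix_inv[OF posdef_invertible[OF V]])
    finally show "B ** (htranspose (\<Psi> n \<theta>) ** (matrix_inv V ** \<Psi> n \<theta>)) = mat 1" .
  qed
  have trB: "trace (matrix_inv B) = trace (matrix_inv V ** F n \<theta>)"
    unfolding Binv trace_mul_sym[of "htranspose (\<Psi> n \<theta>)"] F_def by (simp only: matrix_mul_assoc)
  have "(1 - e) * Re (trace B) \<le> Re (trace (A n \<theta>))"
    unfolding Re_trace sum_distrib_left by (intro sum_mono AB)
  moreover have "(1 - e) * Re (trace (matrix_inv B)) \<le> g * Re (trace (matrix_inv V ** F n \<theta>))"
    unfolding trB[symmetric]
    using g B by (intro mult_right_mono hermitian_psd_trace_nonneg posdef_imp_psd posdef_matrix_inv)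
  ultimately have T: "(1 - e) * (Re (trace B) + Re (trace (matrix_inv B))) \<le> T"
    unfolding T_def by (simp add: distrib_left)
  have unit: "Re (row_form B x x) + 1 / Re (row_form B x x) - 2 \<le> Re (trace B) + Re (trace (matrix_inv B)) - 2 * CARD('p)"
    if "norm x = 1" for x
    using posdef_trace_inverse[OF B that] .
  have pos: "0 < Re (row_form B x x)" if "norm x = 1" for x
    using B that unfolding posdef_def by (metis norm_zero zero_neq_one)
  \<comment> \<open>Any unit vector shows that the excess is nonnegative, as
    \<open>b + 1 / b\<close> is at least 2.\<close>
  have "2 * CARD('p) \<le> Re (trace B) + Re (trace (matrix_inv B))"
  proof -
    have u: "norm (axis i (1::complex)) = 1" for i :: 'p by simp
    define b where "b = Re (row_form B (axis undefined 1) (axis undefined 1))"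
    have "0 < b" unfolding b_def by (rule pos[OF u])
    then have "0 \<le> b + 1 / b - 2"
      using zero_le_power2[of "b - 1"] by (simp add: field_simps power2_eq_square)
    with unit[OF u, of undefined] show ?thesis unfolding b_def by simp
  qed
  then have "(1 - e) * (2 * CARD('p)) \<le> (1 - e) * (Re (trace B) + Re (trace (matrix_inv B)))"
    using e by (intro mult_left_mono) auto
  with T show "(1 - e) * (2 * CARD('p)) \<le> T" by simp
  assume small: "T < (1 - e) * (2 * CARD('p) + \<eta>\<^sup>2 / 4)" and \<eta>: "e \<le> \<eta>" "\<eta> \<le> 1"
  have "(1 - e) * (Re (trace B) + Re (trace (matrix_inv B))) < (1 - e) * (2 * CARD('p) + \<eta>\<^sup>2 / 4)"
    using T small by simp
  then have tr: "Re (trace B) + Re (trace (matrix_inv B)) - 2 * CARD('p) < \<eta>\<^sup>2 / 4"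
    using e by (simp add: mult_less_cancel_left_pos)
  have unit_B: "\<bar>Re (row_form B x x) - 1\<bar> \<le> \<eta>" if "norm x = 1" for x
    using abs_diff_one_le[OF pos[OF that], of \<eta>] unit[OF that] tr e \<eta> by simp
  have B1: "\<bar>Re (row_form B y y) - (norm y)\<^sup>2\<bar> \<le> \<eta> * (norm y)\<^sup>2" for y
  proof (cases "y = 0")
    case False
    define x where "x = complex_of_real (1 / norm y) *s y"
    have "norm x = 1" using False unfolding x_def of_real_vector_scale by simp
    have "y = complex_of_real (norm y) *s x"
      using False by (simp add: x_def vec_eq_iff)
    then have "row_form B y y = row_form B (complex_of_real (norm y) *s x) (complex_of_real (norm y) *s x)" by simp
    also have "\<dots> = complex_of_real ((norm y)\<^sup>2) * row_form B x x"
      by (simp only: row_form_scale_left row_form_scale_right complex_cnj_complex_of_real) (simp add: power2_eq_square)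
    finally have "Re (row_form B y y) = (norm y)\<^sup>2 * Re (row_form B x x)" by (simp flip: of_real_power)
    then have "Re (row_form B y y) - (norm y)\<^sup>2 = (norm y)\<^sup>2 * (Re (row_form B x x) - 1)" by (simp add: algebra_simps)
    then have "\<bar>Re (row_form B y y) - (norm y)\<^sup>2\<bar> = (norm y)\<^sup>2 * \<bar>Re (row_form B x x) - 1\<bar>" by (simp add: abs_mult)
    also have "\<dots> \<le> (norm y)\<^sup>2 * \<eta>" using unit_B[OF \<open>norm x = 1\<close>] by (intro mult_left_mono) auto
    finally show ?thesis by (simp add: mult.commute)
  qed simp
  \<comment> \<open>The factor 3 absorbs two errors: \<open>\<eta>\<close> between \<open>B\<close>
    and the identity, and \<open>e \<le> \<eta>\<close> between \<open>A n\<close> and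
    \<open>B\<close>.\<close>
  show "near (3 * \<eta>) (mat 1) (A n \<theta>)"
    unfolding near_def row_form_mat1
  proof
    fix y
    define s b where "s = (norm y)\<^sup>2" and "b = Re (row_form B y y)"
    have s: "0 \<le> s" by (simp add: s_def)
    have b: "\<bar>b - s\<bar> \<le> \<eta> * s" using B1[of y] by (simp add: s_def b_def)
    have bu: "b \<le> (1 + \<eta>) * s" and bl: "(1 - \<eta>) * s \<le> b" using b by (simp_all add: abs_le_iff algebra_simps)
    have b0: "0 \<le> b" unfolding b_def by (intro hermitian_psd_nonneg posdef_imp_psd B)
    have "(1 + e) * b \<le> (1 + \<eta>) * ((1 + \<eta>) * s)" using bu b0 \<eta> e by (intro mult_mono) auto
    also have "\<dots> \<le> (1 + 3 * \<eta>) * s"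
    proof -
      have "\<eta> * \<eta> \<le> \<eta> * 1" using \<eta> e by (intro mult_left_mono) auto
      then have "(1 + \<eta>) * (1 + \<eta>) \<le> 1 + 3 * \<eta>" by (simp add: algebra_simps)
      from mult_right_mono[OF this s] show ?thesis by (simp add: mult_ac)
    qed
    finally have up: "(1 + e) * b \<le> (1 + 3 * \<eta>) * s" .
    have "(1 - 3 * \<eta>) * s \<le> (1 - \<eta>) * ((1 - \<eta>) * s)"
    proof -
      have "1 - 3 * \<eta> \<le> (1 - \<eta>) * (1 - \<eta>)" using \<eta> e by (simp add: algebra_simps)
      from mult_right_mono[OF this s] show ?thesis by (simp add: mult_ac)
    qed
    also have "\<dots> \<le> (1 - \<eta>) * b" using bl \<eta> by (intro mult_left_mono) auto
    also have "\<dots> \<le> (1 - e) * b" using \<eta> b0 by (intro mult_right_mono) auto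
    finally have lo: "(1 - 3 * \<eta>) * s \<le> (1 - e) * b" .
    show "(1 - 3 * \<eta>) * Re (complex_of_real ((norm y)\<^sup>2)) \<le> Re (row_form (A n \<theta>) y y) \<and>
        Re (row_form (A n \<theta>) y y) \<le> (1 + 3 * \<eta>) * Re (complex_of_real ((norm y)\<^sup>2))"
      using AB[of y] up lo unfolding s_def b_def Re_complex_of_real by linarith
  qed
qed

end

context orthonormal_system
begin

text \<open>A Markov argument: on a set \<open>Gd\<close> of nearly full measure \<open>T\<close> is
  at least about \<open>2 p\<close>, its integral is at most about \<open>2 p\<close>, so the set
  \<open>Z\<close> where it exceeds this value by about \<open>\<kappa>\<close> is small. Off
  \<open>Z\<close> the second part of \<open>trace_sum_lower\<close> applies.\<close>

lemma A_near_identity: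
  assumes pd: "AE \<theta> in circ. posdef (W \<theta>)" and \<eta>: "0 < \<eta>" "\<eta> \<le> 1"
  shows "\<exists>n0. \<forall>n\<ge>n0. \<exists>Y\<in>sets borel. 1 - \<eta> \<le> measure circ Y \<and> (\<forall>\<theta>\<in>Y. near (3 * \<eta>) (mat 1) (A n \<theta>))"
proof -
  \<comment> \<open>\<open>\<kappa>\<close> is the excess allowed in \<open>trace_sum_lower\<close>.
    The argument ends with \<open>\<kappa> * measure circ Z \<le> 16 * p * e\<close>, and
    \<open>e\<close> makes the right side \<open>\<kappa> * \<eta> / 2\<close>.\<close>
  define p \<kappa> e where "p = real CARD('p)" and "\<kappa> = \<eta>\<^sup>2 / 4" and "e = \<eta> * \<kappa> / (32 * p)"
  have p: "1 \<le> p" by (simp add: p_def)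
  have \<kappa>: "0 < \<kappa>" "\<kappa> \<le> 1 / 4" using \<eta> by (auto simp: \<kappa>_def power_le_one)
  have e0: "0 < e" using \<eta> \<kappa> p by (simp add: e_def)
  have e32: "32 * p * e = \<eta> * \<kappa>" using p by (simp add: e_def)
  have "32 * e \<le> 32 * p * e" using p e0 by simp
  also have "\<dots> \<le> \<eta> * (1 / 4)" unfolding e32 using \<kappa> \<eta> by (intro mult_left_mono) auto
  finally have e_small: "128 * e \<le> \<eta>" by simp
  obtain J :: nat and V E where V: "\<forall>j. posdef (V j)" and E: "\<forall>j. E j \<in> sets borel" "\<forall>j. E j \<subseteq> C"
    and disj: "disjoint_family E" and near: "\<forall>j. \<forall>\<theta>\<in>E j. near e (V j) (W \<theta>)"
    and J: "1 - e < measure circ (\<Union>j<J. E j)"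
    using posdef_partition[OF pd e0] by (elim exE conjE)
  define Q where "Q j = (\<Sum>k\<in>UNIV. \<Sum>l\<in>UNIV. cmod (matrix_inv (V j) $ k $ l))" for j
  have Q0: "0 \<le> Q j" for j by (simp add: Q_def sum_nonneg)
  define QQ where "QQ = (\<Sum>j<J. Q j)"
  have QQ: "0 \<le> QQ" by (simp add: QQ_def sum_nonneg Q0)
  \<comment> \<open>The two terms serve \<open>J\<close> exceptional sets of measure at most
    \<open>\<delta> / e\<close> and the sum of the errors \<open>\<delta> * Q j\<close>; either
    total is at most \<open>e\<close>.\<close>
  define \<delta> where "\<delta> = min (e\<^sup>2 / (real J + 1)) (e / (QQ + 1))"
  have \<delta>: "0 < \<delta>" using e0 QQ by (simp add: \<delta>_def)
  have \<delta>J: "real J * (\<delta> / e) \<le> e"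
  proof -
    have "\<delta> \<le> e\<^sup>2 / (real J + 1)" by (simp add: \<delta>_def)
    then have "(real J + 1) * \<delta> \<le> e\<^sup>2" by (simp add: field_simps)
    then have "real J * \<delta> \<le> e * e" using \<delta> by (simp add: algebra_simps power2_eq_square)
    then show ?thesis using e0 by (simp add: field_simps)
  qed
  have \<delta>Q: "\<delta> * QQ \<le> e"
  proof -
    have "\<delta> \<le> e / (QQ + 1)" by (simp add: \<delta>_def)
    then have "(QQ + 1) * \<delta> \<le> e" using QQ by (simp add: field_simps)
    then show ?thesis using \<delta> by (simp add: algebra_simps)
  qed
  define R where "R j q g \<longleftrightarrow> trig q (\<lambda>\<theta>. complex_of_real (g \<theta>)) \<and> (\<forall>\<theta>. 0 \<le> g \<theta>) \<and>
      (\<integral>\<theta>. \<bar>g \<theta> - indicator (E j) \<theta>\<bar> \<partial>circ) \<le> \<delta> \<and>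
      (\<forall>k l. cmod (entry_integral \<rho> k l (\<lambda>\<theta>. complex_of_real (g \<theta>)) - (\<integral>\<theta>. indicator (E j) \<theta> * W \<theta> $ k $ l \<partial>circ)) \<le> \<delta>)"
    for j q and g :: "real \<Rightarrow> real"
  have "\<exists>q g. R j q g" for j
  proof -
    obtain q g where g: "trig q (\<lambda>\<theta>. complex_of_real (g \<theta>))" "\<forall>\<theta>. 0 \<le> g \<theta>"
      "(\<integral>\<theta>. \<bar>g \<theta> - indicator (E j) \<theta>\<bar> \<partial>circ) \<le> \<delta>"
      and ap: "\<forall>k l h B. h \<in> borel_measurable borel \<longrightarrow> (\<forall>\<theta>. cmod (h \<theta>) \<le> B) \<longrightarrow>
        cmod (entry_integral \<rho> k l (\<lambda>\<theta>. complex_of_real (g \<theta>) * h \<theta>)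
        - (\<integral>\<theta>. indicator (E j) \<theta> * h \<theta> * W \<theta> $ k $ l \<partial>circ)) \<le> B * \<delta>"
      using trig_approx_C[OF E(1)[rule_format, of j] E(2)[rule_format, of j] \<delta>] by (elim exE conjE)
    have "cmod (entry_integral \<rho> k l (\<lambda>\<theta>. complex_of_real (g \<theta>)) - (\<integral>\<theta>. indicator (E j) \<theta> * W \<theta> $ k $ l \<partial>circ)) \<le> \<delta>" for k l
      using ap[rule_format, of "\<lambda>_. 1" 1 k l] by simp
    with g have "R j q g" unfolding R_def by simp
    then show ?thesis by blast
  qed
  then obtain K g where Kg: "\<And>j. R j (K j) (g j)" by metis
  have g: "trig (K j) (\<lambda>\<theta>. complex_of_real (g j \<theta>))" "0 \<le> g j \<theta>"
    "(\<integral>\<theta>. \<bar>g j \<theta> - indicator (E j) \<theta>\<bar> \<partial>circ) \<le> \<delta>"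
    "cmod (entry_integral \<rho> k l (\<lambda>\<theta>. complex_of_real (g j \<theta>)) - (\<integral>\<theta>. indicator (E j) \<theta> * W \<theta> $ k $ l \<partial>circ)) \<le> \<delta>"
    for j \<theta> k l
    using Kg[of j] unfolding R_def by blast+
  have g_meas [measurable]: "g j \<in> borel_measurable borel" for j
  proof -
    have "(\<lambda>\<theta>. Re (complex_of_real (g j \<theta>))) \<in> borel_measurable borel"
      using trig_measurable[OF g(1), of j] by measurable
    then show ?thesis by simp
  qed
  have [measurable]: "E j \<in> sets borel" for j using E by simp
  \<comment> \<open>Where \<open>g j\<close> drops below \<open>1 - e\<close> on \<open>E j\<close>,
    it differs from the indicator by more than \<open>e\<close>, so little of \<open>E j\<close> is
    lost.\<close>
  define H where "H j = E j \<inter> {\<theta>. 1 - e \<le> g j \<theta>}" for j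
  have [measurable]: "H j \<in> sets borel" for j unfolding H_def by measurable
  have bad: "measure circ (E j - H j) \<le> \<delta> / e" for j
  proof -
    have i: "integrable circ (\<lambda>\<theta>. \<bar>g j \<theta> - indicator (E j) \<theta>\<bar>)"
      by (intro integrable_abs_diff_indicator[OF g(1)] finite_measure_circ) simp_all
    have "(\<integral>\<theta>. e * indicator (E j - H j) \<theta> \<partial>circ) \<le> (\<integral>\<theta>. \<bar>g j \<theta> - indicator (E j) \<theta>\<bar> \<partial>circ)"
    proof (rule integral_mono)
      show "integrable circ (\<lambda>\<theta>. e * indicator (E j - H j) \<theta>)"
        by (intro integrable_mult_right integrable_real_indicator) (auto simp: circ.emeasure_eq_measure)
      show "e * indicator (E j - H j) \<theta> \<le> \<bar>g j \<theta> - indicator (E j) \<theta>\<bar>" for \<theta>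
        using e0 by (auto simp: H_def indicator_def)
    qed (rule i)
    then have "e * measure circ (E j - H j) \<le> \<delta>" using g(3)[of j] by simp
    then show ?thesis using e0 by (simp add: field_simps)
  qed
  define Gd where "Gd = (\<Union>j<J. H j)"
  have [measurable]: "Gd \<in> sets borel" unfolding Gd_def by measurable
  have GdC: "Gd \<subseteq> C" using E unfolding Gd_def H_def by blast
  have mGd: "1 - 2 * e \<le> measure circ Gd"
  proof -
    have "(\<Union>j<J. E j) \<subseteq> Gd \<union> (\<Union>j<J. E j - H j)" unfolding Gd_def by blast
    then have "measure circ (\<Union>j<J. E j) \<le> measure circ (Gd \<union> (\<Union>j<J. E j - H j))"
      by (intro circ.finite_measure_mono) auto
    also have "\<dots> \<le> measure circ Gd + measure circ (\<Union>j<J. E j - H j)"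
      by (intro measure_Un_le) auto
    also have "measure circ (\<Union>j<J. E j - H j) \<le> (\<Sum>j<J. measure circ (E j - H j))"
      by (intro measure_UNION_le) auto
    also have "\<dots> \<le> (\<Sum>j<J. \<delta> / e)" by (intro sum_mono bad)
    also have "\<dots> \<le> e" using \<delta>J by simp
    finally show ?thesis using J by simp
  qed
  have sumE: "(\<Sum>j<J. measure circ (E j)) \<le> 1"
  proof -
    have "(\<Sum>j<J. measure circ (E j)) = measure circ (\<Union>j<J. E j)"
      using disj by (intro circ.finite_measure_finite_Union[symmetric])
        (auto simp: disjoint_family_on_def)
    also have "\<dots> \<le> measure circ (space circ)" by (rule circ.bounded_measure)
    finally show ?thesis by simp
  qed
  show ?thesis
  proof (intro exI allI impI)
    \<comment> \<open>Then each \<open>g j\<close> with \<open>j < J\<close> has degree at most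
      \<open>n\<close>, as Bernstein-Szego for \<open>F n\<close> requires.\<close>
    fix n assume n: "(\<Sum>j<J. K j) \<le> n"
    define h where "h j \<theta> = g j \<theta> * Re (trace (matrix_inv (V j) ** F n \<theta>))" for j \<theta>
    have h0: "0 \<le> h j \<theta>" for j \<theta>
      unfolding h_def using V
      by (intro mult_nonneg_nonneg g(2) trace_psd_mult_nonneg posdef_imp_psd[OF posdef_matrix_inv] psd_F) auto
    have ih: "integrable circ (h j)" for j unfolding h_def by (rule integrable_trace_F[OF g(1)])
    have h_le: "(\<integral>\<theta>. h j \<theta> \<partial>circ) \<le> (1 + e) * p * measure circ (E j) + \<delta> * Q j" if "j < J" for j
    proof -
      have "K j \<le> (\<Sum>j<J. K j)" using that by (intro member_le_sum) auto
      with n have "trig n (\<lambda>\<theta>. complex_of_real (g j \<theta>))" by (intro trig_mono[OF g(1)]) simp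
      then show ?thesis
        unfolding h_def p_def Q_def using V E near g(4) by (intro integral_trace_F_le) auto
    qed
    define T where "T \<theta> = indicator C \<theta> * Re (trace (A n \<theta>)) + (\<Sum>j<J. h j \<theta>)" for \<theta>
    have iT: "integrable circ T"
      unfolding T_def by (intro Bochner_Integration.integrable_add Bochner_Integration.integrable_sum ih integral_trace_A_le(2))
    have [measurable]: "T \<in> borel_measurable borel" using borel_measurable_integrable[OF iT] by simp
    have tA: "0 \<le> indicator C \<theta> * Re (trace (A n \<theta>))" for \<theta>
      using hermitian_psd_trace_nonneg[OF psd_A, of \<theta> n] by (auto simp: indicator_def)
    have T0: "0 \<le> T \<theta>" for \<theta> unfolding T_def by (intro add_nonneg_nonneg sum_nonneg tA h0)
    have T_int: "(\<integral>\<theta>. T \<theta> \<partial>circ) \<le> 2 * p + p * e + e"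
    proof -
      have "(\<integral>\<theta>. T \<theta> \<partial>circ) = (\<integral>\<theta>. indicator C \<theta> * Re (trace (A n \<theta>)) \<partial>circ) + (\<Sum>j<J. \<integral>\<theta>. h j \<theta> \<partial>circ)"
        unfolding T_def by (simp add: Bochner_Integration.integral_add Bochner_Integration.integral_sum ih integral_trace_A_le(2))
      also have "\<dots> \<le> p + (\<Sum>j<J. (1 + e) * p * measure circ (E j) + \<delta> * Q j)"
        using integral_trace_A_le(1)[of n] h_le by (intro add_mono sum_mono) (auto simp: p_def)
      also have "\<dots> = p + (1 + e) * p * (\<Sum>j<J. measure circ (E j)) + \<delta> * QQ"
        by (simp add: sum.distrib sum_distrib_left QQ_def)
      also have "\<dots> \<le> p + (1 + e) * p * 1 + e"
        using sumE \<delta>Q e0 p by (intro add_mono mult_left_mono) auto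
      finally show ?thesis by (simp add: algebra_simps)
    qed
    define Z where "Z = Gd \<inter> {\<theta>. (1 - e) * (2 * p + \<kappa>) \<le> T \<theta>}"
    have [measurable]: "Z \<in> sets borel" unfolding Z_def by measurable
    have on_Gd: "(1 - e) * (2 * p) \<le> T \<theta>"
      "T \<theta> < (1 - e) * (2 * p + \<kappa>) \<Longrightarrow> near (3 * \<eta>) (mat 1) (A n \<theta>)" if "\<theta> \<in> Gd" for \<theta>
    proof -
      from that obtain j where j: "j < J" "\<theta> \<in> E j" "1 - e \<le> g j \<theta>" by (auto simp: Gd_def H_def)
      have e1: "e < 1" using e_small \<eta> e0 by simp
      have "h j \<theta> \<le> (\<Sum>j<J. h j \<theta>)" using j by (intro member_le_sum h0) auto
      moreover have "\<theta> \<in> C" using that GdC by blast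
      ultimately have TT: "Re (trace (A n \<theta>)) + g j \<theta> * Re (trace (matrix_inv (V j) ** F n \<theta>)) \<le> T \<theta>"
        unfolding T_def h_def by simp
      note low = trace_sum_lower[OF V[rule_format] near[rule_format, OF j(2)] e0 e1 j(3), of n]
      show "(1 - e) * (2 * p) \<le> T \<theta>" using low(1) TT unfolding p_def by linarith
      assume "T \<theta> < (1 - e) * (2 * p + \<kappa>)"
      then show "near (3 * \<eta>) (mat 1) (A n \<theta>)"
        using TT e_small e0 \<eta> unfolding p_def \<kappa>_def by (intro low(2)) auto
    qed
    have "(\<integral>\<theta>. (1 - e) * (2 * p * indicator Gd \<theta> + \<kappa> * indicator Z \<theta>) \<partial>circ) \<le> (\<integral>\<theta>. T \<theta> \<partial>circ)"
    proof (intro integral_mono iT)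
      show "integrable circ (\<lambda>\<theta>. (1 - e) * (2 * p * indicator Gd \<theta> + \<kappa> * indicator Z \<theta>))"
        by (intro integrable_mult_right Bochner_Integration.integrable_add integrable_real_indicator)
          (auto simp: circ.emeasure_eq_measure)
      show "(1 - e) * (2 * p * indicator Gd \<theta> + \<kappa> * indicator Z \<theta>) \<le> T \<theta>" for \<theta>
      proof (cases "\<theta> \<in> Gd")
        case True
        then show ?thesis using on_Gd(1)[OF True] by (cases "\<theta> \<in> Z") (auto simp: Z_def)
      next
        case False
        then show ?thesis using T0[of \<theta>] by (simp add: Z_def)
      qed
    qed
    also have "(\<integral>\<theta>. (1 - e) * (2 * p * indicator Gd \<theta> + \<kappa> * indicator Z \<theta>) \<partial>circ)
        = (1 - e) * (2 * p * measure circ Gd + \<kappa> * measure circ Z)"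
    proof -
      have "integrable circ (indicator Gd :: real \<Rightarrow> real)" "integrable circ (indicator Z :: real \<Rightarrow> real)"
        by (intro integrable_real_indicator; simp add: circ.emeasure_eq_measure)+
      then show ?thesis by simp
    qed
    finally have "(1 - e) * (2 * p * measure circ Gd + \<kappa> * measure circ Z) \<le> 2 * p + p * e + e"
      using T_int by simp
    moreover have "(1 - e) * (2 * p * (1 - 2 * e) + \<kappa> * measure circ Z) \<le> (1 - e) * (2 * p * measure circ Gd + \<kappa> * measure circ Z)"
      using mGd e_small \<eta> e0 p \<kappa> by (intro mult_left_mono add_mono) auto
    ultimately have main: "(1 - e) * (2 * p * (1 - 2 * e) + \<kappa> * measure circ Z) \<le> 2 * p + p * e + e" by simp
    \<comment> \<open>The errors add up to at most \<open>8 * p * e\<close>, and division by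
      \<open>1 - e\<close> at most doubles this, since \<open>e \<le> 1 / 2\<close>.\<close>
    have mZ: "\<kappa> * measure circ Z \<le> 16 * p * e"
    proof -
      define z where "z = \<kappa> * measure circ Z"
      have z: "0 \<le> z" using \<kappa> by (simp add: z_def)
      have "e * z \<le> (1 / 2) * z" using e_small \<eta> z by (intro mult_right_mono) auto
      moreover have "(1 - e) * z \<le> 2 * p + p * e + e - 2 * p * ((1 - e) * (1 - 2 * e))"
        using main unfolding z_def[symmetric] by (simp add: algebra_simps)
      moreover have "2 * p * ((1 - e) * (1 - 2 * e)) = 2 * p - 6 * (p * e) + 4 * (p * (e * e))" by (simp add: algebra_simps)
      moreover have "0 \<le> p * (e * e)" using p by simp
      moreover have "e \<le> p * e" using p e0 by simp
      ultimately show ?thesis unfolding z_def[symmetric] by (simp add: algebra_simps)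
    qed
    have "16 * p * e = \<kappa> * (\<eta> / 2)" using e32 by (simp add: field_simps)
    with mZ have "\<kappa> * measure circ Z \<le> \<kappa> * (\<eta> / 2)" by simp
    then have mZ': "measure circ Z \<le> \<eta> / 2" using \<kappa> by simp
    show "\<exists>Y\<in>sets borel. 1 - \<eta> \<le> measure circ Y \<and> (\<forall>\<theta>\<in>Y. near (3 * \<eta>) (mat 1) (A n \<theta>))"
    proof (intro bexI conjI ballI)
      have "measure circ (Gd - Z) = measure circ Gd - measure circ Z"
        by (intro circ.finite_measure_Diff) (auto simp: Z_def)
      then show "1 - \<eta> \<le> measure circ (Gd - Z)" using mGd mZ' e_small e0 by simp
      show "near (3 * \<eta>) (mat 1) (A n \<theta>)" if "\<theta> \<in> Gd - Z" for \<theta>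
        using that by (intro on_Gd(2)) (auto simp: Z_def)
    qed simp
  qed
qed

text \<open>\<open>A m\<close> near the identity bounds the form of \<open>W\<close> by
  \<open>1 + e\<close> times that of \<open>F m\<close>, and congruence by \<open>\<phi> n\<close>
  turns the lower bound for \<open>A n\<close> into one for \<open>G n m\<close>. Control from above
  will come from the trace of \<open>G n m\<close>, whose integral is known.\<close>

lemma G_lower:
  assumes A1: "near e (mat 1) (A n \<theta>)" and A2: "near e (mat 1) (A m \<theta>)" and e: "0 \<le> e"
  shows "(1 - e) / (1 + e) * (norm x)\<^sup>2 \<le> Re (row_form (G n m \<theta>) x x)"
proof -
  have WF: "Re (row_form (W \<theta>) u u) \<le> (1 + e) * Re (row_form (F m \<theta>) u u)" for u
  proof -
    have "Re (row_form (A m \<theta>) (u v* \<Psi> m \<theta>) (u v* \<Psi> m \<theta>)) \<le> (1 + e) * Re (row_form (mat 1) (u v* \<Psi> m \<theta>) (u v* \<Psi> m \<theta>))"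
      using A2 unfolding near_def by blast
    then show ?thesis by (simp add: row_form_A row_form_F vector_matrix_mul_assoc)
  qed
  have "(1 - e) * (norm x)\<^sup>2 \<le> Re (row_form (A n \<theta>) x x)"
    using A1 unfolding near_def row_form_mat1 by simp
  also have "\<dots> \<le> (1 + e) * Re (row_form (G n m \<theta>) x x)"
    unfolding row_form_A row_form_G by (rule WF)
  finally show ?thesis using e by (simp add: field_simps)
qed

lemma spectral_norm_G_le:
  "spectral_norm (G n m \<theta> - mat 1) \<le> Re (trace (G n m \<theta>)) + 1"
proof -
  have "spectral_norm (G n m \<theta> + (- 1) *\<^sub>R mat 1) \<le> spectral_norm (G n m \<theta>) + spectral_norm ((- 1) *\<^sub>R mat 1 :: complex^'p^'p)"
    by (rule spectral_norm_add_le)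
  with spectral_norm_psd_le_trace[OF psd_G, of n m \<theta>] spectral_norm_scaleR_mat1[where c = "- 1" and 'p = 'p]
  show ?thesis by simp
qed

text \<open>\<open>G - 1\<close> splits into \<open>G - c\<close> and \<open>c - 1\<close>. The
  first is positive semidefinite, so its norm is at most its trace, which can be integrated
  exactly.\<close>

lemma spectral_norm_G_le':
  assumes "\<And>x. c * (norm x)\<^sup>2 \<le> Re (row_form (G n m \<theta>) x x)" "c \<le> 1"
  shows "spectral_norm (G n m \<theta> - mat 1) \<le> Re (trace (G n m \<theta>)) - c * CARD('p) + 1 - c"
proof -
  let ?D = "G n m \<theta> - c *\<^sub>R mat 1"
  have "hermitian_psd ?D"
  proof (rule hermitian_psdI)
    have "htranspose (G n m \<theta>) = G n m \<theta>" using psd_G by (simp add: hermitian_psd_def)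
    then show "htranspose ?D = ?D"
      by (simp add: htranspose_def transpose_def vec_eq_iff mat_def) 
    show "0 \<le> Re (row_form ?D u u)" for u
      using assms(1)[of u] by (simp add: row_form_diff_matrix row_form_scaleR_matrix row_form_mat1)
  qed
  then have 1: "spectral_norm ?D \<le> Re (trace ?D)" by (rule spectral_norm_psd_le_trace)
  have 2: "Re (trace ?D) = Re (trace (G n m \<theta>)) - c * CARD('p)"
    by (simp add: trace_def mat_def sum_subtractf)
  have "G n m \<theta> - mat 1 = ?D + (c - 1) *\<^sub>R mat 1" by (simp add: algebra_simps)
  then have "spectral_norm (G n m \<theta> - mat 1) \<le> spectral_norm ?D + spectral_norm ((c - 1) *\<^sub>R mat 1 :: complex^'p^'p)"
    by (simp only: spectral_norm_add_le)
  with 1 2 spectral_norm_scaleR_mat1[where c = "c - 1" and 'p = 'p] assms(2) show ?thesis by simp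
qed

end

section \<open>The two implications\<close>

context orthonormal_system
begin

definition deviation :: "nat \<Rightarrow> nat \<Rightarrow> ennreal" where
  "deviation n m = ennreal (1 / (2*pi)) *
     (\<integral>\<^sup>+\<theta>\<in>{0..<2*pi}. ennreal (spectral_norm (G n m \<theta> - mat 1)) \<partial>lborel)"

text \<open>The nonnegative integral is monotone for arbitrary functions, so comparison with a
  measurable \<open>q\<close> avoids the measurability of the spectral norm.\<close>

lemma deviation_le:
  assumes "q \<in> borel_measurable borel" "\<And>\<theta>. ennreal (spectral_norm (G n m \<theta> - mat 1)) \<le> q \<theta>"
  shows "deviation n m \<le> (\<integral>\<^sup>+\<theta>. q \<theta> \<partial>circ)"
  unfolding deviation_def nn_integral_circ[OF assms(1)]
  by (intro mult_left_mono nn_integral_mono mult_right_mono assms) auto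

lemma deviation_ge:
  assumes "q \<in> borel_measurable borel" "\<And>\<theta>. q \<theta> \<le> ennreal (spectral_norm (G n m \<theta> - mat 1))"
  shows "(\<integral>\<^sup>+\<theta>. q \<theta> \<partial>circ) \<le> deviation n m"
  unfolding deviation_def nn_integral_circ[OF assms(1)]
  by (intro mult_left_mono nn_integral_mono mult_right_mono assms) auto

text \<open>The Scheffe step: the integral of the trace of \<open>G n m\<close> is fixed, so a lower
  bound \<open>c\<close> on \<open>Y\<close> leaves only the contributions of \<open>1 - c\<close>
  and of the complement of \<open>Y\<close>.\<close>

lemma deviation_upper:
  assumes Y: "Y \<in> sets borel" and nm: "n \<le> m" and c: "0 \<le> c" "c \<le> 1"
    and low: "\<And>\<theta> x. \<theta> \<in> Y \<Longrightarrow> c * (norm x)\<^sup>2 \<le> Re (row_form (G n m \<theta>) x x)"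
  shows "deviation n m \<le> ennreal ((CARD('p) + 1) * (1 - c * measure circ Y))"
proof -
  \<comment> \<open>On \<open>Y\<close> this is the bound of \<open>spectral_norm_G_le'\<close>,
    elsewhere that of \<open>spectral_norm_G_le\<close>.\<close>
  define q where "q \<theta> = Re (trace (G n m \<theta>)) + 1 - c * (CARD('p) + 1) * indicator Y \<theta>" for \<theta>
  have le: "spectral_norm (G n m \<theta> - mat 1) \<le> q \<theta>" for \<theta>
    using spectral_norm_G_le[of n m \<theta>] spectral_norm_G_le'[OF low, of \<theta>] c
    by (cases "\<theta> \<in> Y") (auto simp: q_def algebra_simps)
  have q0: "0 \<le> q \<theta>" for \<theta> using order_trans[OF spectral_norm_nonneg le] .
  have iY: "integrable circ (indicator Y :: real \<Rightarrow> real)"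
    using Y by (intro integrable_real_indicator) (auto simp: circ.emeasure_eq_measure)
  have iq: "integrable circ q"
    unfolding q_def
    by (intro Bochner_Integration.integrable_diff Bochner_Integration.integrable_add integral_trace_G(2)[OF nm] integrable_mult_right iY) simp
  have "q \<in> borel_measurable borel" using borel_measurable_integrable[OF iq] by simp
  then have "deviation n m \<le> (\<integral>\<^sup>+\<theta>. ennreal (q \<theta>) \<partial>circ)"
    by (intro deviation_le ennreal_leI le) measurable
  also have "\<dots> = ennreal (\<integral>\<theta>. q \<theta> \<partial>circ)"
    by (intro nn_integral_eq_integral iq AE_I2 q0)
  also have "(\<integral>\<theta>. q \<theta> \<partial>circ) = CARD('p) + 1 - c * (CARD('p) + 1) * measure circ Y"
    using iY integral_trace_G[OF nm] Y unfolding q_def by simp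
  also have "\<dots> = (CARD('p) + 1) * (1 - c * measure circ Y)" by (simp add: algebra_simps)
  finally show ?thesis .
qed

lemma deviation_tendsto:
  assumes pd: "AE \<theta> in circ. posdef (W \<theta>)"
  shows "(\<lambda>n. SUP l\<in>{1..}. deviation n (n + l)) \<longlonglongrightarrow> 0"
proof (rule order_tendstoI)
  fix a :: ennreal assume "0 < a"
  then obtain b where b: "0 < b" "b < a" using dense by blast
  then have "b < top" using order_less_le_trans[OF b(2) top_greatest] by simp
  define r where "r = enn2real b"
  have r: "b = ennreal r" "0 < r" using b \<open>b < top\<close> by (auto simp: r_def enn2real_positive_iff)
  define p where "p = real CARD('p) + 1"
  have p: "1 \<le> p" by (simp add: p_def)
  \<comment> \<open>\<open>1 / 3\<close> keeps \<open>c\<close> below nonnegative, and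
    \<open>r / (8 * p)\<close> brings the final bound \<open>8 * p * \<eta>\<close> down to
    \<open>r\<close>. Here \<open>p\<close> is the dimension plus 1.\<close>
  define \<eta> where "\<eta> = min (1 / 3) (r / (8 * p))"
  have \<eta>: "0 < \<eta>" "\<eta> \<le> 1" "3 * \<eta> \<le> 1" "8 * p * \<eta> \<le> r"
  proof -
    have "\<eta> \<le> r / (8 * p)" by (simp add: \<eta>_def)
    then show "8 * p * \<eta> \<le> r" using p by (simp add: field_simps)
    have "\<eta> \<le> 1 / 3" by (simp add: \<eta>_def)
    then show "\<eta> \<le> 1" "3 * \<eta> \<le> 1" by simp_all
  qed (use r p in \<open>simp add: \<eta>_def\<close>)
  obtain n0 where n0: "\<forall>n\<ge>n0. \<exists>Y\<in>sets borel. 1 - \<eta> \<le> measure circ Y \<and> (\<forall>\<theta>\<in>Y. near (3 * \<eta>) (mat 1) (A n \<theta>))"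
    using A_near_identity[OF pd \<eta>(1,2)] by (elim exE)
  have "deviation n m \<le> b" if n: "n0 \<le> n" "n \<le> m" for n m
  proof -
    obtain Y1 where Y1: "Y1 \<in> sets borel" "1 - \<eta> \<le> measure circ Y1" "\<forall>\<theta>\<in>Y1. near (3 * \<eta>) (mat 1) (A n \<theta>)"
      using n0[rule_format, OF n(1)] by (elim bexE conjE)
    obtain Y2 where Y2: "Y2 \<in> sets borel" "1 - \<eta> \<le> measure circ Y2" "\<forall>\<theta>\<in>Y2. near (3 * \<eta>) (mat 1) (A m \<theta>)"
      using n0[rule_format, OF order_trans[OF n]] by (elim bexE conjE)
    define c where "c = (1 - 3 * \<eta>) / (1 + 3 * \<eta>)"
    have c: "0 \<le> c" "c \<le> 1" using \<eta> by (simp_all add: c_def)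
    have "deviation n m \<le> ennreal ((CARD('p) + 1) * (1 - c * measure circ (Y1 \<inter> Y2)))"
    proof (rule deviation_upper[OF _ n(2) c])
      fix \<theta> x assume "\<theta> \<in> Y1 \<inter> Y2"
      then show "c * (norm x)\<^sup>2 \<le> Re (row_form (G n m \<theta>) x x)"
        unfolding c_def using Y1(3) Y2(3) \<eta> by (intro G_lower) auto
    qed (use Y1 Y2 in auto)
    also have "\<dots> \<le> ennreal (8 * p * \<eta>)"
    proof (rule ennreal_leI)
      have "measure circ (Y1 \<union> Y2) = measure circ Y1 + measure circ Y2 - measure circ (Y1 \<inter> Y2)"
        using Y1 Y2 by (intro measure_Un3) (auto simp: fmeasurable_def circ.emeasure_eq_measure less_top)
      moreover have "measure circ (Y1 \<union> Y2) \<le> 1" using circ.bounded_measure[of "Y1 \<union> Y2"] by simp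
      ultimately have Y: "1 - 2 * \<eta> \<le> measure circ (Y1 \<inter> Y2)" using Y1(2) Y2(2) by simp
      \<comment> \<open>The loss is \<open>6 * \<eta>\<close> from \<open>c\<close> and
        \<open>2 * \<eta>\<close> from the measure of the intersection.\<close>
      have "1 - 6 * \<eta> \<le> c"
      proof -
        have "(1 - 6 * \<eta>) * (1 + 3 * \<eta>) \<le> 1 - 3 * \<eta>" using \<eta> by (simp add: algebra_simps)
        then show ?thesis using \<eta> by (simp add: c_def pos_le_divide_eq)
      qed
      then have "1 - 8 * \<eta> \<le> c * (1 - 2 * \<eta>)"
      proof -
        assume a: "1 - 6 * \<eta> \<le> c"
        have "c * (2 * \<eta>) \<le> 1 * (2 * \<eta>)" using c \<eta> by (intro mult_right_mono) auto
        then show ?thesis using a by (simp add: algebra_simps)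
      qed
      also have "\<dots> \<le> c * measure circ (Y1 \<inter> Y2)" using c Y by (intro mult_left_mono) auto
      finally have "1 - c * measure circ (Y1 \<inter> Y2) \<le> 8 * \<eta>" by simp
      then have "p * (1 - c * measure circ (Y1 \<inter> Y2)) \<le> p * (8 * \<eta>)" using p by (intro mult_left_mono) auto
      then show "(CARD('p) + 1) * (1 - c * measure circ (Y1 \<inter> Y2)) \<le> 8 * p * \<eta>"
        by (simp add: p_def algebra_simps)
    qed
    also have "\<dots> \<le> b" unfolding r(1) by (rule ennreal_leI) (rule \<eta>(4))
    finally show ?thesis .
  qed
  then have "(SUP l\<in>{1..}. deviation n (n + l)) \<le> b" if "n0 \<le> n" for n
    using that by (intro SUP_least) auto
  then have "(SUP l\<in>{1..}. deviation n (n + l)) < a" if "n0 \<le> n" for n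
    using le_less_trans[OF _ b(2)] that by simp
  then show "eventually (\<lambda>n. (SUP l\<in>{1..}. deviation n (n + l)) < a) sequentially"
    by (auto simp: eventually_sequentially)
qed simp

text \<open>The indicator is replaced by a polynomial \<open>g\<close>, and \<open>A n\<close> by
  \<open>G n m\<close> for one \<open>m\<close> large enough for \<open>g\<close>. The bound on the
  deviation is uniform in \<open>m\<close>, so it survives this choice.\<close>

lemma integral_A_minus_identity:
  assumes E: "E \<in> sets borel" "E \<subseteq> C" and dev: "\<And>m. n < m \<Longrightarrow> deviation n m \<le> ennreal \<epsilon>" and \<epsilon>: "0 \<le> \<epsilon>"
  shows "cmod (\<integral>\<theta>. indicator E \<theta> * (A n \<theta> - mat 1) $ i $ j \<partial>circ) \<le> \<epsilon>"
proof (rule field_le_epsilon)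
  fix e :: real assume "0 < e"
  \<comment> \<open>For this \<open>\<delta>\<close> the total error
    \<open>(1 + \<delta>) * \<epsilon> + \<delta> + \<delta>\<close> equals
    \<open>\<epsilon> + e\<close>.\<close>
  define \<delta> where "\<delta> = e / (2 + \<epsilon>)"
  have \<delta>: "0 < \<delta>" using \<open>0 < e\<close> \<epsilon> by (simp add: \<delta>_def)
  obtain q g where g: "trig q (\<lambda>\<theta>. complex_of_real (g \<theta>))" "\<forall>\<theta>. 0 \<le> g \<theta>" "\<forall>\<theta>. g \<theta> \<le> 1 + \<delta>"
    "(\<integral>\<theta>. \<bar>g \<theta> - indicator E \<theta>\<bar> \<partial>circ) \<le> \<delta>"
    and ap: "\<forall>m\<ge>q + (n + n). \<forall>i j. cmod ((\<integral>\<theta>. complex_of_real (g \<theta>) * G n m \<theta> $ i $ j \<partial>circ)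
      - (\<integral>\<theta>. indicator E \<theta> * A n \<theta> $ i $ j \<partial>circ)) \<le> \<delta>"
    using integral_A_approx[OF E \<delta>, of n] by (elim exE conjE)
  \<comment> \<open>The final \<open>1\<close> gives \<open>n < m\<close> even when \<open>q\<close>
    and \<open>n\<close> are 0.\<close>
  define m where "m = q + (n + n) + 1"
  have nm: "n < m" by (simp add: m_def)
  let ?I = "mat 1 :: complex^'p^'p"
  let ?D = "\<lambda>\<theta>. (G n m \<theta> - ?I) $ i $ j"
  have bg: "bounded_borel (\<lambda>\<theta>. complex_of_real (g \<theta>))" by (rule bounded_borel_trig[OF g(1)])
  have bE: "bounded_borel (indicator E)" by (rule bounded_borel_indicator[OF E(1)])
  have bD: "bounded_borel ?D"
    using bounded_borel_add[OF bounded_G bounded_borel_const[of "- ?I $ i $ j"]] by simp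
  have int: "integrable circ (\<lambda>\<theta>. complex_of_real (g \<theta>) * G n m \<theta> $ i $ j)"
    "integrable circ (\<lambda>\<theta>. complex_of_real (g \<theta>) * ?I $ i $ j)"
    "integrable circ (\<lambda>\<theta>. complex_of_real (g \<theta>) * ?D \<theta>)"
    "integrable circ (\<lambda>\<theta>. indicator E \<theta> * ?I $ i $ j)"
    by (intro bounded_borel_integrable_circ bounded_borel_mult bg bE bD bounded_G bounded_borel_const)+
  have "cmod (\<integral>\<theta>. complex_of_real (g \<theta>) * ?D \<theta> \<partial>circ) \<le> (\<integral>\<theta>. cmod (complex_of_real (g \<theta>) * ?D \<theta>) \<partial>circ)"
    by (rule integral_norm_bound)
  also have "\<dots> \<le> (\<integral>\<theta>. (1 + \<delta>) * cmod (?D \<theta>) \<partial>circ)"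
    using g(2,3) by (intro integral_mono integrable_norm int integrable_mult_right bounded_borel_integrable_circ bD)
      (simp add: norm_mult mult_right_mono)
  also have "\<dots> = (1 + \<delta>) * (\<integral>\<theta>. cmod (?D \<theta>) \<partial>circ)" by simp
  also have "\<dots> \<le> (1 + \<delta>) * \<epsilon>"
  proof (intro mult_left_mono)
    have "ennreal (\<integral>\<theta>. cmod (?D \<theta>) \<partial>circ) = (\<integral>\<^sup>+\<theta>. ennreal (cmod (?D \<theta>)) \<partial>circ)"
      by (intro nn_integral_eq_integral[symmetric] integrable_norm bounded_borel_integrable_circ bD) simp
    also have "\<dots> \<le> deviation n m"
    proof (intro deviation_ge ennreal_leI norm_entry_le_spectral_norm)
      show "(\<lambda>\<theta>. ennreal (cmod (?D \<theta>))) \<in> borel_measurable borel"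
        by (rule measurable_compose[OF bounded_borel_measurable[OF bD]]) measurable
    qed
    also have "\<dots> \<le> ennreal \<epsilon>" by (rule dev[OF nm])
    finally show "(\<integral>\<theta>. cmod (?D \<theta>) \<partial>circ) \<le> \<epsilon>" using \<epsilon> by simp
  qed (use \<delta> in simp)
  finally have 1: "cmod (\<integral>\<theta>. complex_of_real (g \<theta>) * ?D \<theta> \<partial>circ) \<le> (1 + \<delta>) * \<epsilon>" .
  have 2: "cmod ((\<integral>\<theta>. complex_of_real (g \<theta>) * G n m \<theta> $ i $ j \<partial>circ) - (\<integral>\<theta>. indicator E \<theta> * A n \<theta> $ i $ j \<partial>circ)) \<le> \<delta>"
    using ap by (simp add: m_def)
  have 3: "cmod ((\<integral>\<theta>. complex_of_real (g \<theta>) * ?I $ i $ j \<partial>circ) - (\<integral>\<theta>. indicator E \<theta> * ?I $ i $ j \<partial>circ)) \<le> \<delta>"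
  proof -
    have "(\<integral>\<theta>. complex_of_real (g \<theta>) * ?I $ i $ j \<partial>circ) - (\<integral>\<theta>. indicator E \<theta> * ?I $ i $ j \<partial>circ)
        = (\<integral>\<theta>. complex_of_real (g \<theta>) * ?I $ i $ j - indicator E \<theta> * ?I $ i $ j \<partial>circ)"
      by (rule Bochner_Integration.integral_diff[OF int(2,4), symmetric])
    also have "cmod \<dots> \<le> (\<integral>\<theta>. cmod (complex_of_real (g \<theta>) * ?I $ i $ j - indicator E \<theta> * ?I $ i $ j) \<partial>circ)"
      by (rule integral_norm_bound)
    also have "\<dots> \<le> (\<integral>\<theta>. \<bar>g \<theta> - indicator E \<theta>\<bar> \<partial>circ)"
    proof (rule integral_mono)
      show "integrable circ (\<lambda>\<theta>. cmod (complex_of_real (g \<theta>) * ?I $ i $ j - indicator E \<theta> * ?I $ i $ j))"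
        by (intro integrable_norm Bochner_Integration.integrable_diff int)
      show "integrable circ (\<lambda>\<theta>. \<bar>g \<theta> - indicator E \<theta>\<bar>)"
        by (intro integrable_abs_diff_indicator[OF g(1) E(1)] finite_measure_circ sets_circ)
      show "cmod (complex_of_real (g \<theta>) * ?I $ i $ j - indicator E \<theta> * ?I $ i $ j) \<le> \<bar>g \<theta> - indicator E \<theta>\<bar>" for \<theta>
        unfolding left_diff_distrib[symmetric] norm_mult cmod_diff_indicator by (simp add: mat_def)
    qed
    finally show ?thesis using g(4) by simp
  qed
  have D: "(\<integral>\<theta>. complex_of_real (g \<theta>) * ?D \<theta> \<partial>circ)
      = (\<integral>\<theta>. complex_of_real (g \<theta>) * G n m \<theta> $ i $ j \<partial>circ) - (\<integral>\<theta>. complex_of_real (g \<theta>) * ?I $ i $ j \<partial>circ)"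
    using Bochner_Integration.integral_diff[OF int(1,2)] by (simp add: right_diff_distrib)
  have AA: "(\<integral>\<theta>. indicator E \<theta> * (A n \<theta> - ?I) $ i $ j \<partial>circ)
      = (\<integral>\<theta>. indicator E \<theta> * A n \<theta> $ i $ j \<partial>circ) - (\<integral>\<theta>. indicator E \<theta> * ?I $ i $ j \<partial>circ)"
    using Bochner_Integration.integral_diff[OF integrable_A[OF E(1)] int(4)] by (simp add: right_diff_distrib)
  have tri: "cmod (a' - b') \<le> cmod (a - b) + cmod (a - a') + cmod (b - b')" for a b a' b' :: complex
  proof -
    have "a' - b' = (a - b) - (a - a') + (b - b')" by simp
    then show ?thesis by (metis norm_triangle_ineq norm_triangle_ineq4 add_right_mono order_trans)
  qed
  have "cmod (\<integral>\<theta>. indicator E \<theta> * (A n \<theta> - ?I) $ i $ j \<partial>circ) \<le> (1 + \<delta>) * \<epsilon> + \<delta> + \<delta>"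
    unfolding AA using order_trans[OF tri add_mono[OF add_mono[OF 1[unfolded D] 2] 3]] .
  also have "\<dots> = \<epsilon> + \<delta> * (2 + \<epsilon>)" by (simp add: algebra_simps)
  also have "\<dots> = \<epsilon> + e" using \<epsilon> by (simp add: \<delta>_def)
  finally show "cmod (\<integral>\<theta>. indicator E \<theta> * (A n \<theta> - ?I) $ i $ j \<partial>circ) \<le> \<epsilon> + e" .
qed

text \<open>The subsets of \<open>S\<close> where \<open>f\<close> is nonnegative and where it is
  negative contribute at most \<open>\<epsilon>\<close> each.\<close>

lemma integral_abs_le_of_subsets:
  fixes f :: "real \<Rightarrow> real"
  assumes f: "integrable circ f" and S: "S \<in> sets borel"
    and le: "\<And>E. E \<in> sets borel \<Longrightarrow> E \<subseteq> S \<Longrightarrow> \<bar>\<integral>\<theta>. indicator E \<theta> * f \<theta> \<partial>circ\<bar> \<le> \<epsilon>"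
  shows "(\<integral>\<theta>. indicator S \<theta> * \<bar>f \<theta>\<bar> \<partial>circ) \<le> 2 * \<epsilon>"
proof -
  have [measurable]: "f \<in> borel_measurable borel" "S \<in> sets borel"
    using borel_measurable_integrable[OF f] S by simp_all
  define P Q where "P = S \<inter> {\<theta>. 0 \<le> f \<theta>}" and "Q = S \<inter> {\<theta>. f \<theta> < 0}"
  have [measurable]: "P \<in> sets borel" "Q \<in> sets borel" unfolding P_def Q_def by measurable
  have i: "integrable circ (\<lambda>\<theta>. indicator E \<theta> * f \<theta>)" if "E \<in> sets borel" for E
    using integrable_mult_indicator[OF _ f, of E] that by simp
  have "(\<integral>\<theta>. indicator S \<theta> * \<bar>f \<theta>\<bar> \<partial>circ) = (\<integral>\<theta>. indicator P \<theta> * f \<theta> - indicator Q \<theta> * f \<theta> \<partial>circ)"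
    by (intro Bochner_Integration.integral_cong refl) (auto simp: P_def Q_def indicator_def)
  also have "\<dots> = (\<integral>\<theta>. indicator P \<theta> * f \<theta> \<partial>circ) - (\<integral>\<theta>. indicator Q \<theta> * f \<theta> \<partial>circ)"
    by (intro Bochner_Integration.integral_diff i) simp_all
  finally show ?thesis using le[of P] le[of Q] by (auto simp: P_def Q_def abs_le_iff)
qed

text \<open>Where \<open>W\<close> is singular, a null vector of \<open>W\<close> pulled back by
  \<open>\<phi> n\<close> is one of \<open>A n\<close>, so the moduli of the entries of
  \<open>A n - 1\<close> sum to at least 1, whatever \<open>n\<close> is. Their integrals over the
  set of such points are small for suitable \<open>n\<close>, so this set is null.\<close>

lemma posdef_of_deviation:
  assumes lim: "(\<lambda>n. SUP l\<in>{1..}. deviation n (n + l)) \<longlonglongrightarrow> 0"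
  shows "AE \<theta> in circ. posdef (W \<theta>)"
proof -
  define S where "S = C \<inter> {\<theta>. \<not> 0 < det (W \<theta>)}"
  have [measurable]: "(\<lambda>\<theta>. det (W \<theta>)) \<in> borel_measurable borel"
    by (rule measurable_compose[OF W_measurable])
      (intro borel_measurable_continuous_onI continuous_on_det continuous_intros)
  have [measurable]: "S \<in> sets borel" unfolding S_def less_complex_def by measurable
  have SC: "S \<subseteq> C" by (simp add: S_def)
  have "measure circ S \<le> 0"
  proof (rule field_le_epsilon)
    fix e :: real assume "0 < e"
    \<comment> \<open>Each entry contributes at most \<open>4 * \<epsilon>\<close>: a real and an
      imaginary part, each with the factor 2 of \<open>integral_abs_le_of_subsets\<close>.\<close>
    define \<epsilon> where "\<epsilon> = e / (4 * (CARD('p))\<^sup>2)"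
    have \<epsilon>: "0 < \<epsilon>" using \<open>0 < e\<close> by (simp add: \<epsilon>_def)
    have "eventually (\<lambda>n. (SUP l\<in>{1..}. deviation n (n + l)) < ennreal \<epsilon>) sequentially"
      using order_tendstoD(2)[OF lim] \<epsilon> by simp
    then obtain n where n: "(SUP l\<in>{1..}. deviation n (n + l)) < ennreal \<epsilon>" by (auto simp: eventually_sequentially)
    have dev: "deviation n m \<le> ennreal \<epsilon>" if "n < m" for m
    proof -
      have "deviation n m = deviation n (n + (m - n))" using that by simp
      also have "\<dots> \<le> (SUP l\<in>{1..}. deviation n (n + l))" using that by (intro SUP_upper) auto
      finally show ?thesis using n by simp
    qed
    let ?Y = "\<lambda>i j \<theta>. indicator C \<theta> * (A n \<theta> - mat 1) $ i $ j"
    have iY: "integrable circ (?Y i j)" for i j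
    proof -
      have "integrable circ (\<lambda>\<theta>. indicator C \<theta> * A n \<theta> $ i $ j - indicator C \<theta> * (mat 1 :: complex^'p^'p) $ i $ j)"
        by (intro Bochner_Integration.integrable_diff integrable_A bounded_borel_integrable_circ bounded_borel_mult
            bounded_borel_indicator bounded_borel_const) simp_all
      then show ?thesis by (simp add: right_diff_distrib)
    qed
    have sub: "cmod (\<integral>\<theta>. indicator E \<theta> * ?Y i j \<theta> \<partial>circ) \<le> \<epsilon>" if "E \<in> sets borel" "E \<subseteq> S" for E i j
    proof -
      have "indicator E \<theta> * ?Y i j \<theta> = indicator E \<theta> * (A n \<theta> - mat 1) $ i $ j" for \<theta>
        using that SC by (auto simp: indicator_def)
      moreover have "E \<subseteq> C" using that(2) SC by blast
      ultimately show ?thesis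
        using integral_A_minus_identity[OF that(1) _ dev, of i j] \<epsilon> by (simp only: less_imp_le)
    qed
    have iE: "integrable circ (\<lambda>\<theta>. indicator E \<theta> * ?Y i j \<theta>)" if "E \<in> sets borel" for E i j
      using that by (intro bounded_bochner_integrable[OF iY, of _ 1]) (auto simp: indicator_def)
    have Y_le: "(\<integral>\<theta>. indicator S \<theta> * \<bar>Re (?Y i j \<theta>)\<bar> \<partial>circ) \<le> 2 * \<epsilon>"
      "(\<integral>\<theta>. indicator S \<theta> * \<bar>Im (?Y i j \<theta>)\<bar> \<partial>circ) \<le> 2 * \<epsilon>" for i j
    proof -
      have "(\<integral>\<theta>. indicator E \<theta> * Re (?Y i j \<theta>) \<partial>circ) = Re (\<integral>\<theta>. indicator E \<theta> * ?Y i j \<theta> \<partial>circ)"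
        "(\<integral>\<theta>. indicator E \<theta> * Im (?Y i j \<theta>) \<partial>circ) = Im (\<integral>\<theta>. indicator E \<theta> * ?Y i j \<theta> \<partial>circ)"
        if "E \<in> sets borel" for E
        unfolding integral_Re[OF iE[OF that], symmetric] integral_Im[OF iE[OF that], symmetric]
        by (intro Bochner_Integration.integral_cong refl; simp add: indicator_def)+
      then show "(\<integral>\<theta>. indicator S \<theta> * \<bar>Re (?Y i j \<theta>)\<bar> \<partial>circ) \<le> 2 * \<epsilon>"
        "(\<integral>\<theta>. indicator S \<theta> * \<bar>Im (?Y i j \<theta>)\<bar> \<partial>circ) \<le> 2 * \<epsilon>"
        using order_trans[OF abs_Re_le_cmod sub] order_trans[OF abs_Im_le_cmod sub]
        by (intro integral_abs_le_of_subsets integrable_Re integrable_Im iY; simp)+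
    qed
    have iS: "integrable circ (\<lambda>\<theta>. indicator S \<theta> * \<bar>Re (?Y i j \<theta>)\<bar>)" "integrable circ (\<lambda>\<theta>. indicator S \<theta> * \<bar>Im (?Y i j \<theta>)\<bar>)" for i j
      using integrable_mult_indicator[OF _ integrable_abs[OF integrable_Re[OF iY]], of S]
        integrable_mult_indicator[OF _ integrable_abs[OF integrable_Im[OF iY]], of S] by simp_all
    let ?U = "\<lambda>\<theta>. \<Sum>i\<in>UNIV. \<Sum>j\<in>UNIV. indicator S \<theta> * \<bar>Re (?Y i j \<theta>)\<bar> + indicator S \<theta> * \<bar>Im (?Y i j \<theta>)\<bar>"
    have one: "indicator S \<theta> \<le> ?U \<theta>" for \<theta>
    proof (cases "\<theta> \<in> S")
      case True
      then have \<theta>: "\<theta> \<in> C" using SC by blast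
      have "\<not> posdef (W \<theta>)" using True psd_det_pos_iff[OF W_psd[OF \<theta>]] by (simp add: S_def)
      then obtain x where x: "x \<noteq> 0" "\<not> 0 < Re (row_form (W \<theta>) x x)"
        using W_psd[OF \<theta>] by (auto simp: posdef_def hermitian_psd_def)
      then have x0: "Re (row_form (W \<theta>) x x) = 0" using hermitian_psd_nonneg[OF W_psd[OF \<theta>], of x] by simp
      define y where "y = x v* \<Psi> n \<theta>"
      have yx: "y v* \<Phi> n \<theta> = x" by (simp add: y_def vector_matrix_mul_assoc)
      have "y \<noteq> 0" using yx x(1) by auto
      let ?D = "A n \<theta> - mat 1"
      have "Re (row_form ?D y y) = - (norm y)\<^sup>2"
        by (simp add: row_form_diff_matrix row_form_A yx x0 row_form_mat1)
      then have "(norm y)\<^sup>2 \<le> cmod (row_form ?D y y)" using abs_Re_le_cmod[of "row_form ?D y y"] by simp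
      also have "\<dots> \<le> (\<Sum>i\<in>UNIV. \<Sum>j\<in>UNIV. norm y * cmod (?D $ i $ j) * norm y)"
        unfolding row_form_def
        by (intro sum_norm_le)
          (auto simp: norm_mult intro!: mult_mono Finite_Cartesian_Product.norm_nth_le)
      also have "\<dots> = (norm y)\<^sup>2 * (\<Sum>i\<in>UNIV. \<Sum>j\<in>UNIV. cmod (?D $ i $ j))"
        by (simp add: sum_distrib_left power2_eq_square mult_ac)
      finally have "1 \<le> (\<Sum>i\<in>UNIV. \<Sum>j\<in>UNIV. cmod (?D $ i $ j))" using \<open>y \<noteq> 0\<close> by simp
      also have "\<dots> \<le> ?U \<theta>"
      proof (intro sum_mono)
        fix i j
        show "cmod (?D $ i $ j) \<le> indicator S \<theta> * \<bar>Re (?Y i j \<theta>)\<bar> + indicator S \<theta> * \<bar>Im (?Y i j \<theta>)\<bar>"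
          using True \<theta> cmod_le[of "?D $ i $ j"] by simp
      qed
      finally show ?thesis using True by simp
    qed simp
    have "measure circ S = (\<integral>\<theta>. indicator S \<theta> \<partial>circ)" by simp
    also have "\<dots> \<le> (\<integral>\<theta>. ?U \<theta> \<partial>circ)"
    proof (rule integral_mono)
      show "integrable circ (indicator S :: real \<Rightarrow> real)"
        by (intro integrable_real_indicator) (auto simp: circ.emeasure_eq_measure)
      show "integrable circ ?U" by (intro Bochner_Integration.integrable_sum Bochner_Integration.integrable_add iS)
    qed (rule one)
    also have "\<dots> = (\<Sum>i\<in>UNIV. \<Sum>j\<in>UNIV. (\<integral>\<theta>. indicator S \<theta> * \<bar>Re (?Y i j \<theta>)\<bar> \<partial>circ) + (\<integral>\<theta>. indicator S \<theta> * \<bar>Im (?Y i j \<theta>)\<bar> \<partial>circ))"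
    proof -
      have "(\<integral>\<theta>. ?U \<theta> \<partial>circ) = (\<Sum>i\<in>UNIV. \<integral>\<theta>. (\<Sum>j\<in>UNIV. indicator S \<theta> * \<bar>Re (?Y i j \<theta>)\<bar> + indicator S \<theta> * \<bar>Im (?Y i j \<theta>)\<bar>) \<partial>circ)"
        by (intro Bochner_Integration.integral_sum Bochner_Integration.integrable_sum Bochner_Integration.integrable_add iS)
      also have "\<dots> = (\<Sum>i\<in>UNIV. \<Sum>j\<in>UNIV. \<integral>\<theta>. indicator S \<theta> * \<bar>Re (?Y i j \<theta>)\<bar> + indicator S \<theta> * \<bar>Im (?Y i j \<theta>)\<bar> \<partial>circ)"
        by (intro sum.cong refl Bochner_Integration.integral_sum Bochner_Integration.integrable_add iS)
      also have "\<dots> = (\<Sum>i\<in>UNIV. \<Sum>j\<in>UNIV. (\<integral>\<theta>. indicator S \<theta> * \<bar>Re (?Y i j \<theta>)\<bar> \<partial>circ) + (\<integral>\<theta>. indicator S \<theta> * \<bar>Im (?Y i j \<theta>)\<bar> \<partial>circ))"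
        by (intro sum.cong refl Bochner_Integration.integral_add iS)
      finally show ?thesis .
    qed
    also have "\<dots> \<le> (\<Sum>i\<in>(UNIV :: 'p set). \<Sum>j\<in>(UNIV :: 'p set). 2 * \<epsilon> + 2 * \<epsilon>)"
      by (intro sum_mono add_mono Y_le)
    also have "\<dots> = 0 + e" by (simp add: \<epsilon>_def power2_eq_square)
    finally show "measure circ S \<le> 0 + e" .
  qed
  then have "measure circ S = 0" by (simp add: measure_le_0_iff)
  then have "S \<in> null_sets circ" by (simp add: null_sets_def circ.emeasure_eq_measure)
  then have "AE \<theta> in circ. \<theta> \<notin> S" by (rule AE_not_in)
  with AE_C show ?thesis
  proof eventually_elim
    case (elim \<theta>)
    then have "0 < det (W \<theta>)" by (simp add: S_def)
    then show ?case using psd_det_pos_iff[OF W_psd[OF elim(1)]] by simp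
  qed
qed

end

theorem lemma3:
  fixes \<rho> \<rho>\<^sub>s :: "real set \<Rightarrow> complex^'p^'p"
    and \<rho>' :: "real \<Rightarrow> complex^'p^'p"
    and \<phi> :: "nat \<Rightarrow> (complex^'p^'p) poly"
  assumes "matrix_measure \<rho>"
    and "nondegenerate \<rho>"
    and "lebesgue_decomposition \<rho> \<rho>' \<rho>\<^sub>s"
    and "left_orthonormal \<rho> \<phi>"
  shows "(AE \<theta> in lborel. \<theta> \<in> {0..<2*pi} \<longrightarrow> 0 < det (\<rho>' \<theta>)) \<longleftrightarrow>
    (\<lambda>n. SUP l\<in>{1..}. ennreal (1 / (2*pi)) *
        (\<integral>\<^sup>+\<theta>\<in>{0..<2*pi}. ennreal (spectral_norm
            (mat_poly_eval (\<phi> n) (cis \<theta>)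
              ** matrix_inv (mat_poly_eval (\<phi> (n + l)) (cis \<theta>))
              ** matrix_inv (htranspose (mat_poly_eval (\<phi> (n + l)) (cis \<theta>)))
              ** htranspose (mat_poly_eval (\<phi> n) (cis \<theta>))
              - mat 1)) \<partial>lborel)) \<longlonglongrightarrow> 0"
proof -
  obtain W N where W: "decomposed_measure \<rho> W N" "\<And>\<theta>. \<theta> \<in> {0..<2*pi} \<Longrightarrow> W \<theta> = \<rho>' \<theta>"
    using decomposed_measure_exists[OF assms(1,3)] by blast
  interpret decomposed_measure \<rho> W N by (rule W(1))
  interpret orthonormal_system \<rho> W N \<phi> by unfold_locales (rule assms(2), rule assms(4))
  have "(AE \<theta> in lborel. \<theta> \<in> {0..<2*pi} \<longrightarrow> 0 < det (\<rho>' \<theta>)) \<longleftrightarrow> (AE \<theta> in circ. 0 < det (W \<theta>))"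
    unfolding AE_circ by (intro AE_cong) (auto simp: W(2))
  also have "\<dots> \<longleftrightarrow> (AE \<theta> in circ. posdef (W \<theta>))"
  proof -
    have "AE \<theta> in circ. (0 < det (W \<theta>)) = posdef (W \<theta>)"
      using AE_C by eventually_elim (rule psd_det_pos_iff[OF W_psd])
    then show ?thesis by (rule eventually_subst)
  qed
  also have "\<dots> \<longleftrightarrow> (\<lambda>n. SUP l\<in>{1..}. deviation n (n + l)) \<longlonglongrightarrow> 0"
    using deviation_tendsto posdef_of_deviation by blast
  finally show ?thesis unfolding deviation_def G_eq \<Phi>_def .
qed

end
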